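(* Let $\mathbb{F}$ be a field and let $G$ be any group. Consider a $G$-grading on $\mathrm{UT}_n^{(-)}(\mathbb{F})$. Then the essential support of the grading is commutative. Furthermore, the following two cases can occur: (1) Either the grading is practically graded isomorphic to an elementary grading $\Gamma_1(\eta)$. In this case, the grading is graded isomorphic to a practical elementary grading $\Gamma_1(\deg\mathrm{I},\eta)$, or (2) the grading is practically graded isomorphic to a type 2 grading $\Gamma_2(g,\eta)$. In this case, if $n\ge 3$, then the grading is graded isomorphic to a practical type 2 grading $\Gamma_2(\deg\mathrm{I},g,\eta)$. For $n=2$, the grading is graded isomorphic to $\Gamma_2(\deg\mathrm{I},\eta)$ if $\deg\mathrm{I}\ne(\deg\mathrm{I})^2=1$. Moreover, if $\mathrm{char}\,\mathbb{F}=2$, then (2) never happens. If $n=2$ and $\mathrm{char}\,\mathbb{F}\ne2$, then both (1) and (2) are true.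
   Context: $\mathrm{UT}_n^{(-)}=\mathrm{UT}_n^{(-)}(\mathbb{F})$ is the Lie algebra of upper triangular $n\times n$ matrices over $\mathbb{F}$ with bracket $[a,b]=ab-ba$; $e_{ij}$ are the matrix units, $\mathrm{I}$ is the identity matrix, and the centre is $\mathbb{F}\mathrm{I}$. The group $G$ is written multiplicatively with identity $1$. A $G$-grading on an algebra $\mathcal{A}$ is a vector space decomposition $\mathcal{A}=\bigoplus_{g\in G}\mathcal{A}_g$ with $\mathcal{A}_g\mathcal{A}_h\subseteq\mathcal{A}_{gh}$ for all $g,h\in G$; a nonzero $x\in\mathcal{A}_g$ is homogeneous with $\deg x=g$. In any $G$-grading on $\mathrm{UT}_n^{(-)}$ the matrix $\mathrm{I}$ is homogeneous. A $G$-graded isomorphism $f:\mathcal{A}\to\mathcal{B}$ is an algebra isomorphism with $f(\mathcal{A}_g)\subseteq\mathcal{B}_g$ for all $g$; two gradings on the same algebra are graded isomorphic if the corresponding graded algebras are. Two $G$-graded algebras $\mathcal{L}_1,\mathcal{L}_2$ are practically $G$-graded isomorphic if there is an isomorphism of ungraded algebras $\psi:\mathcal{L}_1\to\mathcal{L}_2$ inducing a $G$-graded isomorphism $\mathcal{L}_1/\mathfrak{z}(\mathcal{L}_1)\to\mathcal{L}_2/\mathfrak{z}(\mathcal{L}_2)$, where $\mathfrak{z}$ denotes the centre and the quotients carry the induced gradings. The essential support of a grading on $\mathcal{L}$ is $\{g\in G\mid\mathcal{L}_g\not\subseteq\mathfrak{z}(\mathcal{L})\}$; it is commutative if its elements commute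 pairwise. Elementary gradings: for a sequence $\eta=(g_1,\dots,g_{n-1})\in G^{n-1}$ of pairwise commuting elements, $\Gamma_1(\eta)$ is the grading in which every $e_{ij}$ is homogeneous, $\deg e_{ii}=1$ and $\deg e_{ij}=g_ig_{i+1}\cdots g_{j-1}$ for $i<j$. Practical elementary gradings: for such $\eta$ and any $t\in G$, choose a subspace $V$ of the space $\mathscr{D}$ of diagonal matrices with $\mathscr{D}=\mathbb{F}\mathrm{I}\oplus V$. Then $\Gamma_1(t,\eta)$ is the grading in which $e_{i,i+1}$ has degree $g_i$ (hence $\deg e_{ij}=g_i\cdots g_{j-1}$ for $i<j$), $\deg\mathrm{I}=t$, and every nonzero element of $V$ has degree $1$. Different choices of $V$ give isomorphic graded algebras, so $\Gamma_1(t,\eta)$ denotes an isomorphism class. Type 2 gradings (defined for $\mathrm{char}\,\mathbb{F}\ne2$ only): let $g\in G$ have order $2$ and let $\eta=(g_1,\dots,g_{n-1})\in G^{n-1}$ be symmetric, i.e. $g_i=g_{n-i}$ for each $i$, with $g,g_1,\dots,g_{n-1}$ pairwise commuting. Put $X_{ij}^{\pm}=e_{ij}\pm e_{n-j+1,n-i+1}$ for $1\le i\le j\le n$. Then $\Gamma_2(g,\eta)$ is the grading in which each (nonzero) $X_{ij}^{\pm}$ is homogeneous, with $\deg X_{ii}^-=1$, $\deg X_{ii}^+=g$, $\deg X_{i,i+1}^-=g_i$ and $\deg X_{i,i+1}^+=gg_i$. In particular $\mathrm{I}$ has degree $g$. Practical type 2 gradings: let $\Gamma_2(g,\eta)$ be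 a type 2 grading with homogeneous components $\mathcal{U}_h$, let $t\in G$, and choose $\mathcal{V}\subseteq\mathcal{U}_g$ with $\mathcal{U}_g=\mathcal{V}\oplus\mathbb{F}\mathrm{I}$. Then $\Gamma_2(t,g,\eta)$ is the grading with components $\mathcal{U}'_h=\mathcal{U}_h$ for $h\in G\setminus\{g,t\}$, $\mathcal{U}'_t=\mathcal{U}_t+\mathbb{F}\mathrm{I}$, and, if $g\ne t$, $\mathcal{U}'_g=\mathcal{V}$. Different choices of $\mathcal{V}$ give isomorphic graded algebras.
   Formalization: For n=2: the sequence in Γ₂(deg I,η) may differ from that of Γ₂(g,η), and its entries commute with deg I only if deg I commutes with the essential support; (2) is claimed only if G has an element of order 2 commuting with the essential support (it fails e.g. for trivial G). *)

theory Defs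
  imports
    "HOL-Algebra.Group"
    "HOL-Library.Function_Algebras"
    "HOL-Computational_Algebra.Computational_Algebra"
begin

section \<open>The Lie algebra of upper triangular matrices\<close>

text \<open>
  An n by n matrix is a function of two natural numbers with indices 1, ..., n, vanishing outside
  this range.  Addition and zero come from the pointwise instances of Function_Algebras.
  The pointwise instances of times and one are not the matrix operations and are never used on
  matrices below.
\<close>

type_synonym 'f matr = "nat \<Rightarrow> nat \<Rightarrow> 'f"

definition mscale :: "'f::field \<Rightarrow> 'f matr \<Rightarrow> 'f matr" where
  "mscale c a = (\<lambda>i j. c * a i j)"

interpretation matr: vector_space "mscale :: 'f::field \<Rightarrow> 'f matr \<Rightarrow> 'f matr"
  by unfold_locales (auto simp: mscale_def fun_eq_iff algebra_simps)

definition UT :: "nat \<Rightarrow> 'f::field matr set" where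
  "UT n = {a. \<forall>i j. a i j \<noteq> 0 \<longrightarrow> 1 \<le> i \<and> i \<le> j \<and> j \<le> n}"

definition Diag :: "nat \<Rightarrow> 'f::field matr set" where
  "Diag n = {a. \<forall>i j. a i j \<noteq> 0 \<longrightarrow> 1 \<le> i \<and> i = j \<and> j \<le> n}"

definition mmul :: "nat \<Rightarrow> 'f::field matr \<Rightarrow> 'f matr \<Rightarrow> 'f matr" where
  "mmul n a b = (\<lambda>i j. \<Sum>k=1..n. a i k * b k j)"

definition bracket :: "nat \<Rightarrow> 'f::field matr \<Rightarrow> 'f matr \<Rightarrow> 'f matr" where
  "bracket n a b = mmul n a b - mmul n b a"

definition munit :: "nat \<Rightarrow> nat \<Rightarrow> 'f::field matr" where
  "munit i j = (\<lambda>k l. if k = i \<and> l = j then 1 else 0)"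

definition ident :: "nat \<Rightarrow> 'f::field matr" where
  "ident n = (\<Sum>i=1..n. munit i i)"

definition centre :: "nat \<Rightarrow> 'f::field matr set" where
  "centre n = {x \<in> UT n. \<forall>y\<in>UT n. bracket n x y = 0}"

section \<open>Gradings\<close>

text \<open>
  A family of subspaces is indexed by the type underlying the group; only its values on the
  carrier of the group matter.
\<close>

definition is_grading :: "('g, 'z) monoid_scheme \<Rightarrow> nat \<Rightarrow> ('g \<Rightarrow> 'f::field matr set) \<Rightarrow> bool" where
  "is_grading G n A \<longleftrightarrow>
     (\<forall>g\<in>carrier G. matr.subspace (A g) \<and> A g \<subseteq> UT n) \<and>
     (\<forall>x\<in>UT n. \<exists>!c. (\<forall>g\<in>carrier G. c g \<in> A g) \<and> (\<forall>g. g \<notin> carrier G \<longrightarrow> c g = 0) \<and>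
        finite {g. c g \<noteq> 0} \<and> x = (\<Sum>g | c g \<noteq> 0. c g)) \<and>
     (\<forall>g\<in>carrier G. \<forall>h\<in>carrier G. \<forall>x\<in>A g. \<forall>y\<in>A h. bracket n x y \<in> A (g \<otimes>\<^bsub>G\<^esub> h))"

text \<open>Meaningful for nonzero homogeneous elements only.\<close>

definition hdeg :: "('g, 'z) monoid_scheme \<Rightarrow> ('g \<Rightarrow> 'f::field matr set) \<Rightarrow> 'f matr \<Rightarrow> 'g" where
  "hdeg G A x = (THE g. g \<in> carrier G \<and> x \<in> A g)"

definition ess_support :: "('g, 'z) monoid_scheme \<Rightarrow> nat \<Rightarrow> ('g \<Rightarrow> 'f::field matr set) \<Rightarrow> 'g set" where
  "ess_support G n A = {g \<in> carrier G. \<not> A g \<subseteq> centre n}"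

definition lie_auto :: "nat \<Rightarrow> ('f::field matr \<Rightarrow> 'f matr) \<Rightarrow> bool" where
  "lie_auto n f \<longleftrightarrow> bij_betw f (UT n) (UT n) \<and>
     (\<forall>x\<in>UT n. \<forall>y\<in>UT n. f (x + y) = f x + f y) \<and>
     (\<forall>c. \<forall>x\<in>UT n. f (mscale c x) = mscale c (f x)) \<and>
     (\<forall>x\<in>UT n. \<forall>y\<in>UT n. f (bracket n x y) = bracket n (f x) (f y))"

definition graded_iso ::
    "('g, 'z) monoid_scheme \<Rightarrow> nat \<Rightarrow> ('g \<Rightarrow> 'f::field matr set) \<Rightarrow> ('g \<Rightarrow> 'f matr set) \<Rightarrow> bool" where
  "graded_iso G n A B \<longleftrightarrow> is_grading G n A \<and> is_grading G n B \<and>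
     (\<exists>f. lie_auto n f \<and> (\<forall>g\<in>carrier G. f ` A g \<subseteq> B g))"

definition mod_centre :: "nat \<Rightarrow> 'f::field matr \<Rightarrow> 'f matr set" where
  "mod_centre n x = {x + z | z. z \<in> centre n}"

text \<open>
  The homogeneous component of degree g of the quotient by the centre consists of the cosets of
  the elements of A g.  An automorphism preserves the centre, so the automorphism it induces on
  the quotient sends a coset to its image.
\<close>

definition pract_graded_iso ::
    "('g, 'z) monoid_scheme \<Rightarrow> nat \<Rightarrow> ('g \<Rightarrow> 'f::field matr set) \<Rightarrow> ('g \<Rightarrow> 'f matr set) \<Rightarrow> bool" where
  "pract_graded_iso G n A B \<longleftrightarrow> is_grading G n A \<and> is_grading G n B \<and>
     (\<exists>f. lie_auto n f \<and>
        (\<forall>g\<in>carrier G. (\<lambda>C. f ` C) ` (mod_centre n ` A g) \<subseteq> mod_centre n ` B g))"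

section \<open>Elementary gradings\<close>

text \<open>A sequence is a function of which only the values at 1, ..., n - 1 matter.\<close>

definition elem_params :: "('g, 'z) monoid_scheme \<Rightarrow> nat \<Rightarrow> (nat \<Rightarrow> 'g) \<Rightarrow> bool" where
  "elem_params G n \<eta> \<longleftrightarrow>
     (\<forall>i\<in>{1..<n}. \<eta> i \<in> carrier G) \<and>
     (\<forall>i\<in>{1..<n}. \<forall>j\<in>{1..<n}. \<eta> i \<otimes>\<^bsub>G\<^esub> \<eta> j = \<eta> j \<otimes>\<^bsub>G\<^esub> \<eta> i)"

text \<open>The ordered product of the values at i, ..., j - 1; the group need not be commutative.\<close>

definition seg_prod :: "('g, 'z) monoid_scheme \<Rightarrow> (nat \<Rightarrow> 'g) \<Rightarrow> nat \<Rightarrow> nat \<Rightarrow> 'g" where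
  "seg_prod G \<eta> i j = foldr (\<lambda>k x. \<eta> k \<otimes>\<^bsub>G\<^esub> x) [i..<j] \<one>\<^bsub>G\<^esub>"

definition gamma1 ::
    "('g, 'z) monoid_scheme \<Rightarrow> nat \<Rightarrow> (nat \<Rightarrow> 'g) \<Rightarrow> 'g \<Rightarrow> 'f::field matr set" where
  "gamma1 G n \<eta> h = matr.span {munit i j | i j. 1 \<le> i \<and> i \<le> j \<and> j \<le> n \<and> seg_prod G \<eta> i j = h}"

definition ident_complement :: "nat \<Rightarrow> 'f::field matr set \<Rightarrow> 'f matr set \<Rightarrow> bool" where
  "ident_complement n W V \<longleftrightarrow> matr.subspace V \<and>
     V \<inter> matr.span {ident n} = {0} \<and>
     W = {v + z | v z. v \<in> V \<and> z \<in> matr.span {ident n}}"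

definition pract_gamma1 ::
    "('g, 'z) monoid_scheme \<Rightarrow> nat \<Rightarrow> 'g \<Rightarrow> (nat \<Rightarrow> 'g) \<Rightarrow> 'f::field matr set \<Rightarrow> 'g \<Rightarrow> 'f matr set" where
  "pract_gamma1 G n t \<eta> V h = matr.span
     ({munit i j | i j. 1 \<le> i \<and> i < j \<and> j \<le> n \<and> seg_prod G \<eta> i j = h} \<union>
      (if h = \<one>\<^bsub>G\<^esub> then V else {}) \<union> (if h = t then {ident n} else {}))"

text \<open>The practical elementary grading is an isomorphism class; this says that A belongs to it.\<close>

definition is_pract_elementary ::
    "('g, 'z) monoid_scheme \<Rightarrow> nat \<Rightarrow> ('g \<Rightarrow> 'f::field matr set) \<Rightarrow> 'g \<Rightarrow> (nat \<Rightarrow> 'g) \<Rightarrow> bool" where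
  "is_pract_elementary G n A t \<eta> \<longleftrightarrow>
     (\<exists>V. ident_complement n (Diag n) V \<and> graded_iso G n A (pract_gamma1 G n t \<eta> V))"

section \<open>Type 2 gradings\<close>

definition type2_params ::
    "'f::field itself \<Rightarrow> ('g, 'z) monoid_scheme \<Rightarrow> nat \<Rightarrow> 'g \<Rightarrow> (nat \<Rightarrow> 'g) \<Rightarrow> bool" where
  "type2_params F G n g \<eta> \<longleftrightarrow> CHAR('f) \<noteq> 2 \<and> elem_params G n \<eta> \<and>
     g \<in> carrier G \<and> g \<noteq> \<one>\<^bsub>G\<^esub> \<and> g \<otimes>\<^bsub>G\<^esub> g = \<one>\<^bsub>G\<^esub> \<and>
     (\<forall>i\<in>{1..<n}. \<eta> i = \<eta> (n - i) \<and> g \<otimes>\<^bsub>G\<^esub> \<eta> i = \<eta> i \<otimes>\<^bsub>G\<^esub> g)"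

definition Xminus :: "nat \<Rightarrow> nat \<Rightarrow> nat \<Rightarrow> 'f::field matr" where
  "Xminus n i j = munit i j - munit (n + 1 - j) (n + 1 - i)"

definition Xplus :: "nat \<Rightarrow> nat \<Rightarrow> nat \<Rightarrow> 'f::field matr" where
  "Xplus n i j = munit i j + munit (n + 1 - j) (n + 1 - i)"

text \<open>
  The degrees for j > i + 1 are forced by those for j = i and j = i + 1: the span of the Xminus is
  the fixed subalgebra of the involution sending x to minus its reflection in the antidiagonal,
  and the span of the Xplus is the eigenspace of -1, so that brackets of two Xminus, of two Xplus,
  and mixed brackets lie in the span of the Xminus, the Xminus and the Xplus, respectively.
  A vanishing Xminus or Xplus contributes nothing to the span.
  The formula makes sense for all g and \<eta>; the conditions on the parameters are in type2_params.
  For n = 2 and g of order 2 the resulting family is a grading (in characteristic other than 2) even if g and \<eta> 1 do not commute,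
  because Xminus 2 1 2 = 0 and the identity is central.
\<close>

definition gamma2 ::
    "('g, 'z) monoid_scheme \<Rightarrow> nat \<Rightarrow> 'g \<Rightarrow> (nat \<Rightarrow> 'g) \<Rightarrow> 'g \<Rightarrow> 'f::field matr set" where
  "gamma2 G n g \<eta> h = matr.span
     ({Xminus n i j | i j. 1 \<le> i \<and> i \<le> j \<and> j \<le> n \<and> seg_prod G \<eta> i j = h} \<union>
      {Xplus n i j | i j. 1 \<le> i \<and> i \<le> j \<and> j \<le> n \<and> g \<otimes>\<^bsub>G\<^esub> seg_prod G \<eta> i j = h})"

definition pract_gamma2 ::
    "('g, 'z) monoid_scheme \<Rightarrow> nat \<Rightarrow> 'g \<Rightarrow> 'g \<Rightarrow> (nat \<Rightarrow> 'g) \<Rightarrow> 'f::field matr set \<Rightarrow> 'g \<Rightarrow> 'f matr set" where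
  "pract_gamma2 G n t g \<eta> V h =
     (if h = t then {u + z | u z. u \<in> gamma2 G n g \<eta> t \<and> z \<in> matr.span {ident n}}
      else if h = g then V
      else gamma2 G n g \<eta> h)"

text \<open>
  Membership of A in the isomorphism class of the practical type 2 grading.  An arbitrary
  complement V need not yield a grading, since V must contain the commutators of degree g.
  Only those V count for which it does: graded_iso demands that both sides are gradings.
\<close>

definition is_pract_type2 ::
    "('g, 'z) monoid_scheme \<Rightarrow> nat \<Rightarrow> ('g \<Rightarrow> 'f::field matr set) \<Rightarrow> 'g \<Rightarrow> 'g \<Rightarrow> (nat \<Rightarrow> 'g) \<Rightarrow> bool" where
  "is_pract_type2 G n A t g \<eta> \<longleftrightarrow>
     (\<exists>V. ident_complement n (gamma2 G n g \<eta> g) V \<and> graded_iso G n A (pract_gamma2 G n t g \<eta> V))"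

section \<open>The two cases\<close>

definition pract_iso_elementary ::
    "('g, 'z) monoid_scheme \<Rightarrow> nat \<Rightarrow> ('g \<Rightarrow> 'f::field matr set) \<Rightarrow> (nat \<Rightarrow> 'g) \<Rightarrow> bool" where
  "pract_iso_elementary G n A \<eta> \<longleftrightarrow> elem_params G n \<eta> \<and> pract_graded_iso G n A (gamma1 G n \<eta>)"

definition pract_iso_type2 ::
    "('g, 'z) monoid_scheme \<Rightarrow> nat \<Rightarrow> ('g \<Rightarrow> 'f::field matr set) \<Rightarrow> 'g \<Rightarrow> (nat \<Rightarrow> 'g) \<Rightarrow> bool" where
  "pract_iso_type2 G n A g \<eta> \<longleftrightarrow>
     type2_params TYPE('f) G n g \<eta> \<and> pract_graded_iso G n A (gamma2 G n g \<eta>)"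

end

theory Submission
  imports Defs
begin

text \<open>
  On the factor number l of the lower central series the diagonal matrices act as multiplication
  operators of the algebra \<open>F^(n - l)\<close>, whose entries are the values of the roots of height l, and
  the grading of the Lie algebra turns each of these algebras into a graded algebra, in a way
  compatible with writing a root as a sum of simple roots.  The factor with l = n - 1 has trivial
  grading; the factor with l = n - 2 is two-dimensional, and it is graded either trivially or by
  {1, g} with g of order 2 and characteristic different from 2.  From the two ends of the Dynkin
  diagram this information propagates inwards, because \<open>c\<^sub>i d\<^sub>i\<^sub>+\<^sub>1 + c\<^sub>i\<^sub>+\<^sub>1 d\<^sub>i\<close> is obtained from the
  algebras for l = 1 and l = 2.  So modulo the nilradical and the centre the torus either has
  trivial degree, or its components of degree 1 and g are the symmetric and the antisymmetric part
  with respect to the flip of the diagram.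

  An element of trivial degree can be conjugated by transvections into the centralizer of its
  diagonal part d; then the generalized weight spaces of the element are graded and they are the
  weight spaces of d, so that d has trivial degree modulo the centre.  Repeating this with the
  symmetric diagonal matrices makes their centralizer, the space of all diagonal matrices, graded.
  The root spaces are then graded, or in the second case the sums of a root space and its mirror
  image, and after a rescaling the grading is an elementary or a type 2 grading modulo the
  centre.

  Elements of the nilradical which are homogeneous modulo the centre are homogeneous, so that a
  grading is determined by its quotient up to the choice of a complement of the identity.
\<close>

text \<open>The group need not be abelian and the field is arbitrary, so a grading cannot be
  replaced by the action of a character group. What takes its place is a rigidity of multiplication
  operators on a superdiagonal: operators of different degrees are linearly independent
  (\<open>Q_direct\<close>), and there are no nonzero nilpotent ones. In the two-dimensional factor
  an operator p of degree g other than 1, with values p1 and p2, satisfies p^2 + p1 p2 = (p1 + p2)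
  p. The sides have degrees 1 and g, so p1 + p2 = 0; the sign flip and the exclusion of
  characteristic 2 originate here.

  The second obstacle is the identity matrix: its degree is arbitrary, and if the characteristic
  divides n it has trace zero, so the scalars have no canonical complement. Homogeneity is therefore
  handled modulo the centre (\<open>Az\<close>). It becomes exact for brackets and for strictly
  upper triangular matrices, because these contain no nonzero scalar; the degree of the identity
  matters only when a complement of the scalars is chosen.\<close>

lemma sum_matr_apply: "(\<Sum>x\<in>S. f x) i j = (\<Sum>x\<in>S. (f x i j :: 'f::comm_monoid_add))"
  by (induction S rule: infinite_finite_induct) auto

lemma mscale_apply [simp]: "mscale c a i j = c * a i j"
  by (simp add: mscale_def)

lemma matr_diff_apply [simp]: "(a - b) i j = a i j - (b i j :: 'f::ab_group_add)"
  by simp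

lemma sum_single:
  assumes "finite S" "i \<in> S" "\<And>k. k \<in> S \<Longrightarrow> k \<noteq> i \<Longrightarrow> f k = 0"
  shows "sum f S = f i"
  using assms by (subst sum.remove[of S i]) (auto intro: sum.neutral)

section \<open>Products and brackets of matrices, entry by entry\<close>

lemma mmul_add_left: "mmul n (a + b) c = mmul n a c + mmul n b c"
  and mmul_add_right: "mmul n c (a + b) = mmul n c a + mmul n c b"
  and mmul_diff_left: "mmul n (a - b) c = mmul n a c - mmul n b c"
  and mmul_diff_right: "mmul n c (a - b) = mmul n c a - mmul n c b"
  and mmul_scale_left: "mmul n (mscale r a) c = mscale r (mmul n a c)"
  and mmul_scale_right: "mmul n a (mscale r c) = mscale r (mmul n a c)"
  and mmul_0_left: "mmul n 0 c = 0" and mmul_0_right: "mmul n c 0 = 0"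
  by (auto simp: mmul_def fun_eq_iff algebra_simps sum.distrib sum_subtractf sum_distrib_left
      intro!: sum.cong)

lemma mmul_assoc: "mmul n (mmul n a b) c = mmul n a (mmul n b c)"
proof -
  have "(\<Sum>l=1..n. (\<Sum>k=1..n. a i k * b k l) * c l j) = (\<Sum>k=1..n. a i k * (\<Sum>l=1..n. b k l * c l j))"
    for i j
    unfolding sum_distrib_left sum_distrib_right by (subst sum.swap) (simp add: mult.assoc)
  then show ?thesis by (simp add: mmul_def fun_eq_iff)
qed

lemma bracket_add_left: "bracket n (a + b) c = bracket n a c + bracket n b c"
  and bracket_add_right: "bracket n c (a + b) = bracket n c a + bracket n c b"
  and bracket_diff_left: "bracket n (a - b) c = bracket n a c - bracket n b c"
  and bracket_diff_right: "bracket n c (a - b) = bracket n c a - bracket n c b"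
  and bracket_scale_left: "bracket n (mscale r a) c = mscale r (bracket n a c)"
  and bracket_scale_right: "bracket n c (mscale r a) = mscale r (bracket n c a)"
  and bracket_0_left [simp]: "bracket n 0 c = 0"
  and bracket_0_right [simp]: "bracket n c 0 = 0"
  and bracket_anticomm: "bracket n a b = - bracket n b a"
  by (simp_all add: bracket_def mmul_add_left mmul_add_right mmul_diff_left mmul_diff_right
      mmul_scale_left mmul_scale_right mmul_0_left mmul_0_right algebra_simps
      matr.scale_right_diff_distrib)

lemma bracket_sum_left: "bracket n (\<Sum>x\<in>S. f x) c = (\<Sum>x\<in>S. bracket n (f x) c)"
  using sum_comp_morphism[of "\<lambda>a. bracket n a c" f S] by (simp add: bracket_add_left o_def)

lemma bracket_sum_right: "bracket n c (\<Sum>x\<in>S. f x) = (\<Sum>x\<in>S. bracket n c (f x))"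
  using sum_comp_morphism[of "bracket n c" f S] by (simp add: bracket_add_right o_def)

lemma UT_iff: "a \<in> UT n \<longleftrightarrow> (\<forall>i j. \<not> (1 \<le> i \<and> i \<le> j \<and> j \<le> n) \<longrightarrow> a i j = 0)"
  unfolding UT_def by blast

lemma Diag_iff: "a \<in> Diag n \<longleftrightarrow> (\<forall>i j. \<not> (1 \<le> i \<and> i = j \<and> j \<le> n) \<longrightarrow> a i j = 0)"
  unfolding Diag_def by blast

lemma UT_D: "a \<in> UT n \<Longrightarrow> a i j \<noteq> 0 \<Longrightarrow> 1 \<le> i \<and> i \<le> j \<and> j \<le> n"
  by (auto simp: UT_def)

lemma UT_zero: "a \<in> UT n \<Longrightarrow> \<not> (1 \<le> i \<and> i \<le> j \<and> j \<le> n) \<Longrightarrow> a i j = 0"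
  unfolding UT_def by blast

lemma UT_eq_0: "a \<in> UT n \<Longrightarrow> j < i \<Longrightarrow> a i j = 0"
  using UT_D[of a n i j] by linarith

lemma subspace_UT: "matr.subspace (UT n)"
  by (intro matr.subspaceI) (simp_all add: UT_iff)

lemma subspace_Diag: "matr.subspace (Diag n)"
  by (intro matr.subspaceI) (simp_all add: Diag_iff)

lemma Diag_subset_UT: "Diag n \<subseteq> UT n"
  by (fastforce simp: Diag_def UT_def)

lemmas subspace_closed = matr.subspace_add matr.subspace_diff matr.subspace_scale matr.subspace_neg
  matr.subspace_sum matr.subspace_0

lemma mmul_UT: assumes "a \<in> UT n" "b \<in> UT n" shows "mmul n a b \<in> UT n"
proof -
  have "1 \<le> i \<and> i \<le> j \<and> j \<le> n" if ne: "(\<Sum>k=1..n. a i k * b k j) \<noteq> 0" for i j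
  proof -
    obtain k where "a i k * b k j \<noteq> 0" using ne by (meson sum.not_neutral_contains_not_neutral)
    then show ?thesis using UT_D[OF assms(1), of i k] UT_D[OF assms(2), of k j] by auto
  qed
  then show ?thesis unfolding UT_def mmul_def by blast
qed

lemma bracket_UT: "a \<in> UT n \<Longrightarrow> b \<in> UT n \<Longrightarrow> bracket n a b \<in> UT n"
  unfolding bracket_def by (intro subspace_closed(2)[OF subspace_UT] mmul_UT)

lemma mmul_munit_left:
  assumes "1 \<le> j" "j \<le> n"
  shows "mmul n (munit i j) y p q = (if p = i then y j q else 0)"
proof -
  have "(\<Sum>k=1..n. munit i j p k * y k q) = munit i j p j * y j q"
    using assms by (intro sum_single) (auto simp: munit_def)
  then show ?thesis by (simp add: mmul_def munit_def)
qed

lemma mmul_munit_right: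
  assumes "1 \<le> i" "i \<le> n"
  shows "mmul n y (munit i j) p q = (if q = j then y p i else 0)"
proof -
  have "(\<Sum>k=1..n. y p k * munit i j k q) = y p i * munit i j i q"
    using assms by (intro sum_single) (auto simp: munit_def)
  then show ?thesis by (simp add: mmul_def munit_def)
qed

lemma bracket_munit:
  assumes "1 \<le> i" "i \<le> n" "1 \<le> j" "j \<le> n"
  shows "bracket n (munit i j) y p q = (if p = i then y j q else 0) - (if q = j then y p i else 0)"
  using assms by (simp add: bracket_def mmul_munit_left mmul_munit_right)

lemma munit_UT: "1 \<le> i \<Longrightarrow> i \<le> j \<Longrightarrow> j \<le> n \<Longrightarrow> munit i j \<in> UT n"
  by (auto simp: munit_def UT_def)

lemma bracket_munit_munit:
  assumes "1 \<le> i" "i < j" "j < k" "k \<le> n"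
  shows "bracket n (munit i j) (munit j k) = munit i k"
  using assms by (auto simp: fun_eq_iff bracket_munit) (auto simp: munit_def)

lemma munit_nonzero: "munit i j \<noteq> (0::'f::field matr)"
proof
  assume "munit i j = (0::'f matr)"
  then have "munit i j i j = (0::'f)" by simp
  then show False by (simp add: munit_def)
qed

lemma mmul_Diag_left:
  assumes "d \<in> Diag n" "y \<in> UT n" shows "mmul n d y p q = d p p * y p q"
proof (cases "p \<in> {1..n}")
  case True
  have "(\<Sum>k=1..n. d p k * y k q) = d p p * y p q"
    using True assms by (intro sum_single) (auto simp: Diag_def)
  then show ?thesis by (simp add: mmul_def)
next
  case False
  have "d p k = 0" for k using assms(1) False by (auto simp: Diag_def)
  then show ?thesis by (simp add: mmul_def)
qed

lemma mmul_Diag_right: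
  assumes "d \<in> Diag n" "y \<in> UT n" shows "mmul n y d p q = y p q * d q q"
proof (cases "q \<in> {1..n}")
  case True
  have "(\<Sum>k=1..n. y p k * d k q) = y p q * d q q"
    using True assms by (intro sum_single) (auto simp: Diag_def)
  then show ?thesis by (simp add: mmul_def)
next
  case False
  have "d k q = 0" for k using assms(1) False by (auto simp: Diag_def)
  then show ?thesis by (simp add: mmul_def)
qed

lemma bracket_Diag:
  assumes "d \<in> Diag n" "y \<in> UT n" shows "bracket n d y p q = (d p p - d q q) * y p q"
  using assms by (simp add: bracket_def mmul_Diag_left mmul_Diag_right algebra_simps)

definition diag_part :: "'f::field matr \<Rightarrow> 'f matr" where
  "diag_part x = (\<lambda>i j. if i = j then x i j else 0)"

lemma diag_part_Diag: "x \<in> UT n \<Longrightarrow> diag_part x \<in> Diag n"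
  by (fastforce simp: diag_part_def Diag_def UT_def)

lemma diag_part_apply [simp]: "diag_part x i i = x i i"
  by (simp add: diag_part_def)

subsection \<open>The lower central filtration\<close>

text \<open>For k at least 1 this is term number k of the lower central series of the strictly upper
  triangular matrices.\<close>

definition Fil :: "nat \<Rightarrow> nat \<Rightarrow> 'f::field matr set" where
  "Fil n k = {x \<in> UT n. \<forall>i j. j < i + k \<longrightarrow> x i j = 0}"

lemma Fil_subset_UT: "Fil n k \<subseteq> UT n"
  by (auto simp: Fil_def)

lemma Fil_0: "Fil n 0 = UT n"
  by (auto simp: Fil_def UT_eq_0)

lemma Fil_top: "n \<le> k \<Longrightarrow> Fil n k = {0}"
proof (intro equalityI subsetI)
  fix x :: "'a matr" assume nk: "n \<le> k" and x: "x \<in> Fil n k"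
  have "x i j = 0" for i j
  proof (cases "1 \<le> i \<and> j \<le> n")
    case True then have "j < i + k" using nk by linarith
    then show ?thesis using x by (simp add: Fil_def)
  next
    case False then show ?thesis using x by (simp add: Fil_def UT_iff)
  qed
  then show "x \<in> {0}" by (simp add: fun_eq_iff)
qed (auto simp: Fil_def UT_def)

lemma subspace_Fil: "matr.subspace (Fil n k)"
  by (intro matr.subspaceI) (simp_all add: Fil_def UT_iff)

lemma munit_Fil: "1 \<le> i \<Longrightarrow> i + k \<le> j \<Longrightarrow> j \<le> n \<Longrightarrow> munit i j \<in> Fil n k"
  by (auto simp: Fil_def munit_UT) (auto simp: munit_def)

lemma UT_expand:
  assumes "x \<in> UT n"
  shows "x = (\<Sum>i=1..n. \<Sum>j=1..n. mscale (x i j) (munit i j))"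
proof -
  have "(\<Sum>i=1..n. \<Sum>j=1..n. mscale (x i j) (munit i j)) p q = x p q" for p q
  proof -
    have 1: "(\<Sum>i=1..n. \<Sum>j=1..n. mscale (x i j) (munit i j)) p q
      = (\<Sum>i=1..n. \<Sum>j=1..n. x i j * munit i j p q)"
      by (simp add: sum_matr_apply)
    show ?thesis
    proof (cases "p \<in> {1..n} \<and> q \<in> {1..n}")
      case True
      have "(\<Sum>i=1..n. \<Sum>j=1..n. x i j * munit i j p q) = (\<Sum>j=1..n. x p j * munit p j p q)"
        using True by (intro sum_single) (auto simp: munit_def)
      also have "\<dots> = x p q * munit p q p q"
        using True by (intro sum_single) (auto simp: munit_def)
      finally show ?thesis using 1 by (simp add: munit_def)
    next
      case False
      then have "x p q = 0" using UT_zero[OF assms, of p q] by auto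
      moreover have "(\<Sum>i=1..n. \<Sum>j=1..n. x i j * munit i j p q) = 0"
        using False by (intro sum.neutral ballI) (auto simp: munit_def)
      ultimately show ?thesis using 1 by simp
    qed
  qed
  then show ?thesis by (simp add: fun_eq_iff)
qed

lemma Fil_subset_subspace:
  assumes "matr.subspace S" "\<And>i j. 1 \<le> i \<Longrightarrow> i \<le> j \<Longrightarrow> i + k \<le> j \<Longrightarrow> j \<le> n \<Longrightarrow> munit i j \<in> S"
  shows "Fil n k \<subseteq> S"
proof
  fix x :: "'a matr" assume x: "x \<in> Fil n k"
  then have xU: "x \<in> UT n" by (simp add: Fil_def)
  have "mscale (x i j) (munit i j) \<in> S" for i j
  proof (cases "x i j = 0")
    case True then show ?thesis using assms(1) by (simp add: matr.subspace_0)
  next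
    case False
    then have "i + k \<le> j" "1 \<le> i" "j \<le> n" "i \<le> j" using x UT_D[OF xU False]
      by (auto simp: Fil_def not_less[symmetric])
    then show ?thesis using assms by (simp add: matr.subspace_scale)
  qed
  then show "x \<in> S" using UT_expand[OF xU] assms(1)
    by (metis (no_types, lifting) matr.subspace_sum)
qed

lemma UT_subset_subspace:
  assumes "matr.subspace S" "\<And>i j. 1 \<le> i \<Longrightarrow> i \<le> j \<Longrightarrow> j \<le> n \<Longrightarrow> munit i j \<in> S"
  shows "UT n \<subseteq> S"
  using Fil_subset_subspace[of S 0 n] assms by (simp add: Fil_0)

lemma mmul_Fil: assumes "x \<in> Fil n k" "y \<in> Fil n l" shows "mmul n x y \<in> Fil n (k + l)"
proof -
  have U: "x \<in> UT n" "y \<in> UT n" using assms by (auto simp: Fil_def)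
  have "mmul n x y i j = 0" if "j < i + (k + l)" for i j
  proof -
    have "x i p * y p j = 0" for p
      using that assms by (cases "p < i + k") (auto simp: Fil_def)
    then show ?thesis unfolding mmul_def by (intro sum.neutral ballI)
  qed
  then show ?thesis using mmul_UT[OF U] by (auto simp: Fil_def)
qed

lemma bracket_Fil: assumes "x \<in> Fil n k" "y \<in> Fil n l" shows "bracket n x y \<in> Fil n (k + l)"
  unfolding bracket_def using mmul_Fil[OF assms] mmul_Fil[OF assms(2,1)]
  by (intro matr.subspace_diff[OF subspace_Fil]) (auto simp: add.commute)

text \<open>The two summands in which a diagonal entry of x meets \<open>w i j\<close> are split
  off. The remaining sums involve only entries of w strictly closer to the diagonal, which makes
  inductions on \<open>j - i\<close> possible.\<close>

lemma bracket_entry: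
  assumes x: "x \<in> UT n" and w: "w \<in> UT n" and ij: "1 \<le> i" "i \<le> j" "j \<le> n"
  shows "bracket n x w i j = (x i i - x j j) * w i j + (\<Sum>k\<in>{i<..j}. x i k * w k j)
    - (\<Sum>k\<in>{i..<j}. w i k * x k j)"
proof -
  have "(\<Sum>k=1..n. x i k * w k j) = (\<Sum>k\<in>{i..j}. x i k * w k j)"
    using UT_eq_0[OF x] UT_eq_0[OF w] ij by (intro sum.mono_neutral_right) auto
  also have "{i..j} = insert i {i<..j}" using ij by auto
  finally have 1: "(\<Sum>k=1..n. x i k * w k j) = x i i * w i j + (\<Sum>k\<in>{i<..j}. x i k * w k j)"
    by simp
  have "(\<Sum>k=1..n. w i k * x k j) = (\<Sum>k\<in>{i..j}. w i k * x k j)"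
    using UT_eq_0[OF x] UT_eq_0[OF w] ij by (intro sum.mono_neutral_right) auto
  also have "{i..j} = insert j {i..<j}" using ij by auto
  finally have 2: "(\<Sum>k=1..n. w i k * x k j) = w i j * x j j + (\<Sum>k\<in>{i..<j}. w i k * x k j)"
    by simp
  show ?thesis unfolding bracket_def matr_diff_apply mmul_def 1 2 by (simp add: algebra_simps)
qed

lemma bracket_diag_entry: "x \<in> UT n \<Longrightarrow> y \<in> UT n \<Longrightarrow> bracket n x y i i = 0"
  using bracket_entry[of x n y i i] UT_D[OF bracket_UT, of x n y i i] by auto

lemma bracket_Fil1: "x \<in> UT n \<Longrightarrow> y \<in> UT n \<Longrightarrow> bracket n x y \<in> Fil n 1"
  using bracket_UT[of x n y] bracket_diag_entry[of x n y]
  by (auto simp: Fil_def less_Suc_eq UT_eq_0)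

text \<open>Both sums in \<open>bracket_entry\<close> vanish on superdiagonal l. So on
  \<open>Fil n l\<close> modulo \<open>Fil n (Suc l)\<close> the bracket with x is diagonal, with
  the root values of the diagonal of x as eigenvalues.\<close>

lemma bracket_leading:
  assumes x: "x \<in> UT n" and y: "y \<in> Fil n l"
  shows "bracket n x y i (i + l) = (x i i - x (i + l) (i + l)) * y i (i + l)"
proof (cases "1 \<le> i \<and> i + l \<le> n")
  case True
  have y': "y \<in> UT n" using y by (simp add: Fil_def)
  have "(\<Sum>k\<in>{i<..i + l}. x i k * y k (i + l)) = 0" "(\<Sum>k\<in>{i..<i + l}. y i k * x k (i + l)) = 0"
    using y by (auto simp: Fil_def intro!: sum.neutral)
  then show ?thesis using bracket_entry[OF x y', of i "i + l"] True by simp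
next
  case False
  have y': "y \<in> UT n" using y by (simp add: Fil_def)
  show ?thesis using False UT_zero[OF bracket_UT[OF x y'], of i "i + l"] UT_zero[OF y', of i "i + l"] by auto
qed

subsection \<open>The centre\<close>

lemma ident_apply: "ident n i j = (if i = j \<and> 1 \<le> i \<and> i \<le> n then 1 else 0)"
proof -
  have "ident n i j = (\<Sum>k=1..n. munit k k i j)" by (simp add: ident_def sum_matr_apply)
  also have "\<dots> = (if i = j \<and> 1 \<le> i \<and> i \<le> n then 1 else 0)"
  proof (cases "1 \<le> i \<and> i \<le> n")
    case True
    then have "(\<Sum>k=1..n. munit k k i j) = munit i i i j"
      by (intro sum_single) (auto simp: munit_def)
    then show ?thesis using True by (auto simp: munit_def)
  next
    case False then show ?thesis by (auto simp: munit_def intro!: sum.neutral)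
  qed
  finally show ?thesis .
qed

lemma ident_Diag: "ident n \<in> Diag n"
  by (auto simp: Diag_def ident_apply split: if_splits)

lemma ident_UT: "ident n \<in> UT n"
  using ident_Diag Diag_subset_UT by blast

lemma ident_nonzero: "1 \<le> n \<Longrightarrow> ident n \<noteq> (0 :: 'f::field matr)"
  using ident_apply[of n 1 1, where 'a='f] by auto

lemma bracket_ident: "y \<in> UT n \<Longrightarrow> bracket n (ident n) y = 0"
proof (intro ext)
  fix i j assume y: "y \<in> UT n"
  show "bracket n (ident n) y i j = 0 i j"
    using UT_zero[OF y, of i j] by (auto simp: bracket_Diag[OF ident_Diag y] ident_apply)
qed

text \<open>Brackets with \<open>munit i i\<close> kill the off-diagonal entries of a central
  matrix, and brackets with \<open>munit 1 i\<close> equate its diagonal entries.\<close>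

lemma centre_eq: assumes "1 \<le> n" shows "centre n = range (\<lambda>c. mscale c (ident n))"
proof (intro equalityI subsetI)
  fix x :: "'a matr" assume x: "x \<in> centre n"
  then have xU: "x \<in> UT n" and xb: "\<And>y. y \<in> UT n \<Longrightarrow> bracket n x y = 0" by (auto simp: centre_def)
  have mb: "bracket n (munit i j) x = 0" if "1 \<le> i" "i \<le> j" "j \<le> n" for i j
    using xb[OF munit_UT[OF that]] bracket_anticomm[of n "munit i j" x] by simp
  have off: "x i j = 0" if "i \<noteq> j" for i j
  proof (cases "x i j = 0")
    case False
    then have ij: "1 \<le> i" "i \<le> n" using UT_D[OF xU, of i j] by auto
    have "bracket n (munit i i) x i j = 0" using mb[of i i] ij by simp
    then show ?thesis using that ij by (simp add: bracket_munit)
  qed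
  have dg: "x i i = x 1 1" if "1 \<le> i" "i \<le> n" for i
  proof (cases "i = 1")
    case False
    have "bracket n (munit 1 i) x 1 i = 0" using mb[of 1 i] that by simp
    then show ?thesis using that by (simp add: bracket_munit)
  qed simp
  have "x i j = mscale (x 1 1) (ident n) i j" for i j
    using off[of i j] dg[of i] UT_zero[OF xU, of i i] by (auto simp: ident_apply)
  then have "x = mscale (x 1 1) (ident n)" by blast
  then show "x \<in> range (\<lambda>c. mscale c (ident n))" by blast
next
  fix x :: "'a matr" assume "x \<in> range (\<lambda>c. mscale c (ident n))"
  then show "x \<in> centre n"
    by (auto simp: centre_def bracket_scale_left bracket_ident ident_UT
        subspace_closed(3)[OF subspace_UT])
qed

lemma subspace_centre: "matr.subspace (centre n)"
  by (intro matr.subspaceI)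
    (simp_all add: centre_def bracket_add_left bracket_scale_left subspace_closed[OF subspace_UT])

lemma span_ident: "matr.span {ident n} = range (\<lambda>c. mscale c (ident n))"
  by (rule matr.span_singleton)

lemma centre_subset_UT: "centre n \<subseteq> UT n"
  by (auto simp: centre_def)

lemma bracket_centre_left: "z \<in> centre n \<Longrightarrow> y \<in> UT n \<Longrightarrow> bracket n z y = 0"
  by (auto simp: centre_def)

lemma bracket_centre_right: "z \<in> centre n \<Longrightarrow> y \<in> UT n \<Longrightarrow> bracket n y z = 0"
  using bracket_anticomm[of n y z] by (auto simp: centre_def)

text \<open>This holds even if the characteristic divides n, when scalars have trace zero. It is
  what turns homogeneity modulo the centre into homogeneity.\<close>

lemma centre_Fil1: assumes "z \<in> centre n" "z \<in> Fil n 1" "1 \<le> n" shows "z = 0"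
proof -
  obtain c where c: "z = mscale c (ident n)" using assms(1,3) by (auto simp: centre_eq)
  have "z 1 1 = 0" using assms(2) by (auto simp: Fil_def)
  then show ?thesis using c assms(3) by (simp add: ident_apply)
qed

lemma centre_Diag: "1 \<le> n \<Longrightarrow> centre n \<subseteq> Diag n"
  using subspace_closed(3)[OF subspace_Diag ident_Diag] by (auto simp: centre_eq)

section \<open>Homogeneous components with respect to a grading\<close>

locale graded_UT = group G for G :: "('g, 'z) monoid_scheme" (structure) +
  fixes n :: nat and A :: "'g \<Rightarrow> 'f::field matr set"
  assumes n_pos: "1 \<le> n" and grading: "is_grading G n A"
begin

lemma UT_closed:
  "(0 :: 'f matr) \<in> UT n"
  "x \<in> UT n \<Longrightarrow> y \<in> UT n \<Longrightarrow> x + y \<in> (UT n :: 'f matr set)"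
  "x \<in> UT n \<Longrightarrow> y \<in> UT n \<Longrightarrow> x - y \<in> (UT n :: 'f matr set)"
  "x \<in> UT n \<Longrightarrow> - x \<in> (UT n :: 'f matr set)"
  "x \<in> UT n \<Longrightarrow> mscale c x \<in> (UT n :: 'f matr set)"
  by (simp_all add: UT_iff)

lemma A_subspace: "g \<in> carrier G \<Longrightarrow> matr.subspace (A g)"
  and A_subset: "g \<in> carrier G \<Longrightarrow> A g \<subseteq> UT n"
  and A_bracket: "g \<in> carrier G \<Longrightarrow> h \<in> carrier G \<Longrightarrow> x \<in> A g \<Longrightarrow> y \<in> A h \<Longrightarrow>
    bracket n x y \<in> A (g \<otimes> h)"
  using grading unfolding is_grading_def by blast+

lemma A_UT: "g \<in> carrier G \<Longrightarrow> x \<in> A g \<Longrightarrow> x \<in> UT n"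
  using A_subset by blast

definition decomposition_of :: "'f matr \<Rightarrow> ('g \<Rightarrow> 'f matr) \<Rightarrow> bool" where
  "decomposition_of x c \<longleftrightarrow> (\<forall>g\<in>carrier G. c g \<in> A g) \<and> (\<forall>g. g \<notin> carrier G \<longrightarrow> c g = 0) \<and>
     finite {g. c g \<noteq> 0} \<and> x = (\<Sum>g | c g \<noteq> 0. c g)"

lemma decomposition_of_ex1: "x \<in> UT n \<Longrightarrow> \<exists>!c. decomposition_of x c"
  using grading unfolding is_grading_def decomposition_of_def by blast

text \<open>The projection onto the component of degree h. It is meaningful on \<open>UT n\<close>
  only, where the decomposition exists and is unique.\<close>

definition hcomp :: "'g \<Rightarrow> 'f matr \<Rightarrow> 'f matr" where
  "hcomp h x = (THE c. decomposition_of x c) h"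

lemma decomposition_of_hcomp: assumes "x \<in> UT n" shows "decomposition_of x (\<lambda>h. hcomp h x)"
  using theI'[OF decomposition_of_ex1[OF assms]] unfolding hcomp_def by simp

lemma hcomp_unique: "x \<in> UT n \<Longrightarrow> decomposition_of x c \<Longrightarrow> hcomp h x = c h"
  using decomposition_of_ex1[of x] decomposition_of_hcomp[of x] by (metis (no_types, lifting))

lemma hcomp_in: "x \<in> UT n \<Longrightarrow> h \<in> carrier G \<Longrightarrow> hcomp h x \<in> A h"
  using decomposition_of_hcomp unfolding decomposition_of_def by blast

lemma hcomp_outside: "x \<in> UT n \<Longrightarrow> h \<notin> carrier G \<Longrightarrow> hcomp h x = 0"
  using decomposition_of_hcomp unfolding decomposition_of_def by blast

lemma hcomp_UT: assumes "x \<in> UT n" shows "hcomp h x \<in> UT n"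
proof (cases "h \<in> carrier G")
  case True then show ?thesis using hcomp_in[OF assms] A_UT by blast
next
  case False then show ?thesis
    using hcomp_outside[OF assms] matr.subspace_0[OF subspace_UT] by simp
qed

lemma hcomp_sum_family:
  assumes S: "finite S" "S \<subseteq> carrier G" and c: "\<And>g. g \<in> S \<Longrightarrow> c g \<in> A g"
  shows "hcomp h (\<Sum>g\<in>S. c g) = (if h \<in> S then c h else 0)"
proof -
  let ?c = "\<lambda>g. if g \<in> S then c g else 0"
  have "(\<Sum>g\<in>S. c g) = (\<Sum>g | ?c g \<noteq> 0. ?c g)"
    using S by (intro sum.mono_neutral_cong_right) auto
  moreover have "finite {g. ?c g \<noteq> 0}" using S by (auto intro: rev_finite_subset)
  moreover have "?c g \<in> A g" if "g \<in> carrier G" for g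
    using c matr.subspace_0[OF A_subspace[OF that]] by simp
  ultimately have "decomposition_of (\<Sum>g\<in>S. c g) ?c" using S(2) unfolding decomposition_of_def by auto
  moreover have "(\<Sum>g\<in>S. c g) \<in> UT n"
    using S c A_UT by (intro matr.subspace_sum[OF subspace_UT]) blast
  ultimately show ?thesis using hcomp_unique by simp
qed

lemma hcomp_expand:
  assumes "x \<in> UT n"
  obtains S where "finite S" "S \<subseteq> carrier G" "x = (\<Sum>g\<in>S. hcomp g x)"
    "\<And>h. h \<notin> S \<Longrightarrow> hcomp h x = 0"
proof
  let ?S = "{g. hcomp g x \<noteq> 0}"
  show "finite ?S" "?S \<subseteq> carrier G" "x = (\<Sum>g\<in>?S. hcomp g x)"
    using decomposition_of_hcomp[OF assms] unfolding decomposition_of_def by auto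
qed auto

lemma hcomp_homogeneous:
  "x \<in> A g \<Longrightarrow> g \<in> carrier G \<Longrightarrow> hcomp h x = (if h = g then x else 0)"
  using hcomp_sum_family[of "{g}" "\<lambda>_. x" h] by simp

lemma hcomp_0: "hcomp h 0 = 0"
  using hcomp_sum_family[of "{}" "\<lambda>_. 0" h] by simp

lemma hcomp_add:
  assumes "x \<in> UT n" "y \<in> UT n" shows "hcomp h (x + y) = hcomp h x + hcomp h y"
proof -
  obtain S where S: "finite S" "S \<subseteq> carrier G" "x = (\<Sum>g\<in>S. hcomp g x)" "\<And>h. h \<notin> S \<Longrightarrow> hcomp h x = 0"
    using hcomp_expand[OF assms(1)] by blast
  obtain T where T: "finite T" "T \<subseteq> carrier G" "y = (\<Sum>g\<in>T. hcomp g y)" "\<And>h. h \<notin> T \<Longrightarrow> hcomp h y = 0"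
    using hcomp_expand[OF assms(2)] by blast
  have "x = (\<Sum>g\<in>S \<union> T. hcomp g x)"
    using S T by (subst S(3), intro sum.mono_neutral_left) auto
  moreover have "y = (\<Sum>g\<in>S \<union> T. hcomp g y)"
    using S T by (subst T(3), intro sum.mono_neutral_left) auto
  ultimately have "x + y = (\<Sum>g\<in>S \<union> T. hcomp g x + hcomp g y)"
    by (simp only: sum.distrib)
  moreover have "hcomp h (\<Sum>g\<in>S \<union> T. hcomp g x + hcomp g y)
      = (if h \<in> S \<union> T then hcomp h x + hcomp h y else 0)"
    using S(1,2) T(1,2) assms hcomp_in A_subspace
    by (intro hcomp_sum_family) (auto intro!: matr.subspace_add)
  ultimately show ?thesis using S(4) T(4) by auto
qed

lemma hcomp_scale:
  assumes "x \<in> UT n" shows "hcomp h (mscale r x) = mscale r (hcomp h x)"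
proof -
  obtain S where S: "finite S" "S \<subseteq> carrier G" "x = (\<Sum>g\<in>S. hcomp g x)" "\<And>h. h \<notin> S \<Longrightarrow> hcomp h x = 0"
    using hcomp_expand[OF assms(1)] by blast
  have "mscale r x = (\<Sum>g\<in>S. mscale r (hcomp g x))"
    by (subst S(3), rule matr.scale_sum_right)
  moreover have "hcomp h (\<Sum>g\<in>S. mscale r (hcomp g x)) = (if h \<in> S then mscale r (hcomp h x) else 0)"
    using S(1,2) assms hcomp_in A_subspace
    by (intro hcomp_sum_family) (auto intro!: matr.subspace_scale)
  ultimately show ?thesis using S(4) by auto
qed

lemma hcomp_uminus: "x \<in> UT n \<Longrightarrow> hcomp h (- x) = - hcomp h x"
  using hcomp_scale[of x h "-1"] by simp

lemma hcomp_diff: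
  assumes "x \<in> UT n" "y \<in> UT n" shows "hcomp h (x - y) = hcomp h x - hcomp h y"
  using hcomp_add[of x "- y" h] hcomp_uminus[of y h] assms by (simp add: UT_closed)

lemma hcomp_sum:
  assumes "finite S" "\<And>s. s \<in> S \<Longrightarrow> f s \<in> UT n"
  shows "hcomp h (\<Sum>s\<in>S. f s) = (\<Sum>s\<in>S. hcomp h (f s))"
  using assms
proof (induct S rule: finite_induct)
  case empty
  then show ?case by (simp only: sum.empty hcomp_0)
next
  case (insert x F)
  have IH: "hcomp h (sum f F) = (\<Sum>s\<in>F. hcomp h (f s))"
    by (rule insert.hyps(3)) (rule insert.prems, blast)
  have "sum f F \<in> UT n" using insert by (intro matr.subspace_sum[OF subspace_UT]) blast
  then have "hcomp h (f x + sum f F) = hcomp h (f x) + hcomp h (sum f F)"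
    using insert.prems by (intro hcomp_add) blast+
  then show ?case unfolding IH using insert.hyps by (simp only: sum.insert simp_thms)
qed

text \<open>Right translation by k is injective, so the summands
  \<open>bracket n (hcomp g x) y\<close> lie in pairwise different degrees. The mirror version below
  is separate because the group need not be abelian.\<close>

lemma hcomp_bracket_right:
  assumes "x \<in> UT n" "y \<in> A k" "k \<in> carrier G" "h \<in> carrier G"
  shows "hcomp (h \<otimes> k) (bracket n x y) = bracket n (hcomp h x) y"
proof -
  obtain S where S: "finite S" "S \<subseteq> carrier G" "x = (\<Sum>g\<in>S. hcomp g x)" "\<And>h. h \<notin> S \<Longrightarrow> hcomp h x = 0"
    using hcomp_expand[OF assms(1)] by blast
  have y: "y \<in> UT n" using A_UT assms by blast
  have "bracket n x y = (\<Sum>g\<in>S. bracket n (hcomp g x) y)"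
    by (subst S(3), rule bracket_sum_left)
  then have "hcomp (h \<otimes> k) (bracket n x y) = (\<Sum>g\<in>S. hcomp (h \<otimes> k) (bracket n (hcomp g x) y))"
    using S(1) y hcomp_UT[OF assms(1)] by (simp only: hcomp_sum bracket_UT)
  also have "\<dots> = (\<Sum>g\<in>S. if g = h then bracket n (hcomp h x) y else 0)"
  proof (intro sum.cong refl)
    fix g assume "g \<in> S"
    then have g: "g \<in> carrier G" using S by blast
    have "bracket n (hcomp g x) y \<in> A (g \<otimes> k)"
      using A_bracket g assms hcomp_in by blast
    then have "hcomp (h \<otimes> k) (bracket n (hcomp g x) y)
      = (if h \<otimes> k = g \<otimes> k then bracket n (hcomp g x) y else 0)"
      using g assms(3) by (simp only: hcomp_homogeneous m_closed)
    then show "hcomp (h \<otimes> k) (bracket n (hcomp g x) y) = (if g = h then bracket n (hcomp h x) y else 0)"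
      using g assms(3,4) by auto
  qed
  also have "\<dots> = bracket n (hcomp h x) y"
    using S by (cases "h \<in> S") auto
  finally show ?thesis .
qed

lemma hcomp_bracket_left:
  assumes "y \<in> UT n" "x \<in> A k" "k \<in> carrier G" "h \<in> carrier G"
  shows "hcomp (k \<otimes> h) (bracket n x y) = bracket n x (hcomp h y)"
proof -
  obtain S where S: "finite S" "S \<subseteq> carrier G" "y = (\<Sum>g\<in>S. hcomp g y)" "\<And>h. h \<notin> S \<Longrightarrow> hcomp h y = 0"
    using hcomp_expand[OF assms(1)] by blast
  have x: "x \<in> UT n" using A_UT assms by blast
  have "bracket n x y = (\<Sum>g\<in>S. bracket n x (hcomp g y))"
    by (subst S(3), rule bracket_sum_right)
  then have "hcomp (k \<otimes> h) (bracket n x y) = (\<Sum>g\<in>S. hcomp (k \<otimes> h) (bracket n x (hcomp g y)))"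
    using S(1) x hcomp_UT[OF assms(1)] by (simp only: hcomp_sum bracket_UT)
  also have "\<dots> = (\<Sum>g\<in>S. if g = h then bracket n x (hcomp h y) else 0)"
  proof (intro sum.cong refl)
    fix g assume "g \<in> S"
    then have g: "g \<in> carrier G" using S by blast
    have "bracket n x (hcomp g y) \<in> A (k \<otimes> g)"
      using A_bracket g assms hcomp_in by blast
    then have "hcomp (k \<otimes> h) (bracket n x (hcomp g y))
      = (if k \<otimes> h = k \<otimes> g then bracket n x (hcomp g y) else 0)"
      using g assms(3) by (simp only: hcomp_homogeneous m_closed)
    then show "hcomp (k \<otimes> h) (bracket n x (hcomp g y)) = (if g = h then bracket n x (hcomp h y) else 0)"
      using g assms(3,4) by auto
  qed
  also have "\<dots> = bracket n x (hcomp h y)"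
    using S by (cases "h \<in> S") auto
  finally show ?thesis .
qed

lemma hcomp_mem:
  assumes "x \<in> UT n" "matr.subspace M" "\<And>h. h \<in> carrier G \<Longrightarrow> hcomp h x \<in> M"
  shows "x \<in> M"
proof -
  obtain S where S: "finite S" "S \<subseteq> carrier G" "x = (\<Sum>g\<in>S. hcomp g x)" "\<And>h. h \<notin> S \<Longrightarrow> hcomp h x = 0"
    using hcomp_expand[OF assms(1)] by blast
  show ?thesis using S(2) assms(3) by (subst S(3), intro matr.subspace_sum[OF assms(2)]) blast
qed

lemma hcomp_eqI:
  assumes "x \<in> UT n" "y \<in> UT n" "\<And>h. h \<in> carrier G \<Longrightarrow> hcomp h x = hcomp h y"
  shows "x = y"
proof -
  have 0: "hcomp h (x - y) = 0" for h
    using assms hcomp_diff[of x y h] hcomp_outside by (cases "h \<in> carrier G") auto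
  have "x - y \<in> UT n" using assms by (simp add: UT_closed)
  then have "x - y \<in> {0}" by (rule hcomp_mem[OF _ matr.subspace_single_0]) (simp only: 0 singletonI)
  then have "x - y = 0" by simp
  then show ?thesis by (simp only: right_minus_eq)
qed

lemma deg_unique: "x \<in> A h \<Longrightarrow> x \<in> A k \<Longrightarrow> h \<in> carrier G \<Longrightarrow> k \<in> carrier G \<Longrightarrow> x \<noteq> 0 \<Longrightarrow> h = k"
  using hcomp_homogeneous[of x h h] hcomp_homogeneous[of x k h] by (auto split: if_splits)

text \<open>Up to sign the bracket is also \<open>bracket n y x\<close>, so it is homogeneous of
  both degrees \<open>h \<otimes> k\<close> and \<open>k \<otimes> h\<close>. All commutation
  relations between degrees come from this.\<close>

lemma deg_commute:
  assumes "x \<in> A h" "y \<in> A k" "h \<in> carrier G" "k \<in> carrier G" "bracket n x y \<noteq> 0"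
  shows "h \<otimes> k = k \<otimes> h"
proof -
  have "bracket n y x \<in> A (k \<otimes> h)" using A_bracket assms by blast
  then have "bracket n x y \<in> A (k \<otimes> h)"
    using matr.subspace_neg[OF A_subspace[of "k \<otimes> h"]] assms(3,4) bracket_anticomm[of n x y] by simp
  then show ?thesis using A_bracket[OF assms(3,4,1,2)] deg_unique assms by blast
qed

section \<open>Graded subspaces: the centre and the filtration\<close>

definition graded_sub :: "'f matr set \<Rightarrow> bool" where
  "graded_sub M \<longleftrightarrow> (\<forall>x\<in>M. \<forall>h\<in>carrier G. hcomp h x \<in> M)"

lemma graded_subD: "graded_sub M \<Longrightarrow> x \<in> M \<Longrightarrow> h \<in> carrier G \<Longrightarrow> hcomp h x \<in> M"
  by (auto simp: graded_sub_def)

lemma graded_UT: "graded_sub (UT n)"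
  by (simp add: graded_sub_def hcomp_UT)

text \<open>For homogeneous y the components of \<open>bracket n x y\<close> are the brackets of the
  components of x with y, so the defining condition passes to each component of x.\<close>

lemma graded_transporter:
  assumes M: "graded_sub M" "M \<subseteq> UT n" and M': "graded_sub M'" "matr.subspace M'" "M' \<subseteq> UT n"
  shows "graded_sub {x \<in> UT n. \<forall>y\<in>M. bracket n x y \<in> M'}"
  unfolding graded_sub_def
proof (intro ballI)
  fix x h assume x: "x \<in> {x \<in> UT n. \<forall>y\<in>M. bracket n x y \<in> M'}" and h: "h \<in> carrier G"
  then have xU: "x \<in> UT n" by simp
  have "bracket n (hcomp h x) y \<in> M'" if y: "y \<in> M" for y
  proof -
    have yU: "y \<in> UT n" using M(2) y by blast
    have "bracket n (hcomp h x) (hcomp k y) \<in> M'" if k: "k \<in> carrier G" for k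
    proof -
      have "hcomp k y \<in> M" using M(1) y k graded_subD by blast
      then have "hcomp (h \<otimes> k) (bracket n x (hcomp k y)) \<in> M'"
        using x M'(1) graded_subD h k by auto
      then show ?thesis using hcomp_bracket_right[OF xU hcomp_in[OF yU k] k h] by simp
    qed
    moreover obtain S where S: "finite S" "S \<subseteq> carrier G" "y = (\<Sum>g\<in>S. hcomp g y)" "\<And>h. h \<notin> S \<Longrightarrow> hcomp h y = 0"
      using hcomp_expand[OF yU] by blast
    ultimately have "(\<Sum>g\<in>S. bracket n (hcomp h x) (hcomp g y)) \<in> M'"
      by (intro matr.subspace_sum[OF M'(2)]) blast
    moreover have "bracket n (hcomp h x) y = (\<Sum>g\<in>S. bracket n (hcomp h x) (hcomp g y))"
      by (subst S(3), rule bracket_sum_right)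
    ultimately show ?thesis by simp
  qed
  then show "hcomp h x \<in> {x \<in> UT n. \<forall>y\<in>M. bracket n x y \<in> M'}" using hcomp_UT[OF xU] by simp
qed

lemma graded_0: "graded_sub {0}"
  by (simp add: graded_sub_def hcomp_0)

lemma graded_centre: "graded_sub (centre n)"
  using graded_transporter[OF graded_UT _ graded_0 matr.subspace_single_0]
  by (simp add: centre_def UT_closed)

lemma hcomp_bracket_mem:
  assumes "a \<in> UT n" "b \<in> UT n" "matr.subspace M" "h \<in> carrier G"
    and "\<And>k l. k \<in> carrier G \<Longrightarrow> l \<in> carrier G \<Longrightarrow> bracket n (hcomp k a) (hcomp l b) \<in> M"
  shows "hcomp h (bracket n a b) \<in> M"
proof -
  obtain S where S: "finite S" "S \<subseteq> carrier G" "a = (\<Sum>g\<in>S. hcomp g a)" "\<And>h. h \<notin> S \<Longrightarrow> hcomp h a = 0"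
    using hcomp_expand[OF assms(1)] by blast
  have "bracket n a b = (\<Sum>g\<in>S. bracket n (hcomp g a) b)"
    by (subst S(3), rule bracket_sum_left)
  then have "hcomp h (bracket n a b) = (\<Sum>g\<in>S. hcomp h (bracket n (hcomp g a) b))"
    using S(1) assms(2) hcomp_UT[OF assms(1)] by (simp only: hcomp_sum bracket_UT)
  moreover have "hcomp h (bracket n (hcomp g a) b) \<in> M" if "g \<in> S" for g
  proof -
    have g: "g \<in> carrier G" using that S by blast
    \<comment> \<open>The part of degree h of the bracket with \<open>hcomp g a\<close> stems from
      the component of b of degree \<open>inv g \<otimes> h\<close>.\<close>
    have "h = g \<otimes> (inv g \<otimes> h)" using g assms(4) by (simp add: m_assoc[symmetric])
    then have "hcomp h (bracket n (hcomp g a) b) = bracket n (hcomp g a) (hcomp (inv g \<otimes> h) b)"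
      using hcomp_bracket_left[OF assms(2) hcomp_in[OF assms(1) g] g, of "inv g \<otimes> h"] g assms(4) by simp
    then show ?thesis using assms(4,5) g by simp
  qed
  ultimately show ?thesis by (simp only:) (rule matr.subspace_sum[OF assms(3)])
qed

text \<open>Every matrix unit in \<open>Fil n (Suc l)\<close> is a bracket: of arbitrary elements of
  \<open>UT n\<close> for l = 0, and of an element of \<open>Fil n 1\<close> with one of
  \<open>Fil n l\<close> otherwise. The components of the two factors stay in these spaces, so their
  brackets lie in \<open>Fil n (Suc l)\<close>.\<close>

lemma graded_Fil: "graded_sub (Fil n l)"
proof (induct l)
  case 0
  then show ?case by (simp add: Fil_0 graded_UT)
next
  case (Suc l)
  let ?S = "{x \<in> UT n. \<forall>h\<in>carrier G. hcomp h x \<in> Fil n (Suc l)}"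
  have "matr.subspace ?S"
    by (intro matr.subspaceI)
      (simp_all add: hcomp_0 hcomp_add hcomp_scale UT_closed subspace_closed[OF subspace_Fil])
  moreover have "munit i j \<in> ?S" if ij: "1 \<le> i" "i \<le> j" "i + Suc l \<le> j" "j \<le> n" for i j
  proof -
    have "hcomp h (munit i j) \<in> Fil n (Suc l)" if h: "h \<in> carrier G" for h
    proof (cases "l = 0")
      case True
      have "bracket n (munit i i) (munit i j) = (munit i j :: 'f matr)"
        using ij by (auto simp: fun_eq_iff bracket_munit) (auto simp: munit_def)
      moreover have "hcomp h (bracket n (munit i i) (munit i j)) \<in> Fil n (Suc l)"
        using ij h True by (intro hcomp_bracket_mem[OF _ _ subspace_Fil])
          (auto simp: hcomp_UT munit_UT intro!: bracket_Fil1[simplified])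
      ultimately show ?thesis by simp
    next
      case False
      have "bracket n (munit i (i + 1)) (munit (i + 1) j) = (munit i j :: 'f matr)"
        using ij False by (intro bracket_munit_munit) auto
      moreover have "hcomp h (bracket n (munit i (i + 1)) (munit (i + 1) j)) \<in> Fil n (Suc l)"
      proof (rule hcomp_bracket_mem[OF _ _ subspace_Fil h])
        show u: "munit i (i + 1) \<in> UT n" "munit (i + 1) j \<in> UT n" using ij by (auto intro!: munit_UT)
        fix k r assume k: "k \<in> carrier G" "r \<in> carrier G"
        have "munit (i + 1) j \<in> Fil n l" using ij by (intro munit_Fil) auto
        then have 1: "hcomp r (munit (i + 1) j) \<in> Fil n l" using Suc k graded_subD by blast
        \<comment> \<open>The induction hypothesis speaks of level l only, so the argument for level
          1 is repeated for the first factor.\<close>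
        have "bracket n (munit i i) (munit i (i + 1)) = (munit i (i + 1) :: 'f matr)"
          using ij by (auto simp: fun_eq_iff bracket_munit) (auto simp: munit_def)
        moreover have "hcomp k (bracket n (munit i i) (munit i (i + 1))) \<in> Fil n 1"
          using ij k by (intro hcomp_bracket_mem[OF _ _ subspace_Fil])
            (auto simp: hcomp_UT munit_UT intro!: bracket_Fil1[simplified])
        ultimately show "bracket n (hcomp k (munit i (i + 1))) (hcomp r (munit (i + 1) j)) \<in> Fil n (Suc l)"
          using bracket_Fil[OF _ 1, of _ 1] by simp
      qed
      ultimately show ?thesis by simp
    qed
    then show ?thesis using ij by (simp add: munit_UT)
  qed
  ultimately have "Fil n (Suc l) \<subseteq> ?S" by (intro Fil_subset_subspace)
  then show ?case by (auto simp: graded_sub_def)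
qed

text \<open>The centre is graded and one-dimensional, so a nonzero component of the identity is a
  multiple of it.\<close>

lemma ident_homogeneous: obtains t where "t \<in> carrier G" "ident n \<in> A t"
proof -
  have c: "hcomp h (ident n) \<in> centre n" if "h \<in> carrier G" for h
  proof -
    have "mscale 1 (ident n) \<in> centre n" using n_pos by (auto simp only: centre_eq)
    then show ?thesis using graded_centre that graded_subD by simp
  qed
  obtain h where h: "h \<in> carrier G" "hcomp h (ident n) \<noteq> 0"
    using hcomp_eqI[of "ident n" 0] ident_UT ident_nonzero[OF n_pos] hcomp_0
      UT_closed(1) by metis
  obtain r where r: "hcomp h (ident n) = mscale r (ident n)" using c[OF h(1)] n_pos by (auto simp: centre_eq)
  then have "r \<noteq> 0" using h(2) by auto
  then have "ident n = mscale (inverse r) (hcomp h (ident n))" unfolding r by (simp add: fun_eq_iff)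
  also have "\<dots> \<in> A h" using hcomp_in[OF ident_UT h(1)] matr.subspace_scale[OF A_subspace[OF h(1)]] by blast
  finally show ?thesis using that h(1) by blast
qed

lemma hdeg_ident: "hdeg G A (ident n) \<in> carrier G" "ident n \<in> A (hdeg G A (ident n))"
proof -
  obtain t where t: "t \<in> carrier G" "ident n \<in> A t" by (rule ident_homogeneous)
  have "hdeg G A (ident n) = t" unfolding hdeg_def
    using t deg_unique ident_nonzero[OF n_pos] by (intro the_equality) auto
  then show "hdeg G A (ident n) \<in> carrier G" "ident n \<in> A (hdeg G A (ident n))" using t by auto
qed

text \<open>\<open>Az h\<close> is the preimage of the component of degree h of the quotient by the centre.\<close>

definition Az :: "'g \<Rightarrow> 'f matr set" where
  "Az h = {x \<in> UT n. \<forall>k\<in>carrier G. k \<noteq> h \<longrightarrow> hcomp k x \<in> centre n}"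

lemma Az_UT: "Az h \<subseteq> UT n"
  by (auto simp: Az_def)

lemma subspace_Az: "matr.subspace (Az h)"
  by (intro matr.subspaceI)
    (simp_all add: Az_def hcomp_0 hcomp_add hcomp_scale UT_closed
      subspace_closed[OF subspace_centre])

lemma A_subset_Az: "h \<in> carrier G \<Longrightarrow> A h \<subseteq> Az h"
  using hcomp_homogeneous A_UT matr.subspace_0[OF subspace_centre] by (auto simp: Az_def)

lemma centre_subset_Az: "centre n \<subseteq> Az h"
  using graded_centre centre_subset_UT by (auto simp: Az_def graded_sub_def)

lemma Az_E:
  assumes "x \<in> Az h" "h \<in> carrier G"
  obtains a z where "a \<in> A h" "z \<in> centre n" "x = a + z"
proof
  have x: "x \<in> UT n" using assms Az_UT by blast
  show a: "hcomp h x \<in> A h" using x assms hcomp_in by blast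
  show "x - hcomp h x \<in> centre n"
  proof (rule hcomp_mem[OF _ subspace_centre])
    show "x - hcomp h x \<in> UT n" using x by (simp add: hcomp_UT UT_closed)
    fix k assume k: "k \<in> carrier G"
    have "hcomp k (x - hcomp h x) = hcomp k x - (if k = h then hcomp h x else 0)"
      using x hcomp_UT a assms(2) by (simp add: hcomp_diff hcomp_homogeneous)
    then show "hcomp k (x - hcomp h x) \<in> centre n"
      using assms(1) k matr.subspace_0[OF subspace_centre] by (auto simp: Az_def)
  qed
qed simp

text \<open>The central summand of x drops out of the bracket, so the result is homogeneous itself
  and not only modulo the centre.\<close>

lemma Az_bracket_left:
  assumes "x \<in> Az h" "h \<in> carrier G" "y \<in> A k" "k \<in> carrier G"
  shows "bracket n x y \<in> A (h \<otimes> k)"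
proof -
  obtain a z where "a \<in> A h" "z \<in> centre n" "x = a + z" using Az_E assms by blast
  then show ?thesis using A_bracket assms A_UT by (simp add: bracket_add_left bracket_centre_left)
qed

text \<open>Converse of \<open>Az_bracket_left\<close>: for l other than h the bracket of
  \<open>hcomp l x\<close> with y of degree k is the component of degree
  \<open>l \<otimes> k\<close> of an element of \<open>A (h \<otimes> k)\<close>, hence 0. So
  \<open>hcomp l x\<close> is central.\<close>

lemma AzI:
  assumes x: "x \<in> UT n" and h: "h \<in> carrier G"
    and "\<And>k y. k \<in> carrier G \<Longrightarrow> y \<in> A k \<Longrightarrow> bracket n x y \<in> A (h \<otimes> k)"
  shows "x \<in> Az h"
proof -
  have "hcomp l x \<in> centre n" if l: "l \<in> carrier G" "l \<noteq> h" for l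
  proof -
    have "bracket n (hcomp l x) y = 0" if y: "y \<in> UT n" for y
    proof -
      have "y \<in> {y \<in> UT n. bracket n (hcomp l x) y = 0}"
      proof (rule hcomp_mem[OF y])
        show "matr.subspace {y \<in> UT n. bracket n (hcomp l x) y = 0}"
          by (intro matr.subspaceI)
            (simp_all add: bracket_add_right bracket_scale_right UT_closed)
        fix k assume k: "k \<in> carrier G"
        have yk: "hcomp k y \<in> A k" using hcomp_in y k by blast
        have "bracket n (hcomp l x) (hcomp k y) = hcomp (l \<otimes> k) (bracket n x (hcomp k y))"
          using hcomp_bracket_right[OF x yk k l(1)] by simp
        also have "\<dots> = 0"
          using hcomp_homogeneous[OF assms(3)[OF k yk], of "l \<otimes> k"] h k l by simp
        finally show "hcomp k y \<in> {y \<in> UT n. bracket n (hcomp l x) y = 0}" using hcomp_UT y by simp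
      qed
      then show ?thesis by simp
    qed
    then show ?thesis using hcomp_UT x by (simp add: centre_def)
  qed
  then show ?thesis using x by (simp add: Az_def)
qed

text \<open>The components of the other degrees are central and lie in the graded subspace
  \<open>Fil n 1\<close>, so \<open>centre_Fil1\<close> makes them 0.\<close>

lemma Az_Fil1: assumes "x \<in> Az h" "x \<in> Fil n 1" "h \<in> carrier G" shows "x \<in> A h"
proof -
  have x: "x \<in> UT n" using assms Az_UT by blast
  have "hcomp k x = hcomp k (hcomp h x)" if k: "k \<in> carrier G" for k
  proof (cases "k = h")
    case True then show ?thesis using hcomp_homogeneous[OF hcomp_in[OF x assms(3)] assms(3)] by simp
  next
    case False
    then have "hcomp k x \<in> centre n" "hcomp k x \<in> Fil n 1"
      using assms k graded_Fil graded_subD by (auto simp: Az_def)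
    then have "hcomp k x = 0" using centre_Fil1 n_pos by blast
    then show ?thesis using False hcomp_homogeneous[OF hcomp_in[OF x assms(3)] assms(3)] by simp
  qed
  then have "x = hcomp h x" using hcomp_eqI x hcomp_UT by blast
  then show ?thesis using hcomp_in[OF x assms(3)] by simp
qed

end

section \<open>Multiplication operators on the superdiagonals and their degrees\<close>

context graded_UT
begin

text \<open>On the superdiagonal number l, which represents the factor number l of the lower central
  series, the matrices act as multiplication operators.  The set \<open>Q l h\<close> consists of those
  multiplication operators which shift degrees by h; only the indices i with \<open>i + l \<le> n\<close>
  matter.\<close>

definition Q :: "nat \<Rightarrow> 'g \<Rightarrow> (nat \<Rightarrow> 'f) set" where
  "Q l h = {c. \<forall>s\<in>carrier G. \<forall>v\<in>A s \<inter> Fil n l. \<exists>w\<in>A (h \<otimes> s) \<inter> Fil n l.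
     \<forall>i. w i (i + l) = c i * v i (i + l)}"

lemma Q_E:
  assumes "c \<in> Q l h" "s \<in> carrier G" "v \<in> A s" "v \<in> Fil n l"
  obtains w where "w \<in> A (h \<otimes> s)" "w \<in> Fil n l" "\<And>i. w i (i + l) = c i * v i (i + l)"
  using assms unfolding Q_def by blast

lemma Q_I:
  assumes "\<And>s v. s \<in> carrier G \<Longrightarrow> v \<in> A s \<Longrightarrow> v \<in> Fil n l \<Longrightarrow>
    \<exists>w. w \<in> A (h \<otimes> s) \<and> w \<in> Fil n l \<and> (\<forall>i. w i (i + l) = c i * v i (i + l))"
  shows "c \<in> Q l h"
  using assms unfolding Q_def by blast

text \<open>The bracket with x raises degrees by h, and \<open>bracket_leading\<close> shows that on
  superdiagonal l it multiplies by these root values.\<close>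

lemma Q_kappa:
  assumes "x \<in> A h" "h \<in> carrier G"
  shows "(\<lambda>i. x i i - x (i + l) (i + l)) \<in> Q l h"
proof (rule Q_I)
  fix s v assume "s \<in> carrier G" "v \<in> A s" and v: "v \<in> Fil n l"
  then have "bracket n x v \<in> A (h \<otimes> s)" using assms A_bracket by blast
  moreover have x: "x \<in> UT n" using assms A_UT by blast
  then have "bracket n x v \<in> Fil n l" using bracket_Fil[of x n 0 v l] v by (simp add: Fil_0)
  ultimately show "\<exists>w. w \<in> A (h \<otimes> s) \<and> w \<in> Fil n l \<and>
      (\<forall>i. w i (i + l) = (x i i - x (i + l) (i + l)) * v i (i + l))"
    using bracket_leading[OF x v] by blast
qed

lemma Fil_entry_zero: "v \<in> Fil n l \<Longrightarrow> \<not> (1 \<le> i \<and> i + l \<le> n) \<Longrightarrow> v i (i + l) = 0"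
  using UT_zero[of v n i "i + l"] by (auto simp: Fil_def)

lemma Q_cong:
  assumes "c \<in> Q l h" "\<And>i. 1 \<le> i \<Longrightarrow> i + l \<le> n \<Longrightarrow> c i = d i"
  shows "d \<in> Q l h"
proof (rule Q_I)
  fix s v assume s: "s \<in> carrier G" "v \<in> A s" and v: "v \<in> Fil n l"
  obtain w where w: "w \<in> A (h \<otimes> s)" "w \<in> Fil n l" "\<And>i. w i (i + l) = c i * v i (i + l)"
    using Q_E[OF assms(1) s v] by blast
  have "w i (i + l) = d i * v i (i + l)" for i
    using w(3)[of i] assms(2)[of i] Fil_entry_zero[OF v, of i] by (cases "1 \<le> i \<and> i + l \<le> n") auto
  then show "\<exists>w. w \<in> A (h \<otimes> s) \<and> w \<in> Fil n l \<and> (\<forall>i. w i (i + l) = d i * v i (i + l))"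
    using w by blast
qed

lemma Q_one: "(\<lambda>_. 1) \<in> Q l \<one>"
  by (rule Q_I) auto

lemma Q_scale: assumes "c \<in> Q l h" "h \<in> carrier G" shows "(\<lambda>i. r * c i) \<in> Q l h"
proof (rule Q_I)
  fix s v assume s: "s \<in> carrier G" "v \<in> A s" and v: "v \<in> Fil n l"
  obtain w where w: "w \<in> A (h \<otimes> s)" "w \<in> Fil n l" "\<And>i. w i (i + l) = c i * v i (i + l)"
    using Q_E[OF assms(1) s v] by blast
  show "\<exists>w. w \<in> A (h \<otimes> s) \<and> w \<in> Fil n l \<and> (\<forall>i. w i (i + l) = r * c i * v i (i + l))"
    using w s assms(2) by (intro exI[of _ "mscale r w"])
      (simp add: subspace_closed[OF subspace_Fil] subspace_closed[OF A_subspace])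
qed

lemma Q_add:
  assumes "c \<in> Q l h" "d \<in> Q l h" "h \<in> carrier G" shows "(\<lambda>i. c i + d i) \<in> Q l h"
proof (rule Q_I)
  fix s v assume s: "s \<in> carrier G" "v \<in> A s" and v: "v \<in> Fil n l"
  obtain w where w: "w \<in> A (h \<otimes> s)" "w \<in> Fil n l" "\<And>i. w i (i + l) = c i * v i (i + l)"
    using Q_E[OF assms(1) s v] by blast
  obtain w' where w': "w' \<in> A (h \<otimes> s)" "w' \<in> Fil n l" "\<And>i. w' i (i + l) = d i * v i (i + l)"
    using Q_E[OF assms(2) s v] by blast
  show "\<exists>w. w \<in> A (h \<otimes> s) \<and> w \<in> Fil n l \<and> (\<forall>i. w i (i + l) = (c i + d i) * v i (i + l))"
    using w w' s assms(3) by (intro exI[of _ "w + w'"])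
      (simp add: subspace_closed[OF subspace_Fil] subspace_closed[OF A_subspace] distrib_right)
qed

lemma Q_diff:
  assumes "c \<in> Q l h" "d \<in> Q l h" "h \<in> carrier G" shows "(\<lambda>i. c i - d i) \<in> Q l h"
  using Q_add[OF assms(1) Q_scale[OF assms(2,3), of "-1"] assms(3)] by simp

lemma Q_mult:
  assumes "c \<in> Q l h" "d \<in> Q l k" "h \<in> carrier G" "k \<in> carrier G"
  shows "(\<lambda>i. c i * d i) \<in> Q l (h \<otimes> k)"
proof (rule Q_I)
  fix s v assume s: "s \<in> carrier G" "v \<in> A s" and v: "v \<in> Fil n l"
  obtain w where w: "w \<in> A (k \<otimes> s)" "w \<in> Fil n l" "\<And>i. w i (i + l) = d i * v i (i + l)"
    using Q_E[OF assms(2) s v] by blast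
  obtain w' where w': "w' \<in> A (h \<otimes> (k \<otimes> s))" "w' \<in> Fil n l" "\<And>i. w' i (i + l) = c i * w i (i + l)"
    using Q_E[OF assms(1) _ w(1,2)] assms(4) s(1) by blast
  show "\<exists>w. w \<in> A (h \<otimes> k \<otimes> s) \<and> w \<in> Fil n l \<and> (\<forall>i. w i (i + l) = c i * d i * v i (i + l))"
    using w w' s assms(3,4) by (intro exI[of _ w']) (simp add: m_assoc)
qed

text \<open>The identity is applied to a homogeneous v. The images w s have different degrees, and
  their sum vanishes on superdiagonal l, so it lies in the next filtration step; that step is
  graded, hence contains each w s, and c s0 kills v. The components of
  \<open>munit i (i + l)\<close> are such v. The degree map is any injection, so that translated
  families are covered.\<close>

lemma Q_direct:
  assumes S: "finite S" "inj_on deg S" "deg ` S \<subseteq> carrier G"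
    and c: "\<And>s. s \<in> S \<Longrightarrow> c s \<in> Q l (deg s)"
    and sum0: "\<And>i. 1 \<le> i \<Longrightarrow> i + l \<le> n \<Longrightarrow> (\<Sum>s\<in>S. c s i) = 0"
    and s0: "s0 \<in> S" and i: "1 \<le> i" "i + l \<le> n"
  shows "c s0 i = 0"
proof -
  let ?M = "{v \<in> Fil n l. \<forall>i. c s0 i * v i (i + l) = 0}"
  have sub: "matr.subspace ?M"
    by (intro matr.subspaceI)
      (auto simp add: subspace_closed[OF subspace_Fil] distrib_left mult.left_commute simp del: mult_eq_0_iff)
  have deg: "deg s \<in> carrier G" if "s \<in> S" for s using S(3) that by blast
  have "v \<in> ?M" if k: "k \<in> carrier G" and v: "v \<in> A k" "v \<in> Fil n l" for k v
  proof -
    have "\<exists>w. w \<in> A (deg s \<otimes> k) \<and> w \<in> Fil n l \<and> (\<forall>i. w i (i + l) = c s i * v i (i + l))"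
      if "s \<in> S" for s using Q_E[OF c[OF that] k v] by metis
    then obtain w where w: "\<And>s. s \<in> S \<Longrightarrow> w s \<in> A (deg s \<otimes> k)" "\<And>s. s \<in> S \<Longrightarrow> w s \<in> Fil n l"
      "\<And>s i. s \<in> S \<Longrightarrow> w s i (i + l) = c s i * v i (i + l)" by metis
    let ?W = "\<Sum>s\<in>S. w s"
    have W: "?W \<in> Fil n l" using w(2) by (intro matr.subspace_sum[OF subspace_Fil])
    have "?W i (i + l) = 0" for i
    proof (cases "1 \<le> i \<and> i + l \<le> n")
      case True
      have "?W i (i + l) = (\<Sum>s\<in>S. c s i * v i (i + l))" using w(3) by (simp add: sum_matr_apply)
      also have "\<dots> = (\<Sum>s\<in>S. c s i) * v i (i + l)" by (simp add: sum_distrib_right)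
      finally show ?thesis using sum0 True by simp
    next
      case False then show ?thesis using Fil_entry_zero[OF W] by blast
    qed
    \<comment> \<open>One more superdiagonal vanishes, and \<open>graded_Fil\<close> passes this
      from the sum to its component of degree \<open>deg s0 \<otimes> k\<close>.\<close>
    then have "?W \<in> Fil n (Suc l)" using W by (auto simp: Fil_def less_Suc_eq)
    then have "hcomp (deg s0 \<otimes> k) ?W \<in> Fil n (Suc l)"
      using graded_subD[OF graded_Fil] deg[OF s0] k by simp
    also have "hcomp (deg s0 \<otimes> k) ?W = (\<Sum>s\<in>S. hcomp (deg s0 \<otimes> k) (w s))"
      using S(1) w(2) Fil_subset_UT by (intro hcomp_sum) blast+
    also have "\<dots> = hcomp (deg s0 \<otimes> k) (w s0)"
    proof (intro sum_single S(1) s0)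
      fix s assume s: "s \<in> S" "s \<noteq> s0"
      then have "deg s0 \<otimes> k \<noteq> deg s \<otimes> k"
        using S(2) s0 deg k inj_onD[OF S(2), of s0 s] by auto
      then show "hcomp (deg s0 \<otimes> k) (w s) = 0"
        using hcomp_homogeneous[OF w(1)[OF s(1)]] deg[OF s(1)] k by simp
    qed
    also have "\<dots> = w s0" using hcomp_homogeneous[OF w(1)[OF s0]] deg[OF s0] k by simp
    finally have "w s0 i (i + l) = 0" for i by (auto simp: Fil_def)
    then show ?thesis using w(3)[OF s0] v by simp
  qed
  moreover have "hcomp k (munit i (i + l)) \<in> A k" "hcomp k (munit i (i + l)) \<in> Fil n l"
    if "k \<in> carrier G" for k
    using that hcomp_in munit_UT[of i "i + l" n] munit_Fil[of i l "i + l" n] graded_subD[OF graded_Fil] i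
    by simp_all
  ultimately have "hcomp k (munit i (i + l)) \<in> ?M" if "k \<in> carrier G" for k
    using that by blast
  then have "munit i (i + l) \<in> ?M"
    by (rule hcomp_mem[OF munit_UT[OF i(1) le_add1 i(2)] sub])
  then have "c s0 i * munit i (i + l) i (i + l) = 0" by blast
  then show ?thesis by (simp add: munit_def)
qed

lemma Q_disjoint:
  assumes "c \<in> Q l h" "d \<in> Q l k" "h \<in> carrier G" "k \<in> carrier G" "h \<noteq> k"
    and "\<And>i. 1 \<le> i \<Longrightarrow> i + l \<le> n \<Longrightarrow> c i = d i" and i: "1 \<le> i" "i + l \<le> n"
  shows "c i = 0"
proof -
  have d': "(\<lambda>i. - 1 * d i) \<in> Q l k" using Q_scale assms by blast
  have "(if h = h then c else (\<lambda>i. - 1 * d i)) i = 0"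
    by (rule Q_direct[of "{h, k}" "\<lambda>x. x" "\<lambda>x. if x = h then c else (\<lambda>i. - 1 * d i)" l])
      (use assms d' in auto)
  then show ?thesis by simp
qed

text \<open>On the points a and b the functions u = (1, 1) and w = (1, -1) form a basis because 2 is
  nonzero. Half the sum and half the difference of x and y are the coordinates p and q of v, and
  independence of degrees leaves only the coordinate belonging to h.\<close>

lemma two_point:
  assumes two: "(2::'f) \<noteq> 0" and g: "g \<in> carrier G" "g \<noteq> \<one>"
    and ab: "a \<noteq> b" "1 \<le> a" "a + l \<le> n" "1 \<le> b" "b + l \<le> n"
    and u: "u \<in> Q l \<one>" "\<And>i. 1 \<le> i \<Longrightarrow> i + l \<le> n \<Longrightarrow> u i = (if i = a then 1 else if i = b then 1 else 0)"
    and w: "w \<in> Q l g" "\<And>i. 1 \<le> i \<Longrightarrow> i + l \<le> n \<Longrightarrow> w i = (if i = a then 1 else if i = b then -1 else 0)"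
    and v: "v \<in> Q l h" "\<And>i. 1 \<le> i \<Longrightarrow> i + l \<le> n \<Longrightarrow> v i = (if i = a then x else if i = b then y else 0)"
    and h: "h \<in> carrier G"
  shows "(h \<noteq> \<one> \<and> h \<noteq> g \<longrightarrow> x = 0 \<and> y = 0) \<and> (h = g \<longrightarrow> x + y = 0) \<and> (h = \<one> \<longrightarrow> x = y)"
proof -
  define p q where "p = (x + y) / 2" and "q = (x - y) / 2"
  have "p + q = (2 * x) / 2" "p - q = (2 * y) / 2"
    unfolding p_def q_def add_divide_distrib[symmetric] diff_divide_distrib[symmetric]
    by (rule arg_cong[where f = "\<lambda>z. z / 2"], algebra)+
  then have pq: "p + q = x" "p - q = y" using two by simp_all
  have eq: "v i = p * u i + q * w i" if "1 \<le> i" "i + l \<le> n" for i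
    using u(2)[OF that] w(2)[OF that] v(2)[OF that] pq by auto
  have pu: "(\<lambda>i. p * u i) \<in> Q l \<one>" and qw: "(\<lambda>i. q * w i) \<in> Q l g"
    using Q_scale u(1) w(1) g by auto
  consider "h = \<one>" | "h = g" | "h \<noteq> \<one>" "h \<noteq> g" by blast
  then show ?thesis
  proof cases
    case 1
    have "(\<lambda>i. v i - p * u i) \<in> Q l \<one>" using Q_diff v(1) pu 1 by auto
    then have "v a - p * u a = 0" using Q_disjoint[OF _ qw, of _ \<one> a] g ab eq by auto
    then have "q = 0" using eq[of a] ab w(2)[of a] by simp
    then show ?thesis using 1 g pq by auto
  next
    case 2
    have "(\<lambda>i. v i - q * w i) \<in> Q l g" using Q_diff v(1) qw 2 h by auto
    then have "v a - q * w a = 0" using Q_disjoint[OF _ pu, of _ g a] g ab eq by auto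
    then have "p = 0" using eq[of a] ab u(2)[of a] by simp
    then show ?thesis using 2 g pq by auto
  next
    case 3
    let ?c = "\<lambda>s. if s = \<one> then (\<lambda>i. p * u i) else if s = g then (\<lambda>i. q * w i) else (\<lambda>i. - 1 * v i)"
    have v': "(\<lambda>i. - 1 * v i) \<in> Q l h" using Q_scale v(1) h by blast
    have "?c h i = 0" if "1 \<le> i" "i + l \<le> n" for i
      by (rule Q_direct[of "{\<one>, g, h}" "\<lambda>s. s" ?c l])
        (use that 3 g h v' pu qw eq in auto)
    then have "v a = 0" "v b = 0" using 3 ab by auto
    then show ?thesis using v(2)[of a] v(2)[of b] ab 3 by auto
  qed
qed

subsection \<open>The torus modulo the nilradical\<close>

definition simple_root :: "'f matr \<Rightarrow> nat \<Rightarrow> 'f" where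
  "simple_root x i = x i i - x (Suc i) (Suc i)"

text \<open>A right inverse of \<open>simple_root\<close> on the indices below n, normalized by the
  entry 0 (an empty sum) at position n.\<close>

definition diag_of_roots :: "(nat \<Rightarrow> 'f) \<Rightarrow> 'f matr" where
  "diag_of_roots c = (\<lambda>i j. if i = j \<and> 1 \<le> i \<and> i \<le> n then (\<Sum>k=i..<n. c k) else 0)"

lemma diag_of_roots_UT: "diag_of_roots c \<in> UT n"
  by (simp add: UT_iff diag_of_roots_def)

lemma simple_root_diag_of_roots: "1 \<le> i \<Longrightarrow> i < n \<Longrightarrow> simple_root (diag_of_roots c) i = c i"
  by (simp add: simple_root_def diag_of_roots_def sum.atLeast_Suc_lessThan)

text \<open>The decomposition of a function on the simple roots into functions in
  \<open>Q 1 h\<close>, obtained by lifting it to a diagonal matrix; see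
  \<open>root_comp_expand\<close> and \<open>root_comp_Q\<close>.\<close>

definition root_comp :: "'g \<Rightarrow> (nat \<Rightarrow> 'f) \<Rightarrow> nat \<Rightarrow> 'f" where
  "root_comp h c = simple_root (hcomp h (diag_of_roots c))"

lemma simple_root_Q: "x \<in> A h \<Longrightarrow> h \<in> carrier G \<Longrightarrow> simple_root x \<in> Q 1 h"
  using Q_kappa[of x h 1] by (simp add: simple_root_def[abs_def])

lemma root_comp_Q: "h \<in> carrier G \<Longrightarrow> root_comp h c \<in> Q 1 h"
  unfolding root_comp_def by (intro simple_root_Q hcomp_in diag_of_roots_UT)

lemma root_comp_expand:
  obtains S where "finite S" "S \<subseteq> carrier G"
    "\<And>i. 1 \<le> i \<Longrightarrow> i < n \<Longrightarrow> c i = (\<Sum>s\<in>S. root_comp s c i)" "\<And>h i. h \<notin> S \<Longrightarrow> root_comp h c i = 0"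
proof -
  obtain S where S: "finite S" "S \<subseteq> carrier G" "diag_of_roots c = (\<Sum>g\<in>S. hcomp g (diag_of_roots c))"
    "\<And>h. h \<notin> S \<Longrightarrow> hcomp h (diag_of_roots c) = 0"
    using hcomp_expand[OF diag_of_roots_UT] by blast
  have "c i = (\<Sum>s\<in>S. root_comp s c i)" if "1 \<le> i" "i < n" for i
  proof -
    have "diag_of_roots c j j = (\<Sum>g\<in>S. hcomp g (diag_of_roots c) j j)" for j
      by (subst S(3)) (rule sum_matr_apply)
    then have "simple_root (diag_of_roots c) i = (\<Sum>s\<in>S. root_comp s c i)"
      unfolding simple_root_def root_comp_def by (simp only: sum_subtractf)
    then show ?thesis using simple_root_diag_of_roots[OF that] by simp
  qed
  then show ?thesis using that S by (simp add: root_comp_def simple_root_def)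
qed

text \<open>Converse of \<open>simple_root_Q\<close>. The functions \<open>root_comp s c\<close> add
  up to c; subtracting c from the one of degree h gives a vanishing sum of operators of different
  degrees, so \<open>root_comp h c\<close> agrees with c.\<close>

lemma Q_simple_root:
  assumes c: "c \<in> Q 1 h" and h: "h \<in> carrier G"
  obtains x where "x \<in> A h" "\<And>i. 1 \<le> i \<Longrightarrow> i < n \<Longrightarrow> simple_root x i = c i"
proof
  show "hcomp h (diag_of_roots c) \<in> A h" using hcomp_in diag_of_roots_UT h by blast
  obtain S where S: "finite S" "S \<subseteq> carrier G" "\<And>i. 1 \<le> i \<Longrightarrow> i < n \<Longrightarrow> c i = (\<Sum>s\<in>S. root_comp s c i)"
    "\<And>h i. h \<notin> S \<Longrightarrow> root_comp h c i = 0" by (rule root_comp_expand[of c]) blast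
  let ?d = "\<lambda>s. if s = h then (\<lambda>i. root_comp h c i - c i) else root_comp s c"
  have "?d h i = 0" if i: "1 \<le> i" "i < n" for i
  proof (rule Q_direct[of "insert h S" "\<lambda>s. s" ?d 1])
    show "?d s \<in> Q 1 s" if "s \<in> insert h S" for s
      using that S(2) c h root_comp_Q Q_diff by (cases "s = h") auto
    fix i assume i: "1 \<le> i" "i + 1 \<le> n"
    have "(\<Sum>s\<in>insert h S. ?d s i) = (\<Sum>s\<in>insert h S. root_comp s c i - (if s = h then c i else 0))"
      by (intro sum.cong) auto
    also have "\<dots> = (\<Sum>s\<in>insert h S. root_comp s c i) - c i"
      using S(1) by (simp add: sum_subtractf del: sum.insert)
    also have "(\<Sum>s\<in>insert h S. root_comp s c i) = (\<Sum>s\<in>S. root_comp s c i)"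
      using S(1,4) by (intro sum.mono_neutral_right) auto
    also have "\<dots> = c i" using S(3) i by simp
    finally show "(\<Sum>s\<in>insert h S. ?d s i) = 0" by simp
  qed (use S h i in auto)
  then show "simple_root (hcomp h (diag_of_roots c)) i = c i" if "1 \<le> i" "i < n" for i
    using that by (simp add: root_comp_def)
qed

text \<open>A root of height l is the sum of l consecutive simple roots. So if c consists of the
  simple root values of a homogeneous x, these sums are the values in
  \<open>Q_kappa\<close>.\<close>

lemma Q_sums:
  assumes c: "c \<in> Q 1 h" and h: "h \<in> carrier G"
  shows "(\<lambda>i. \<Sum>j=i..<i + l. c j) \<in> Q l h"
proof -
  obtain x where x: "x \<in> A h" "\<And>i. 1 \<le> i \<Longrightarrow> i < n \<Longrightarrow> simple_root x i = c i" using Q_simple_root[OF assms] by blast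
  have "x i i - x (i + k) (i + k) = (\<Sum>j=i..<i + k. c j)" if "1 \<le> i" "i + k \<le> n" for i k
    using that
  proof (induct k)
    case (Suc k)
    then have 1: "x i i - x (i + k) (i + k) = (\<Sum>j=i..<i + k. c j)" by simp
    have 2: "x (i + k) (i + k) - x (Suc (i + k)) (Suc (i + k)) = c (i + k)"
      using x(2)[of "i + k"] Suc(2,3) by (simp add: simple_root_def)
    have "(\<Sum>j=i..<i + Suc k. c j) = (\<Sum>j=i..<i + k. c j) + c (i + k)" by simp
    then show ?case unfolding 1[symmetric] 2[symmetric] by simp
  qed simp
  then show ?thesis by (rule Q_cong[OF Q_kappa[OF x(1) h, of l]])
qed

text \<open>The product of the level 2 sums of c and d, minus the level 2 sum of the product of c
  and d, leaves exactly the cross terms. This lets information pass from one simple root to its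
  neighbour.\<close>

lemma Q_adjacent:
  assumes "c \<in> Q 1 h" "d \<in> Q 1 k" "h \<in> carrier G" "k \<in> carrier G"
  shows "(\<lambda>i. c i * d (Suc i) + c (Suc i) * d i) \<in> Q 2 (h \<otimes> k)"
proof -
  have s: "(\<Sum>j=i..<i + 2. f j) = f i + (f (Suc i) :: 'f)" for f i
    by (simp add: numeral_2_eq_2)
  have "(\<lambda>i. (c i + c (Suc i)) * (d i + d (Suc i)) - (c i * d i + c (Suc i) * d (Suc i))) \<in> Q 2 (h \<otimes> k)"
    using Q_diff[OF Q_mult[OF Q_sums[OF assms(1,3), of 2] Q_sums[OF assms(2,4), of 2] assms(3,4)]
        Q_sums[OF Q_mult[OF assms], of 2]] assms(3,4) unfolding s by simp
  then show ?thesis by (simp add: algebra_simps)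
qed

text \<open>A homogeneity test which asks for the vanishing of the other components only on the
  support of e.\<close>

lemma Q_detect:
  assumes r: "r \<in> carrier G"
    and "\<And>h i. h \<in> carrier G \<Longrightarrow> h \<noteq> r \<Longrightarrow> 1 \<le> i \<Longrightarrow> i < n \<Longrightarrow> e i * root_comp h e i = 0"
  shows "e \<in> Q 1 r"
proof -
  obtain S where S: "finite S" "S \<subseteq> carrier G" "\<And>i. 1 \<le> i \<Longrightarrow> i < n \<Longrightarrow> e i = (\<Sum>s\<in>S. root_comp s e i)"
    "\<And>h i. h \<notin> S \<Longrightarrow> root_comp h e i = 0" by (rule root_comp_expand[of e]) blast
  have z: "root_comp h e i = 0" if h: "h \<in> S" "h \<noteq> r" and i: "1 \<le> i" "i < n" for h i
  proof -
    have hG: "h \<in> carrier G" using h S(2) by blast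
    \<comment> \<open>The products of \<open>root_comp h e\<close> with all components of e have the
      different degrees \<open>s \<otimes> h\<close>, and their sum is e times
      \<open>root_comp h e\<close>, which is 0. So the product for s = h, a square,
      vanishes.\<close>
    have "(\<lambda>i. root_comp h e i * root_comp h e i) i = 0"
    proof (rule Q_direct[of S "\<lambda>s. s \<otimes> h" "\<lambda>s i. root_comp s e i * root_comp h e i" 1])
      show "inj_on (\<lambda>s. s \<otimes> h) S" using S(2) hG by (intro inj_onI) (metis right_cancel subsetD)
      show "(\<lambda>i. root_comp s e i * root_comp h e i) \<in> Q 1 (s \<otimes> h)" if "s \<in> S" for s
        using that S(2) hG by (intro Q_mult root_comp_Q) auto
      fix i assume i: "1 \<le> i" "i + 1 \<le> n"
      then have "(\<Sum>s\<in>S. root_comp s e i * root_comp h e i) = e i * root_comp h e i"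
        using S(3)[of i] by (simp add: sum_distrib_right)
      then show "(\<Sum>s\<in>S. root_comp s e i * root_comp h e i) = 0" using assms(2) hG h i by simp
    qed (use S hG h i in auto)
    then show ?thesis by simp
  qed
  have "root_comp r e i = e i" if i: "1 \<le> i" "i + 1 \<le> n" for i
  proof -
    have "e i = (\<Sum>s\<in>insert r S. root_comp s e i)"
      using S i by (subst S(3)) (auto intro!: sum.mono_neutral_left)
    also have "\<dots> = root_comp r e i"
      using z S i by (intro sum_single) auto
    finally show ?thesis by simp
  qed
  then show ?thesis using Q_cong[OF root_comp_Q[OF r]] by blast
qed

text \<open>A linear functional that kills all components of degree other than r takes the same
  value on e as on its component of degree r.\<close>

lemma root_comp_functional:
  assumes L: "\<And>h d. h \<in> carrier G \<Longrightarrow> h \<noteq> r \<Longrightarrow> d \<in> Q 1 h \<Longrightarrow> p * d i + q * d j = 0"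
    and ij: "1 \<le> i" "i < n" "1 \<le> j" "j < n" and e: "p * e i + q * e j = 0"
  shows "p * root_comp r e i + q * root_comp r e j = 0"
proof -
  obtain S where S: "finite S" "S \<subseteq> carrier G" "\<And>i. 1 \<le> i \<Longrightarrow> i < n \<Longrightarrow> e i = (\<Sum>s\<in>S. root_comp s e i)"
    "\<And>h i. h \<notin> S \<Longrightarrow> root_comp h e i = 0" by (rule root_comp_expand[of e]) blast
  have eq: "e k = (\<Sum>s\<in>insert r S. root_comp s e k)" if "1 \<le> k" "k < n" for k
    using S that by (subst S(3)) (auto intro!: sum.mono_neutral_left)
  have "0 = (\<Sum>s\<in>insert r S. p * root_comp s e i + q * root_comp s e j)"
    using e eq[OF ij(1,2)] eq[OF ij(3,4)] by (simp only: sum.distrib sum_distrib_left)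
  also have "\<dots> = p * root_comp r e i + q * root_comp r e j"
    using S L root_comp_Q by (intro sum_single) auto
  finally show ?thesis by simp
qed

text \<open>Level \<open>n - 1\<close> has the single index 1, so every operator there is a constant
  and hence of trivial degree. Its value is the highest root, the sum of all simple roots.\<close>

lemma Q_trace:
  assumes "2 \<le> n" "c \<in> Q 1 h" "h \<in> carrier G" "h \<noteq> \<one>"
  shows "(\<Sum>j=1..<n. c j) = 0"
proof -
  let ?s = "\<Sum>j=1..<n. c j"
  have a: "(\<lambda>i. \<Sum>j=i..<i + (n - 1). c j) \<in> Q (n - 1) h" using Q_sums assms by blast
  have b: "(\<lambda>i. ?s * 1) \<in> Q (n - 1) \<one>" using Q_scale[OF Q_one] by blast
  have eq: "(\<Sum>j=i..<i + (n - 1). c j) = ?s * 1" if "1 \<le> i" "i + (n - 1) \<le> n" for i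
  proof -
    have "i = 1" using that assms(1) by linarith
    then show ?thesis using assms(1) by simp
  qed
  have "(\<Sum>j=1..<1 + (n - 1). c j) = 0"
    by (rule Q_disjoint[OF a b assms(3) one_closed assms(4) eq]) (use assms(1) in auto)
  then show ?thesis using assms(1) by simp
qed

text \<open>Level \<open>n - 2\<close> has the indices 1 and 2, whose roots omit the last and the
  first simple root. By \<open>Q_trace\<close> the values there are, for nontrivial degree, the
  negatives of \<open>c (n - 1)\<close> and \<open>c 1\<close>. The constants and one operator p of
  nontrivial degree g span all functions on two points, so no third degree can occur.\<close>

lemma Q_end_cases:
  assumes n3: "3 \<le> n"
  shows "(\<forall>h\<in>carrier G. \<forall>c\<in>Q 1 h. h \<noteq> \<one> \<longrightarrow> c 1 = 0 \<and> c (n - 1) = 0) \<or>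
    ((2::'f) \<noteq> 0 \<and> (\<exists>g\<in>carrier G. g \<noteq> \<one> \<and> g \<otimes> g = \<one> \<and>
      (\<forall>h\<in>carrier G. \<forall>c\<in>Q 1 h. (h \<noteq> \<one> \<and> h \<noteq> g \<longrightarrow> c 1 = 0 \<and> c (n - 1) = 0) \<and>
        (h = g \<longrightarrow> c 1 + c (n - 1) = 0) \<and> (h = \<one> \<longrightarrow> c 1 = c (n - 1)))))" (is "?A \<or> ?B")
proof (cases ?A)
  case False
  then obtain g c where g: "g \<in> carrier G" "g \<noteq> \<one>" and c: "c \<in> Q 1 g" "\<not> (c 1 = 0 \<and> c (n - 1) = 0)"
    by blast
  define l where "l = n - 2"
  have nl: "n = l + 2" "1 \<le> l" using n3 by (auto simp: l_def)
  have rng: "i = 1 \<or> i = 2" if "1 \<le> i" "i + l \<le> n" for i using that nl by auto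
  define sm where "sm = (\<lambda>(d::nat \<Rightarrow> 'f) i. \<Sum>j=i..<i + l. d j)"
  have smQ: "sm d \<in> Q l h" if "d \<in> Q 1 h" "h \<in> carrier G" for d h
    unfolding sm_def using Q_sums that by blast
  have sm1: "sm d 1 = (\<Sum>j=1..<n. d j) - d (n - 1)" for d
  proof -
    have "n - 1 = Suc l" using nl by simp
    then show ?thesis using nl by (simp add: sm_def)
  qed
  have sm2: "sm d 2 = (\<Sum>j=1..<n. d j) - d 1" for d
  proof -
    have "(\<Sum>j=1..<n. d j) = d 1 + (\<Sum>j=Suc 1..<n. d j)"
      using nl by (intro sum.atLeast_Suc_lessThan) simp
    then show ?thesis using nl by (simp add: sm_def numeral_2_eq_2)
  qed
  define p where "p = sm c"
  have p1: "p 1 = - c (n - 1)" and p2: "p 2 = - c 1"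
    using sm1[of c] sm2[of c] Q_trace[OF _ c(1) g] n3 by (simp_all add: p_def)
  have pQ: "p \<in> Q l g" using smQ c g by (simp add: p_def)
  \<comment> \<open>A constant p would have degree 1 as well as g, and so vanish.\<close>
  have ne: "p 1 \<noteq> p 2"
  proof
    assume eq: "p 1 = p 2"
    have "p i = 0" if "1 \<le> i" "i + l \<le> n" for i
    proof (rule Q_disjoint[OF pQ Q_scale[OF Q_one, of "p 1"] g(1) _ g(2)])
      show "p i = p 1 * 1" if "1 \<le> i" "i + l \<le> n" for i using rng[OF that] eq by auto
    qed (use that in auto)
    then have "p 1 = 0" "p 2 = 0" using nl by auto
    then show False using c(2) p1 p2 by simp
  qed
  \<comment> \<open>As p takes two values, q is interpolated by a + b p; the three terms have three
    different degrees.\<close>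
  have combo: "q 1 = 0 \<and> q 2 = 0" if q: "q \<in> Q l h" "h \<in> carrier G" "h \<noteq> \<one>" "h \<noteq> g" for q h
  proof -
    define b where "b = (q 1 - q 2) / (p 1 - p 2)"
    define a where "a = q 1 - b * p 1"
    have q2: "q 2 = a + b * p 2"
    proof -
      have "b * (p 1 - p 2) = q 1 - q 2" using ne by (simp add: b_def)
      then show ?thesis by (simp add: a_def algebra_simps)
    qed
    have q1: "q 1 = a + b * p 1" by (simp add: a_def)
    let ?c = "\<lambda>s. if s = \<one> then (\<lambda>i. a * 1) else if s = g then (\<lambda>i. b * p i) else (\<lambda>i. - 1 * q i)"
    have "?c h i = 0" if i: "1 \<le> i" "i + l \<le> n" for i
    proof (rule Q_direct[of "{\<one>, g, h}" "\<lambda>s. s" ?c l])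
      show "?c s \<in> Q l s" if "s \<in> {\<one>, g, h}" for s
        using that g q Q_scale[OF Q_one, of a] Q_scale[OF pQ, of b] Q_scale[OF q(1), of "-1"]
        by (auto simp del: mult_minus1 mult_1_right)
      show "(\<Sum>s\<in>{\<one>, g, h}. ?c s i) = 0" if "1 \<le> i" "i + l \<le> n" for i
        using rng[OF that] q1 q2 q(3,4) g(2) by auto
    qed (use g q i in auto)
    then have "q i = 0" if "1 \<le> i" "i + l \<le> n" for i using that q(3,4) by simp
    then show ?thesis using nl by auto
  qed
  have pp: "(\<lambda>i. p i * p i) \<in> Q l (g \<otimes> g)" using Q_mult pQ g by blast
  \<comment> \<open>Otherwise \<open>combo\<close> applies to the square of p and makes p vanish at
    both points.\<close>
  have gg: "g \<otimes> g = \<one>"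
  proof (rule ccontr)
    assume "g \<otimes> g \<noteq> \<one>"
    moreover have "g \<otimes> g \<noteq> g" using g by simp
    ultimately have "p 1 * p 1 = 0 \<and> p 2 * p 2 = 0" using combo[OF pp] g by simp
    then show False using ne by simp
  qed
  \<comment> \<open>The polynomial (X - p 1) (X - p 2) annihilates p. Its even part has degree 1 and
    its linear part degree g, so both vanish, which gives p 1 + p 2 = 0.\<close>
  have "(\<lambda>i. p i * p i + (p 1 * p 2) * 1) \<in> Q l \<one>"
    using Q_add[OF _ Q_scale[OF Q_one]] pp gg by simp
  moreover have "(\<lambda>i. (p 1 + p 2) * p i) \<in> Q l g" using Q_scale pQ g by blast
  moreover have "p i * p i + (p 1 * p 2) * 1 = (p 1 + p 2) * p i" if "1 \<le> i" "i + l \<le> n" for i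
    using rng[OF that] by (auto simp: algebra_simps)
  ultimately have z: "p i * p i + (p 1 * p 2) * 1 = 0" if "1 \<le> i" "i + l \<le> n" for i
    using Q_disjoint[of "\<lambda>i. p i * p i + (p 1 * p 2) * 1" l \<one> "\<lambda>i. (p 1 + p 2) * p i" g i] g that by auto
  have z': "(p 1 + p 2) * p 1 = 0" "(p 1 + p 2) * p 2 = 0"
    using z[of 1] z[of 2] nl by (auto simp: algebra_simps)
  have p12: "p 2 = - p 1"
  proof -
    have "p 1 \<noteq> 0 \<or> p 2 \<noteq> 0" using ne by auto
    then have "p 1 + p 2 = 0" using z' by auto
    then show ?thesis by (simp add: add_eq_0_iff)
  qed
  have two: "(2::'f) \<noteq> 0"
  proof
    assume "(2::'f) = 0"
    then have "p 1 + p 1 = 0" by (metis mult_2 mult_zero_left)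
    then show False using ne p12 by (simp add: add_eq_0_iff2)
  qed
  have p10: "p 1 \<noteq> 0" using ne p12 by auto
  have w: "(\<lambda>i. inverse (p 1) * p i) \<in> Q l g" using Q_scale pQ g by blast
  have main: "(h \<noteq> \<one> \<and> h \<noteq> g \<longrightarrow> sm d 1 = 0 \<and> sm d 2 = 0) \<and> (h = g \<longrightarrow> sm d 1 + sm d 2 = 0) \<and>
      (h = \<one> \<longrightarrow> sm d 1 = sm d 2)" if "d \<in> Q 1 h" "h \<in> carrier G" for d h
  proof (rule two_point[OF two g, of 1 2 l _ _ "sm d"])
    show "sm d i = (if i = 1 then sm d 1 else if i = 2 then sm d 2 else 0)" if "1 \<le> i" "i + l \<le> n" for i
      using rng[OF that] by auto
    show "inverse (p 1) * p i = (if i = 1 then 1 else if i = 2 then - 1 else 0)" if "1 \<le> i" "i + l \<le> n" for i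
      using rng[OF that] p12 p10 by auto
    show "1 = (if i = 1 then 1 else if i = 2 then 1 else 0 :: 'f)" if "1 \<le> i" "i + l \<le> n" for i
      using rng[OF that] by auto
  qed (use nl that smQ w Q_one in auto)
  have "(h \<noteq> \<one> \<and> h \<noteq> g \<longrightarrow> d 1 = 0 \<and> d (n - 1) = 0) \<and>
        (h = g \<longrightarrow> d 1 + d (n - 1) = 0) \<and> (h = \<one> \<longrightarrow> d 1 = d (n - 1))"
    if d: "d \<in> Q 1 h" "h \<in> carrier G" for d h
  proof (cases "h = \<one>")
    case True
    then show ?thesis using main[OF d] sm1[of d] sm2[of d] g by auto
  next
    case False
    then have "sm d 1 = - d (n - 1)" "sm d 2 = - d 1"
      using sm1[of d] sm2[of d] Q_trace[OF _ d False] n3 by auto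
    then have "sm d 1 = - d (n - 1)" "sm d 2 = - d 1" "sm d 1 + sm d 2 = - (d 1 + d (n - 1))" by simp_all
    then show ?thesis using main[OF d] False by (simp only: neg_equal_0_iff_equal) blast
  qed
  then show ?thesis using two g gg by blast
qed blast

text \<open>The vanishing is pushed from the simple root i to its neighbour k = i + 1: a function
  supported at a single index of level 2 is a multiple of an idempotent, and its nonzero value would
  force h to be 1.\<close>

lemma Q_trivial:
  assumes base: "\<And>h c. h \<in> carrier G \<Longrightarrow> c \<in> Q 1 h \<Longrightarrow> h \<noteq> \<one> \<Longrightarrow> c 1 = 0"
    and i: "1 \<le> i" "i < n" and c: "c \<in> Q 1 h" "h \<in> carrier G" "h \<noteq> \<one>"
  shows "c i = 0"
  using i c
proof (induct i arbitrary: c h rule: less_induct)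
  case (less k)
  show ?case
  proof (cases "k = 1")
    case True then show ?thesis using base less by blast
  next
    case False
    define i where "i = k - 1"
    have i: "k = Suc i" "1 \<le> i" using False less(2) by (auto simp: i_def)
    \<comment> \<open>The indicator of the simple roots already treated. It has trivial degree by
      \<open>Q_detect\<close>, as the induction hypothesis kills the other components on its
      support.\<close>
    define E where "E = (\<lambda>j. if j \<le> i then 1 else 0 :: 'f)"
    have E: "E \<in> Q 1 \<one>"
    proof (rule Q_detect)
      fix h j assume h: "h \<in> carrier G" "h \<noteq> \<one>" and j: "1 \<le> j" "j < n"
      show "E j * root_comp h E j = 0"
        using less(1)[of j "root_comp h E" h] root_comp_Q h j i by (cases "j \<le> i") (auto simp: E_def)
    qed simp
    have c': "(\<lambda>j. c j - E j * c j) \<in> Q 1 h"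
      using Q_diff[OF less(4) _ less(5)] Q_mult[OF E less(4)] less(5) by simp
    \<comment> \<open>The cross terms of E and of c cut off outside E survive only at the edge i,
      where they show the new value \<open>c k\<close>.\<close>
    define v where "v = (\<lambda>j. E j * (c (Suc j) - E (Suc j) * c (Suc j)) + E (Suc j) * (c j - E j * c j))"
    have v: "v \<in> Q 2 h" using Q_adjacent[OF E c' _ less(5)] less(5) by (simp add: v_def)
    have v_eq: "v j = (if j = i then c k else 0)" for j
      using i by (auto simp: v_def E_def)
    have vv: "(\<lambda>j. v j * v j) \<in> Q 2 (h \<otimes> h)" using Q_mult v less(5) by blast
    have cv: "(\<lambda>j. c k * v j) \<in> Q 2 h" using Q_scale v less(5) by blast
    \<comment> \<open>The square of v is \<open>c k\<close> times v, while its degree is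
      \<open>h \<otimes> h\<close>, which differs from h.\<close>
    have hh: "h \<otimes> h \<noteq> h" using less(5,6) by simp
    have "v i * v i = 0"
      by (rule Q_disjoint[OF vv cv _ less(5) hh]) (use less(3,5) i v_eq in auto)
    then show ?thesis using v_eq by simp
  qed
qed

text \<open>The analogue of \<open>Q_trivial\<close> advancing from both ends at once. The values at
  k and \<open>n - k\<close> appear together at two indices of level 2, where the operators (1, 1)
  of degree 1 and (1, -1) of degree g are available and \<open>two_point\<close> decides.\<close>

lemma Q_symmetric:
  assumes two: "(2::'f) \<noteq> 0" and g: "g \<in> carrier G" "g \<noteq> \<one>" "g \<otimes> g = \<one>"
    and base: "\<And>h c. h \<in> carrier G \<Longrightarrow> c \<in> Q 1 h \<Longrightarrow> (h \<noteq> \<one> \<and> h \<noteq> g \<longrightarrow> c 1 = 0 \<and> c (n - 1) = 0) \<and>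
        (h = g \<longrightarrow> c 1 + c (n - 1) = 0) \<and> (h = \<one> \<longrightarrow> c 1 = c (n - 1))"
    and i: "1 \<le> i" "2 * i \<le> n" and c: "c \<in> Q 1 h" "h \<in> carrier G"
  shows "(h \<noteq> \<one> \<and> h \<noteq> g \<longrightarrow> c i = 0 \<and> c (n - i) = 0) \<and>
        (h = g \<longrightarrow> c i + c (n - i) = 0) \<and> (h = \<one> \<longrightarrow> c i = c (n - i))"
  using i c
proof (induct i arbitrary: c h rule: less_induct)
  case (less k)
  show ?case
  proof (cases "k = 1")
    case True then show ?thesis using base less by blast
  next
    case False
    define i where "i = k - 1"
    have i: "k = Suc i" "1 \<le> i" "i + 1 < n - i" "2 * i \<le> n" "i < n"
      using False less(2,3) by (auto simp: i_def)
    \<comment> \<open>The sign function of the part already treated: 1 on the left end, -1 on the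
      right end. Its square E is the indicator of both ends.\<close>
    define D where "D = (\<lambda>j. if j \<le> i then 1 else if n - i \<le> j then - 1 else 0 :: 'f)"
    have D: "D \<in> Q 1 g"
    proof (rule Q_detect[OF g(1)])
      fix h j assume h: "h \<in> carrier G" "h \<noteq> g" and j: "1 \<le> j" "j < n"
      have *: "root_comp h D j = 0 \<and> root_comp h D (n - j) = 0" if j: "1 \<le> j" "j \<le> i" for j
      proof (cases "h = \<one>")
        case False
        then show ?thesis using less(1)[of j "root_comp h D" h] root_comp_Q h j i by simp
      next
        case True
        have double: "2 * a = 0" if "1 * a + 1 * b = 0" "a = b" for a b :: 'f
          using that by (simp only: mult_2 mult_1_left)
        \<comment> \<open>D is antisymmetric and all components of nontrivial degree are
          antisymmetric or zero here, so the component of degree 1 is antisymmetric too. It is also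
          symmetric by the induction hypothesis, hence 0.\<close>
        have "1 * root_comp \<one> D j + 1 * root_comp \<one> D (n - j) = 0"
        proof (rule root_comp_functional)
          fix h d assume "h \<in> carrier G" "h \<noteq> \<one>" "d \<in> Q 1 h"
          then show "1 * d j + 1 * d (n - j) = 0" using less(1)[of j d h] j i by (cases "h = g") auto
        qed (use j i in \<open>auto simp: D_def\<close>)
        moreover have "root_comp \<one> D j = root_comp \<one> D (n - j)"
          using less(1)[of j "root_comp \<one> D" \<one>] root_comp_Q j i by simp
        ultimately have "2 * root_comp \<one> D j = 0" by (rule double)
        then show ?thesis using two True \<open>root_comp \<one> D j = root_comp \<one> D (n - j)\<close> by simp
      qed
      show "D j * root_comp h D j = 0"
      proof (cases "j \<le> i \<or> n - i \<le> j")
        case True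
        then show ?thesis using *[of j] *[of "n - j"] j i by (cases "j \<le> i") auto
      qed (simp add: D_def)
    qed
    define E where "E = (\<lambda>j. D j * D j)"
    have E: "E \<in> Q 1 \<one>" using Q_mult[OF D D g(1) g(1)] g(3) by (simp add: E_def)
    have E_eq: "E j = (if j \<le> i \<or> n - i \<le> j then 1 else 0)" for j by (simp add: E_def D_def)
    have E': "(\<lambda>j. 1 - E j) \<in> Q 1 \<one>" using Q_diff[OF Q_one E] by simp
    have c': "(\<lambda>j. (1 - E j) * c j) \<in> Q 1 h" using Q_mult[OF E' less(4)] less(5) by simp
    \<comment> \<open>The cross terms with \<open>1 - E\<close> live at the two inner edges: i,
      where the untreated neighbour is k, and \<open>n - i - 1\<close>, where it is
      \<open>n - k\<close>.\<close>
    show ?thesis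
    proof (rule two_point[OF two g(1,2), of i "n - i - 1" 2])
      show "(\<lambda>j. E j * (1 - E (Suc j)) + E (Suc j) * (1 - E j)) \<in> Q 2 \<one>"
        using Q_adjacent[OF E E'] by simp
      show "(\<lambda>j. D j * (1 - E (Suc j)) + D (Suc j) * (1 - E j)) \<in> Q 2 g"
        using Q_adjacent[OF D E'] g by simp
      show "(\<lambda>j. E j * ((1 - E (Suc j)) * c (Suc j)) + E (Suc j) * ((1 - E j) * c j)) \<in> Q 2 h"
        using Q_adjacent[OF E c'] less(5) by simp
      fix j :: nat assume j: "1 \<le> j" "j + 2 \<le> n"
      have a: "j = n - i - 1 \<Longrightarrow> Suc j = n - i" "Suc i \<noteq> n - i" "i \<noteq> n - i - 1" using i by auto
      show "E j * (1 - E (Suc j)) + E (Suc j) * (1 - E j) = (if j = i then 1 else if j = n - i - 1 then 1 else 0)"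
        using i j unfolding E_eq by auto
      show "D j * (1 - E (Suc j)) + D (Suc j) * (1 - E j) = (if j = i then 1 else if j = n - i - 1 then - 1 else 0)"
        using i j unfolding E_eq D_def by auto
      show "E j * ((1 - E (Suc j)) * c (Suc j)) + E (Suc j) * ((1 - E j) * c j)
          = (if j = i then c k else if j = n - i - 1 then c (n - k) else 0)"
        using i j unfolding E_eq by auto
    qed (use i less(5) in auto)
  qed
qed

definition trivial_torus :: bool where
  "trivial_torus \<longleftrightarrow> (\<forall>h\<in>carrier G. \<forall>x\<in>A h. \<forall>i. h \<noteq> \<one> \<longrightarrow> 1 \<le> i \<longrightarrow> i < n \<longrightarrow> simple_root x i = 0)"

text \<open>Antisymmetry in degree g and symmetry in degree 1 refer to root values. For n = 2 the
  flip fixes the only simple root, so the torus cannot tell the two cases apart; there it is always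
  trivial.\<close>

definition flip_torus :: "'g \<Rightarrow> bool" where
  "flip_torus g \<longleftrightarrow> 3 \<le> n \<and> (2::'f) \<noteq> 0 \<and> g \<in> carrier G \<and> g \<noteq> \<one> \<and> g \<otimes> g = \<one> \<and>
     (\<forall>h\<in>carrier G. \<forall>x\<in>A h. \<forall>i. 1 \<le> i \<longrightarrow> i < n \<longrightarrow>
       (h \<noteq> \<one> \<and> h \<noteq> g \<longrightarrow> simple_root x i = 0) \<and> (h = g \<longrightarrow> simple_root x i + simple_root x (n - i) = 0) \<and>
       (h = \<one> \<longrightarrow> simple_root x i = simple_root x (n - i)))"

lemma torus_cases: "trivial_torus \<or> (\<exists>g. flip_torus g)"
proof (cases "3 \<le> n")
  case False
  have "simple_root x i = 0" if "h \<in> carrier G" "x \<in> A h" "h \<noteq> \<one>" "1 \<le> i" "i < n" for h x i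
  proof -
    \<comment> \<open>With a single simple root the sum in \<open>Q_trace\<close> is its
      value.\<close>
    have "n = 2" "i = 1" using that False by auto
    then show ?thesis using Q_trace[OF _ simple_root_Q[OF that(2,1)] that(1,3)] by (simp add: numeral_2_eq_2)
  qed
  then show ?thesis unfolding trivial_torus_def by blast
next
  case True
  from Q_end_cases[OF True] show ?thesis
  proof (elim disjE conjE bexE)
    assume *: "\<forall>h\<in>carrier G. \<forall>c\<in>Q 1 h. h \<noteq> \<one> \<longrightarrow> c 1 = 0 \<and> c (n - 1) = 0"
    have "simple_root x i = 0" if "h \<in> carrier G" "x \<in> A h" "h \<noteq> \<one>" "1 \<le> i" "i < n" for h x i
      using Q_trivial[OF _ that(4,5) simple_root_Q[OF that(2,1)] that(1,3)] * by blast
    then show ?thesis unfolding trivial_torus_def by blast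
  next
    fix g assume two: "(2::'f) \<noteq> 0" and g: "g \<in> carrier G" "g \<noteq> \<one>" "g \<otimes> g = \<one>"
      and *: "\<forall>h\<in>carrier G. \<forall>c\<in>Q 1 h. (h \<noteq> \<one> \<and> h \<noteq> g \<longrightarrow> c 1 = 0 \<and> c (n - 1) = 0) \<and>
        (h = g \<longrightarrow> c 1 + c (n - 1) = 0) \<and> (h = \<one> \<longrightarrow> c 1 = c (n - 1))"
    have sym: "(h \<noteq> \<one> \<and> h \<noteq> g \<longrightarrow> simple_root x i = 0 \<and> simple_root x (n - i) = 0) \<and> (h = g \<longrightarrow> simple_root x i + simple_root x (n - i) = 0) \<and>
       (h = \<one> \<longrightarrow> simple_root x i = simple_root x (n - i))" if "h \<in> carrier G" "x \<in> A h" "1 \<le> i" "2 * i \<le> n" for h x i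
      using Q_symmetric[OF two g _ that(3,4) simple_root_Q[OF that(2,1)] that(1)] * by blast
    have "(h \<noteq> \<one> \<and> h \<noteq> g \<longrightarrow> simple_root x i = 0) \<and> (h = g \<longrightarrow> simple_root x i + simple_root x (n - i) = 0) \<and>
       (h = \<one> \<longrightarrow> simple_root x i = simple_root x (n - i))" if "h \<in> carrier G" "x \<in> A h" "1 \<le> i" "i < n" for h x i
    proof (cases "2 * i \<le> n")
      case True then show ?thesis using sym[OF that(1,2,3)] by blast
    next
      case False
      then have "1 \<le> n - i" "2 * (n - i) \<le> n" "n - (n - i) = i" using that by auto
      then show ?thesis using sym[OF that(1,2), of "n - i"] by (auto simp: add.commute)
    qed
    then show ?thesis using True two g unfolding flip_torus_def by blast
  qed
qed

end

section \<open>Automorphisms of the Lie algebra\<close>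

lemma lie_auto_UT: "lie_auto n f \<Longrightarrow> x \<in> UT n \<Longrightarrow> f x \<in> UT n"
  unfolding lie_auto_def by (metis bij_betw_apply)

lemma lie_auto_add: "lie_auto n f \<Longrightarrow> x \<in> UT n \<Longrightarrow> y \<in> UT n \<Longrightarrow> f (x + y) = f x + f y"
  and lie_auto_scale: "lie_auto n f \<Longrightarrow> x \<in> UT n \<Longrightarrow> f (mscale c x) = mscale c (f x)"
  and lie_auto_bracket: "lie_auto n f \<Longrightarrow> x \<in> UT n \<Longrightarrow> y \<in> UT n \<Longrightarrow> f (bracket n x y) = bracket n (f x) (f y)"
  and lie_auto_bij: "lie_auto n f \<Longrightarrow> bij_betw f (UT n) (UT n)"
  unfolding lie_auto_def by blast+

lemma lie_autoI:
  assumes "bij_betw f (UT n) (UT n)"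
    and "\<And>x y. x \<in> UT n \<Longrightarrow> y \<in> UT n \<Longrightarrow> f (x + y) = f x + f y"
    and "\<And>c x. x \<in> UT n \<Longrightarrow> f (mscale c x) = mscale c (f x)"
    and "\<And>x y. x \<in> UT n \<Longrightarrow> y \<in> UT n \<Longrightarrow> f (bracket n x y) = bracket n (f x) (f y)"
  shows "lie_auto n f"
  using assms unfolding lie_auto_def by blast

lemma lie_auto_0: assumes "lie_auto n f" shows "f 0 = 0"
proof -
  have "f (mscale 0 0) = mscale 0 (f 0)"
    using lie_auto_scale[OF assms] matr.subspace_0[OF subspace_UT] by blast
  then show ?thesis by simp
qed

lemma lie_auto_sum:
  assumes "lie_auto n f" "finite S" "\<And>s. s \<in> S \<Longrightarrow> c s \<in> UT n"
  shows "f (\<Sum>s\<in>S. c s) = (\<Sum>s\<in>S. f (c s))"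
  using assms(2,3)
proof (induct S rule: finite_induct)
  case empty
  then show ?case by (simp only: sum.empty lie_auto_0[OF assms(1)])
next
  case (insert x F)
  have IH: "f (sum c F) = (\<Sum>s\<in>F. f (c s))"
    by (rule insert.hyps(3)) (rule insert.prems, blast)
  have "sum c F \<in> UT n" using insert by (intro matr.subspace_sum[OF subspace_UT]) blast
  then have "f (c x + sum c F) = f (c x) + f (sum c F)"
    using insert.prems by (intro lie_auto_add[OF assms(1)]) blast+
  then show ?case unfolding IH using insert.hyps by (simp only: sum.insert simp_thms)
qed

lemma lie_auto_id: "lie_auto n (\<lambda>x. x)"
  by (simp add: lie_auto_def bij_betw_def)

lemma lie_auto_comp:
  assumes "lie_auto n f" "lie_auto n g" shows "lie_auto n (\<lambda>x. g (f x))"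
proof -
  have "bij_betw (\<lambda>x. g (f x)) (UT n) (UT n)"
    using bij_betw_trans[OF assms[THEN lie_auto_bij]] by (simp add: o_def)
  then show ?thesis
    by (rule lie_autoI)
      (simp_all only: lie_auto_UT[OF assms(1)] lie_auto_add[OF assms(1)] lie_auto_add[OF assms(2)]
        lie_auto_scale[OF assms(1)] lie_auto_scale[OF assms(2)]
        lie_auto_bracket[OF assms(1)] lie_auto_bracket[OF assms(2)])
qed

lemma lie_auto_surj:
  assumes "lie_auto n f" "y \<in> UT n" obtains x where "x \<in> UT n" "y = f x"
proof -
  have "y \<in> f ` UT n" using bij_betw_imp_surj_on[OF lie_auto_bij[OF assms(1)]] assms(2) by simp
  then show ?thesis using that by (rule imageE)
qed

lemma lie_auto_centre:
  assumes f: "lie_auto n f" and z: "z \<in> centre n" shows "f z \<in> centre n"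
proof -
  have zU: "z \<in> UT n" using z centre_subset_UT by blast
  have "bracket n (f z) y = 0" if yU: "y \<in> UT n" for y
  proof -
    obtain x where x: "x \<in> UT n" "y = f x" by (rule lie_auto_surj[OF f yU])
    have "bracket n (f z) (f x) = f (bracket n z x)" using lie_auto_bracket[OF f zU x(1)] by simp
    also have "\<dots> = 0" using bracket_centre_left[OF z x(1)] lie_auto_0[OF f] by simp
    finally show ?thesis using x by simp
  qed
  then show ?thesis using lie_auto_UT[OF f zU] by (simp add: centre_def)
qed

subsection \<open>Constructing and transporting gradings\<close>

text \<open>Spanning and independence of finite families of homogeneous elements replace the unique
  finitely supported decomposition.\<close>

lemma is_gradingI:
  assumes sub: "\<And>g. g \<in> carrier G \<Longrightarrow> matr.subspace (B g)" "\<And>g. g \<in> carrier G \<Longrightarrow> B g \<subseteq> UT n"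
    and ex: "\<And>x. x \<in> UT n \<Longrightarrow> \<exists>S c. finite S \<and> S \<subseteq> carrier G \<and> (\<forall>g\<in>S. c g \<in> B g) \<and> x = (\<Sum>g\<in>S. c g)"
    and ind: "\<And>S c g. finite S \<Longrightarrow> S \<subseteq> carrier G \<Longrightarrow> (\<And>g. g \<in> S \<Longrightarrow> c g \<in> B g) \<Longrightarrow>
      (\<Sum>g\<in>S. c g) = 0 \<Longrightarrow> g \<in> S \<Longrightarrow> c g = 0"
    and br: "\<And>g h x y. g \<in> carrier G \<Longrightarrow> h \<in> carrier G \<Longrightarrow> x \<in> B g \<Longrightarrow> y \<in> B h \<Longrightarrow>
      bracket n x y \<in> B (g \<otimes>\<^bsub>G\<^esub> h)"
  shows "is_grading G n B"
proof -
  let ?D = "\<lambda>x c. (\<forall>g\<in>carrier G. c g \<in> B g) \<and> (\<forall>g. g \<notin> carrier G \<longrightarrow> c g = 0) \<and>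
        finite {g. c g \<noteq> 0} \<and> x = (\<Sum>g | c g \<noteq> 0. c g)"
  have "\<exists>!c. ?D x c" if x: "x \<in> UT n" for x
  proof (rule ex_ex1I)
    obtain S c where S: "finite S" "S \<subseteq> carrier G" "\<And>g. g \<in> S \<Longrightarrow> c g \<in> B g" "x = (\<Sum>g\<in>S. c g)"
      using ex[OF x] by blast
    let ?c = "\<lambda>g. if g \<in> S then c g else 0"
    have "(\<Sum>g\<in>S. c g) = (\<Sum>g | ?c g \<noteq> 0. ?c g)"
      using S(1) by (intro sum.mono_neutral_cong_right) auto
    moreover have "finite {g. ?c g \<noteq> 0}" using S(1) by (auto intro: rev_finite_subset)
    moreover have "?c g \<in> B g" if "g \<in> carrier G" for g
      using S(3) matr.subspace_0[OF sub(1)[OF that]] by simp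
    ultimately have "?D x ?c" using S(2,4) by auto
    then show "\<exists>c. ?D x c" by (rule exI[of _ ?c])
  next
    fix c d assume c: "?D x c" and d: "?D x d"
    let ?S = "{g. c g \<noteq> 0} \<union> {g. d g \<noteq> 0}"
    have fin: "finite ?S" "?S \<subseteq> carrier G" using c d by auto
    have "x = (\<Sum>g\<in>?S. c g)"
    proof -
      have "(\<Sum>g | c g \<noteq> 0. c g) = (\<Sum>g\<in>?S. c g)" using fin(1) by (intro sum.mono_neutral_left) auto
      then show ?thesis using c by simp
    qed
    moreover have "x = (\<Sum>g\<in>?S. d g)"
    proof -
      have "(\<Sum>g | d g \<noteq> 0. d g) = (\<Sum>g\<in>?S. d g)" using fin(1) by (intro sum.mono_neutral_left) auto
      then show ?thesis using d by simp
    qed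
    ultimately have 0: "(\<Sum>g\<in>?S. c g - d g) = 0" by (simp only: sum_subtractf right_minus_eq)
    have mem: "c g - d g \<in> B g" if "g \<in> ?S" for g
    proof -
      have "g \<in> carrier G" using that fin(2) by blast
      then show ?thesis using c d matr.subspace_diff[OF sub(1)] by blast
    qed
    have "c g - d g = 0" if "g \<in> ?S" for g
      using ind[of ?S "\<lambda>g. c g - d g", OF fin mem 0 that] .
    then have "c g = d g" for g
    proof (cases "g \<in> ?S")
      case True then show ?thesis using \<open>\<And>g. g \<in> ?S \<Longrightarrow> c g - d g = 0\<close> right_minus_eq by blast
    qed auto
    then show "c = d" by blast
  qed
  note ex1 = this
  show ?thesis unfolding is_grading_def
    by (intro conjI ballI; (rule sub | rule ex1 | rule br); assumption)
qed

context graded_UT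
begin

lemma grading_image:
  assumes f: "lie_auto n f" shows "graded_UT G n (\<lambda>g. f ` A g)"
proof (unfold_locales, rule n_pos, rule is_gradingI)
  fix g assume g: "g \<in> carrier G"
  show "matr.subspace (f ` A g)"
  proof (rule matr.subspaceI)
    show "0 \<in> f ` A g" using lie_auto_0[OF f] matr.subspace_0[OF A_subspace[OF g]] by force
    fix x y assume "x \<in> f ` A g" "y \<in> f ` A g"
    then obtain a b where "a \<in> A g" "b \<in> A g" "x = f a" "y = f b" by blast
    then have "x + y = f (a + b)" "a + b \<in> A g"
      using lie_auto_add[OF f] A_UT[OF g] matr.subspace_add[OF A_subspace[OF g]] by auto
    then show "x + y \<in> f ` A g" by blast
  next
    fix c x assume "x \<in> f ` A g"
    then obtain a where "a \<in> A g" "x = f a" by blast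
    then have "mscale c x = f (mscale c a)" "mscale c a \<in> A g"
      using lie_auto_scale[OF f] A_UT[OF g] matr.subspace_scale[OF A_subspace[OF g]] by auto
    then show "mscale c x \<in> f ` A g" by blast
  qed
  show "f ` A g \<subseteq> UT n" using lie_auto_UT[OF f] A_UT[OF g] by blast
next
  fix x :: "'f matr" assume "x \<in> UT n"
  then obtain y where y: "y \<in> UT n" "x = f y" by (rule lie_auto_surj[OF f])
  obtain S where S: "finite S" "S \<subseteq> carrier G" "y = (\<Sum>g\<in>S. hcomp g y)" "\<And>h. h \<notin> S \<Longrightarrow> hcomp h y = 0"
    using hcomp_expand[OF y(1)] by blast
  have "f y = f (\<Sum>g\<in>S. hcomp g y)" by (rule arg_cong[OF S(3)])
  also have "\<dots> = (\<Sum>g\<in>S. f (hcomp g y))" using S hcomp_UT[OF y(1)] by (intro lie_auto_sum[OF f]) auto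
  finally have "x = (\<Sum>g\<in>S. f (hcomp g y))" using y by simp
  moreover have "f (hcomp g y) \<in> f ` A g" if "g \<in> S" for g using hcomp_in y that S by blast
  ultimately show "\<exists>S c. finite S \<and> S \<subseteq> carrier G \<and> (\<forall>g\<in>S. c g \<in> f ` A g) \<and> x = (\<Sum>g\<in>S. c g)"
    using S by (intro exI[of _ S] exI[of _ "\<lambda>g. f (hcomp g y)"]) simp
next
  fix S c g assume S: "finite S" "S \<subseteq> carrier G" and c: "\<And>g. g \<in> S \<Longrightarrow> c g \<in> f ` A g"
    and sum: "(\<Sum>g\<in>S. c g) = 0" and g: "g \<in> S"
  define a where "a = (\<lambda>g. SOME b. b \<in> A g \<and> c g = f b)"
  have a: "a g \<in> A g" "c g = f (a g)" if "g \<in> S" for g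
  proof -
    from c[OF that] obtain b where "c g = f b" "b \<in> A g" by (rule imageE)
    then have "\<exists>b. b \<in> A g \<and> c g = f b" by (intro exI conjI)
    then have "a g \<in> A g \<and> c g = f (a g)" unfolding a_def by (rule someI_ex)
    then show "a g \<in> A g" "c g = f (a g)" by simp_all
  qed
  have aU: "a g \<in> UT n" if "g \<in> S" for g using a(1) that A_UT S by blast
  have sU: "(\<Sum>g\<in>S. a g) \<in> UT n" using aU by (rule matr.subspace_sum[OF subspace_UT])
  have "f (\<Sum>g\<in>S. a g) = (\<Sum>g\<in>S. c g)" using lie_auto_sum[OF f S(1) aU] a(2) by simp
  then have "f (\<Sum>g\<in>S. a g) = f 0" using sum lie_auto_0[OF f] by simp
  then have "(\<Sum>g\<in>S. a g) = 0"
    using lie_auto_bij[OF f] sU UT_closed(1) unfolding bij_betw_def by (meson inj_onD)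
  then have "a g = 0" using hcomp_sum_family[OF S a(1), of g] hcomp_0[of g] g by simp
  then show "c g = 0" using a(2)[OF g] lie_auto_0[OF f] by simp
next
  fix g h x y assume gh: "g \<in> carrier G" "h \<in> carrier G" "x \<in> f ` A g" "y \<in> f ` A h"
  then obtain a b where ab: "a \<in> A g" "b \<in> A h" "x = f a" "y = f b" by blast
  have "bracket n x y = f (bracket n a b)" using lie_auto_bracket[OF f] ab A_UT gh by simp
  then show "bracket n x y \<in> f ` A (g \<otimes> h)" using A_bracket gh ab by blast
qed

lemma Az_image:
  assumes f: "lie_auto n f" and x: "x \<in> Az h" and h: "h \<in> carrier G"
  shows "f x \<in> graded_UT.Az G n (\<lambda>g. f ` A g) h"
proof -
  interpret B: graded_UT G n "\<lambda>g. f ` A g" by (rule grading_image[OF f])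
  obtain a z where az: "a \<in> A h" "z \<in> centre n" "x = a + z" using Az_E[OF x h] by blast
  have "f x = f a + f z" using lie_auto_add[OF f] A_UT[OF h az(1)] az(2,3) centre_subset_UT by blast
  moreover have "f a \<in> B.Az h" using B.A_subset_Az[OF h] az(1) by blast
  moreover have "f z \<in> B.Az h" using B.centre_subset_Az lie_auto_centre[OF f az(2)] by blast
  ultimately show ?thesis using matr.subspace_add[OF B.subspace_Az] by simp
qed

subsection \<open>Weight spaces of a homogeneous element of trivial degree\<close>

text \<open>For upper triangular x this says that x commutes with its diagonal part.\<close>

definition block_diagonal :: "'f matr \<Rightarrow> bool" where
  "block_diagonal x \<longleftrightarrow> (\<forall>i j. x i i \<noteq> x j j \<longrightarrow> x i j = 0)"

definition weight_part :: "'f matr \<Rightarrow> 'f \<Rightarrow> 'f matr \<Rightarrow> 'f matr" where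
  "weight_part x r y = (\<lambda>i j. if x i i - x j j = r then y i j else 0)"

definition weight_space :: "'f matr \<Rightarrow> 'f \<Rightarrow> 'f matr set" where
  "weight_space x r = {y \<in> UT n. \<forall>i j. x i i - x j j \<noteq> r \<longrightarrow> y i j = 0}"

lemma weight_part_weight_space: "y \<in> UT n \<Longrightarrow> weight_part x r y \<in> weight_space x r"
  by (simp add: weight_part_def weight_space_def UT_iff)

text \<open>The operator ad x - r, whose powers detect the generalized weight space of weight
  r.\<close>

definition shift :: "'f matr \<Rightarrow> 'f \<Rightarrow> 'f matr \<Rightarrow> 'f matr" where
  "shift x r w = bracket n x w - mscale r w"

lemma shift_UT: "x \<in> UT n \<Longrightarrow> w \<in> UT n \<Longrightarrow> shift x r w \<in> UT n"
  by (simp add: shift_def UT_closed bracket_UT)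

lemma shift_entry:
  assumes x: "x \<in> UT n" and w: "w \<in> UT n"
  shows "shift x r w i j = (x i i - x j j - r) * w i j + (\<Sum>k\<in>{i<..j}. x i k * w k j)
    - (\<Sum>k\<in>{i..<j}. w i k * x k j)"
proof (cases "1 \<le> i \<and> i \<le> j \<and> j \<le> n")
  case True
  then show ?thesis using bracket_entry[OF x w, of i j] by (simp add: shift_def algebra_simps)
next
  case False
  have "shift x r w i j = 0" using False by (rule UT_zero[OF shift_UT[OF x w]])
  moreover have "w i j = 0" using UT_zero[OF w False] .
  moreover have "x i k * w k j = 0" "w i k * x k j = 0" if "i \<le> k" "k \<le> j" for k
    using False that UT_zero[OF x, of i k] UT_zero[OF w, of k j] UT_zero[OF w, of i k] UT_zero[OF x, of k j]
    by auto
  then have "(\<Sum>k\<in>{i<..j}. x i k * w k j) = 0" "(\<Sum>k\<in>{i..<j}. w i k * x k j) = 0"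
    by (auto intro!: sum.neutral simp del: mult_eq_0_iff)
  ultimately show ?thesis by simp
qed

text \<open>On this space the diagonal part of x acts by r, so the operator is the bracket with the
  strictly upper part of x. That part commutes with the diagonal part, so weights are kept, and it
  pushes entries away from the diagonal.\<close>

lemma shift_weight_space:
  assumes x: "x \<in> UT n" "block_diagonal x" and w: "w \<in> weight_space x r" "w \<in> Fil n k"
  shows "shift x r w \<in> weight_space x r" "shift x r w \<in> Fil n (Suc k)"
proof -
  have wU: "w \<in> UT n" using w(1) by (simp add: weight_space_def)
  have w0: "w i j = 0" if "x i i - x j j \<noteq> r" for i j using w(1) that unfolding weight_space_def by blast
  have x0: "x i j = 0" if "x i i \<noteq> x j j" for i j using x(2) that unfolding block_diagonal_def by blast
  have 1: "x i l * w l j = 0" "w i l * x l j = 0" if "x i i - x j j \<noteq> r" for i j l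
    using that x0[of i l] w0[of l j] x0[of l j] w0[of i l] by (metis mult_zero_left mult_zero_right)+
  have "shift x r w i j = 0" if "x i i - x j j \<noteq> r" for i j
    unfolding shift_entry[OF x(1) wU] 1[OF that] w0[OF that] by simp
  then show "shift x r w \<in> weight_space x r"
    using shift_UT[OF x(1) wU] by (simp add: weight_space_def)
  have "shift x r w i j = 0" if ij: "j < i + Suc k" for i j
  proof -
    have "(x i i - x j j - r) * w i j = 0" using w0[of i j] by (cases "x i i - x j j = r") auto
    moreover have "x i l * w l j = 0" if "i < l" for l using that ij w(2) by (simp add: Fil_def)
    moreover have "w i l * x l j = 0" if "l < j" for l using that ij w(2) by (simp add: Fil_def)
    ultimately have "(x i i - x j j - r) * w i j = 0" "(\<Sum>l\<in>{i<..j}. x i l * w l j) = 0"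
        "(\<Sum>l\<in>{i..<j}. w i l * x l j) = 0"
      by (auto intro!: sum.neutral simp del: mult_eq_0_iff)
    then show ?thesis unfolding shift_entry[OF x(1) wU] by simp
  qed
  then show "shift x r w \<in> Fil n (Suc k)" using shift_UT[OF x(1) wU] unfolding Fil_def by blast
qed

lemma shift_power_zero:
  assumes x: "x \<in> UT n" "block_diagonal x" and w: "w \<in> weight_space x r"
  shows "(shift x r ^^ n) w = 0"
proof -
  have "(shift x r ^^ k) w \<in> weight_space x r \<and> (shift x r ^^ k) w \<in> Fil n k" for k
  proof (induct k)
    case 0 then show ?case using w by (simp add: Fil_0 weight_space_def)
  next
    case (Suc k) then show ?case using shift_weight_space[OF x, of "(shift x r ^^ k) w" r k] by simp
  qed
  then have "(shift x r ^^ n) w \<in> Fil n n" by blast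
  then show ?thesis using Fil_top[of n n] by blast
qed

text \<open>At a position of weight other than r the entry of \<open>shift x r w\<close> is a
  nonzero multiple of the entry of w, plus terms with entries of w of the same weight closer to the
  diagonal; these vanish by induction.\<close>

lemma shift_inject:
  assumes x: "x \<in> UT n" "block_diagonal x" and w: "w \<in> UT n" "shift x r w \<in> weight_space x r"
  shows "w \<in> weight_space x r"
proof -
  have "w i j = 0" if "x i i - x j j \<noteq> r" for i j
    using that
  proof (induct "j - i" arbitrary: i j rule: less_induct)
    case less
    have x0: "x i j = 0" if "x i i \<noteq> x j j" for i j using x(2) that unfolding block_diagonal_def by blast
    have "x i l * w l j = 0" if "l \<in> {i<..j}" for l
    proof (cases "x i i = x l l")
      case True
      have 1: "j - l < j - i" using that by auto
      have 2: "x l l - x j j \<noteq> r" using less(2) unfolding True .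
      show ?thesis unfolding less(1)[OF 1 2] by simp
    next
      case False show ?thesis unfolding x0[OF False] by simp
    qed
    moreover have "w i l * x l j = 0" if "l \<in> {i..<j}" for l
    proof (cases "x l l = x j j")
      case True
      have 1: "l - i < j - i" using that by auto
      have 2: "x i i - x l l \<noteq> r" using less(2) unfolding True .
      show ?thesis unfolding less(1)[OF 1 2] by simp
    next
      case False show ?thesis unfolding x0[OF False] by simp
    qed
    ultimately have "(\<Sum>l\<in>{i<..j}. x i l * w l j) = 0" "(\<Sum>l\<in>{i..<j}. w i l * x l j) = 0"
      by (auto intro!: sum.neutral simp del: mult_eq_0_iff)
    then have "shift x r w i j = (x i i - x j j - r) * w i j"
      unfolding shift_entry[OF x(1) w(1)] by simp
    moreover have "shift x r w i j = 0" using w(2) less(2) by (simp only: weight_space_def mem_Collect_eq) blast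
    ultimately show ?case using less(2) by simp
  qed
  then show ?thesis using w(1) by (simp add: weight_space_def)
qed

lemma shift_power_inject:
  assumes x: "x \<in> UT n" "block_diagonal x" and w: "w \<in> UT n" "(shift x r ^^ k) w \<in> weight_space x r"
  shows "w \<in> weight_space x r"
  using w
proof (induct k arbitrary: w)
  case (Suc k)
  then have "shift x r w \<in> weight_space x r" using shift_UT[OF x(1)] by (simp only: funpow_Suc_right o_apply)
  then show ?case using shift_inject[OF x Suc(2)] by blast
qed simp

lemma hcomp_shift:
  assumes x: "x \<in> Az \<one>" and w: "w \<in> UT n" and k: "k \<in> carrier G"
  shows "hcomp k (shift x r w) = shift x r (hcomp k w)"
proof -
  obtain a z where az: "a \<in> A \<one>" "z \<in> centre n" "x = a + z" using Az_E[OF x] by blast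
  have eq: "bracket n x y = bracket n a y" if "y \<in> UT n" for y
    using az that by (simp add: bracket_add_left bracket_centre_left)
  have "hcomp k (bracket n a w) = bracket n a (hcomp k w)"
    using hcomp_bracket_left[OF w az(1) _ k] k by simp
  moreover have "bracket n a w \<in> UT n" using az A_UT w bracket_UT by blast
  ultimately show ?thesis
    using w k eq[OF w] eq[OF hcomp_UT[OF w]] by (simp add: shift_def hcomp_diff hcomp_scale UT_closed)
qed

text \<open>The weight space is the kernel of power n of \<open>shift x r\<close>, by
  \<open>shift_power_zero\<close> and \<open>shift_power_inject\<close>. That operator commutes with
  \<open>hcomp\<close> as x has trivial degree modulo the centre.\<close>

lemma hcomp_weight_space:
  assumes x: "x \<in> Az \<one>" "block_diagonal x" and w: "w \<in> weight_space x r" and k: "k \<in> carrier G"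
  shows "hcomp k w \<in> weight_space x r"
proof -
  have xU: "x \<in> UT n" using x Az_UT by blast
  have wU: "w \<in> UT n" using w by (simp add: weight_space_def)
  have "(shift x r ^^ m) w \<in> UT n \<and> hcomp k ((shift x r ^^ m) w) = (shift x r ^^ m) (hcomp k w)" for m
  proof (induct m)
    case (Suc m)
    then show ?case using hcomp_shift[OF x(1) _ k] shift_UT[OF xU] by simp
  qed (simp add: wU)
  then have "(shift x r ^^ n) (hcomp k w) = 0"
    using shift_power_zero[OF xU x(2) w] hcomp_0 by metis
  moreover have "0 \<in> weight_space x r" by (simp add: weight_space_def UT_closed)
  ultimately show ?thesis using shift_power_inject[OF xU x(2) hcomp_UT[OF wU]] by metis
qed

text \<open>A finite set that contains the weight of every position.\<close>

definition weights :: "'f matr \<Rightarrow> 'f set" where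
  "weights x = (\<lambda>(i, j). x i i - x j j) ` ({1..n} \<times> {1..n})"

lemma finite_weights: "finite (weights x)"
  by (simp add: weights_def)

lemma weight_part_sum:
  assumes y: "y \<in> UT n" shows "(\<Sum>r\<in>weights x. mscale (c r) (weight_part x r y)) i j = c (x i i - x j j) * y i j"
proof (cases "1 \<le> i \<and> i \<le> j \<and> j \<le> n")
  case True
  then have "x i i - x j j \<in> weights x" by (force simp: weights_def)
  then have "(\<Sum>r\<in>weights x. c r * weight_part x r y i j) = c (x i i - x j j) * weight_part x (x i i - x j j) y i j"
    by (intro sum_single finite_weights) (auto simp: weight_part_def)
  then show ?thesis by (simp add: sum_matr_apply weight_part_def)
next
  case False
  then have "weight_part x r y i j = 0" for r using UT_zero[OF y False] by (simp add: weight_part_def)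
  then show ?thesis using UT_zero[OF y False] by (simp add: sum_matr_apply)
qed

lemma weight_part_hcomp:
  assumes x: "x \<in> Az \<one>" "block_diagonal x" and y: "y \<in> UT n" and k: "k \<in> carrier G"
  shows "hcomp k (weight_part x r y) = weight_part x r (hcomp k y)"
proof -
  have wU: "weight_part x s y \<in> UT n" for s using weight_part_weight_space[OF y] by (simp add: weight_space_def)
  have ws: "hcomp k (weight_part x s y) \<in> weight_space x s" for s
    using hcomp_weight_space[OF x weight_part_weight_space[OF y] k] .
  have ws0: "hcomp k (weight_part x s y) i j = 0" if "x i i - x j j \<noteq> s" for s i j
    using ws[of s] that unfolding weight_space_def by blast
  have "y = (\<Sum>s\<in>weights x. mscale 1 (weight_part x s y))"
    using weight_part_sum[OF y, where x = x and c = "\<lambda>_. 1"] by (intro ext) simp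
  then have "hcomp k y = hcomp k (\<Sum>s\<in>weights x. weight_part x s y)" by simp
  also have "\<dots> = (\<Sum>s\<in>weights x. hcomp k (weight_part x s y))"
    using finite_weights wU by (rule hcomp_sum)
  finally have exp: "hcomp k y i j = (\<Sum>s\<in>weights x. hcomp k (weight_part x s y) i j)" for i j
    by (simp only: sum_matr_apply)
  have "hcomp k (weight_part x r y) i j = weight_part x r (hcomp k y) i j" for i j
  proof (cases "x i i - x j j = r \<and> r \<in> weights x")
    case True
    then have "hcomp k y i j = hcomp k (weight_part x r y) i j"
      unfolding exp by (intro sum_single finite_weights ws0) auto
    then show ?thesis using True by (simp add: weight_part_def)
  next
    case False
    show ?thesis
    proof (cases "1 \<le> i \<and> i \<le> j \<and> j \<le> n")
      case True
      then have "x i i - x j j \<in> weights x" by (force simp: weights_def)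
      then show ?thesis using False ws0 by (auto simp: weight_part_def)
    next
      case out: False
      then show ?thesis using UT_zero[OF hcomp_UT[OF wU] out] UT_zero[OF hcomp_UT[OF y] out]
        by (simp add: weight_part_def)
    qed
  qed
  then show ?thesis by blast
qed

lemma weight_part_A:
  assumes x: "x \<in> Az \<one>" "block_diagonal x" and y: "y \<in> A h" and h: "h \<in> carrier G"
  shows "weight_part x r y \<in> A h"
proof -
  have yU: "y \<in> UT n" using A_UT y h by blast
  have wU: "weight_part x r y \<in> UT n" using weight_part_weight_space[OF yU] by (simp add: weight_space_def)
  have "hcomp h (weight_part x r y) = weight_part x r y"
    using weight_part_hcomp[OF x yU h] hcomp_homogeneous[OF y h] by simp
  then show ?thesis using hcomp_in[OF wU h] by simp
qed

text \<open>The bracket of the diagonal part with y is the sum of r times the weight part of y for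
  r. Each weight part keeps the degree of y, so the diagonal part does not shift degrees and
  \<open>AzI\<close> applies.\<close>

lemma diag_part_Az:
  assumes x: "x \<in> Az \<one>" "block_diagonal x" shows "diag_part x \<in> Az \<one>"
proof (rule AzI)
  have xU: "x \<in> UT n" using x Az_UT by blast
  show "diag_part x \<in> UT n" using diag_part_Diag[OF xU] Diag_subset_UT by blast
  fix k y assume k: "k \<in> carrier G" and y: "y \<in> A k"
  have yU: "y \<in> UT n" using A_UT y k by blast
  have "bracket n (diag_part x) y = (\<Sum>r\<in>weights x. mscale r (weight_part x r y))"
    using bracket_Diag[OF diag_part_Diag[OF xU] yU] weight_part_sum[OF yU, where x = x and c = "\<lambda>r. r"] by (intro ext) simp
  also have "\<dots> \<in> A k"
    using weight_part_A[OF x y k] by (intro matr.subspace_sum[OF A_subspace[OF k]] matr.subspace_scale[OF A_subspace[OF k]])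
  finally show "bracket n (diag_part x) y \<in> A (\<one> \<otimes> k)" using k by simp
qed simp

lemma Diag_block_diagonal: "d \<in> Diag n \<Longrightarrow> block_diagonal d"
  unfolding Diag_iff block_diagonal_def by metis

text \<open>Projecting to weight 0 for one d after another makes x commute with all of them. The
  diagonal is unchanged, since diagonal positions have weight 0, and zeros already produced
  persist.\<close>

lemma project_commuting:
  assumes "\<forall>d\<in>set ds. d \<in> Diag n \<and> d \<in> Az \<one>" and x: "x \<in> Az \<one>"
  shows "\<exists>y\<in>Az \<one>. diag_part y = diag_part x \<and> (\<forall>d\<in>set ds. \<forall>i j. d i i \<noteq> d j j \<longrightarrow> y i j = 0)"
  using assms(1)
proof (induct ds)
  case (Cons d ds)
  then obtain y where y: "y \<in> Az \<one>" "diag_part y = diag_part x"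
    "\<forall>d\<in>set ds. \<forall>i j. d i i \<noteq> d j j \<longrightarrow> y i j = 0" by auto
  have d: "d \<in> Diag n" "d \<in> Az \<one>" using Cons by auto
  obtain a z where az: "a \<in> A \<one>" "z \<in> centre n" "y = a + z" using Az_E[OF y(1)] by blast
  \<comment> \<open>The projection preserves \<open>A \<one>\<close>; for the central summand one
    uses that it is diagonal and thus fixed.\<close>
  have "z \<in> Diag n" using centre_Diag[OF n_pos] az by blast
  then have "weight_part d 0 z i j = z i j" for i j by (cases "i = j") (simp_all add: weight_part_def Diag_iff)
  then have "weight_part d 0 z = z" by (intro ext)
  moreover have "weight_part d 0 y = weight_part d 0 a + weight_part d 0 z" using az by (simp add: weight_part_def fun_eq_iff)
  moreover have "weight_part d 0 a \<in> A \<one>" using weight_part_A[OF d(2) Diag_block_diagonal[OF d(1)] az(1)] by simp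
  ultimately have "weight_part d 0 y \<in> Az \<one>"
    using A_subset_Az[of \<one>] centre_subset_Az az(2) matr.subspace_add[OF subspace_Az] by (metis one_closed subsetD)
  moreover have "diag_part (weight_part d 0 y) = diag_part y"
    by (simp add: diag_part_def weight_part_def fun_eq_iff)
  then have "diag_part (weight_part d 0 y) = diag_part x" using y(2) by simp
  moreover have "\<forall>e\<in>set (d # ds). \<forall>i j. e i i \<noteq> e j j \<longrightarrow> weight_part d 0 y i j = 0"
    using y(3) by (auto simp: weight_part_def)
  ultimately show ?case by blast
qed (use x in auto)

end

subsection \<open>Transvections\<close>

text \<open>Conjugation by I + c E with E = \<open>munit i j\<close> and i < j: the quadratic term
  in E y E vanishes on \<open>UT n\<close>, because \<open>y j i\<close> is 0.\<close>

definition transv :: "nat \<Rightarrow> 'f::field \<Rightarrow> nat \<Rightarrow> nat \<Rightarrow> 'f matr \<Rightarrow> 'f matr" where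
  "transv n c i j y = y + mscale c (bracket n (munit i j) y)"

lemma transv_apply:
  assumes "1 \<le> i" "i < j" "j \<le> n"
  shows "transv n c i j y p q = y p q + c * ((if p = i then y j q else 0) - (if q = j then y p i else 0))"
  using assms by (simp add: transv_def bracket_munit)

lemma munit_sandwich:
  assumes "1 \<le> i" "i < j" "j \<le> n" "y \<in> UT n"
  shows "mmul n (munit i j) (mmul n y (munit i j)) = 0"
  using assms UT_eq_0[OF assms(4), of i j]
  by (intro ext) (simp add: mmul_munit_left mmul_munit_right)

lemma lie_auto_transv:
  assumes ij: "1 \<le> i" "i < j" "j \<le> n" shows "lie_auto n (transv n (c::'f::field) i j)"
proof -
  let ?E = "munit i j :: 'f matr"
  have E: "?E \<in> UT n" using ij by (intro munit_UT) auto
  have inv: "transv n (- c) i j (transv n c i j y) = y" if y: "y \<in> UT n" for c and y :: "'f matr"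
    using ij UT_eq_0[OF y, of i j] by (intro ext) (simp add: transv_apply algebra_simps)
  have mem: "transv n c i j y \<in> UT n" if "y \<in> UT n" for c and y :: "'f matr"
    unfolding transv_def using that E
    by (intro subspace_closed(1,3)[OF subspace_UT] bracket_UT)
  have bij: "bij_betw (transv n c i j) (UT n) (UT n)"
    by (rule bij_betwI[where g = "transv n (- c) i j"]) (use mem inv[of _ c] inv[of _ "- c"] in auto)
  have mult: "transv n c i j (mmul n a b) = mmul n (transv n c i j a) (transv n c i j b)"
    if ab: "a \<in> UT n" "b \<in> UT n" for a b
  proof -
    note s = munit_sandwich[OF ij ab(1)] munit_sandwich[OF ij ab(2)] munit_sandwich[OF ij mmul_UT[OF ab]]
    have EE: "mmul n ?E ?E = 0" using ij by (intro ext) (simp add: mmul_munit_left, simp add: munit_def)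
    have EEb: "mmul n ?E (mmul n ?E b) = 0" using EE mmul_assoc[of n ?E ?E b] by (simp add: mmul_0_left)
    have EaEb: "mmul n ?E (mmul n a (mmul n ?E b)) = 0"
    proof -
      have "mmul n (mmul n ?E (mmul n a ?E)) b = 0" unfolding s(1) by (rule mmul_0_left)
      then show ?thesis by (simp only: mmul_assoc)
    qed
    let ?P = "mmul n a (bracket n ?E b)" and ?Q = "mmul n (bracket n ?E a) b"
      and ?R = "mmul n (bracket n ?E a) (bracket n ?E b)"
    \<comment> \<open>Each of the four products contains E twice, with an upper triangular matrix or
      nothing in between. So \<open>transv\<close> respects even the associative product.\<close>
    have R: "?R = 0"
      using s EEb EaEb by (simp add: bracket_def mmul_diff_left mmul_diff_right mmul_assoc mmul_0_right)
    have PQ: "mscale c ?P + mscale c ?Q = mscale c (bracket n ?E (mmul n a b))"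
      by (simp add: bracket_def mmul_diff_left mmul_diff_right mmul_assoc matr.scale_right_diff_distrib)
    have "mmul n (transv n c i j a) (transv n c i j b)
        = mmul n a b + (mscale c ?P + mscale c ?Q) + mscale c (mscale c ?R)"
      by (simp only: transv_def mmul_add_left mmul_add_right mmul_scale_left mmul_scale_right
          matr.scale_right_distrib add.assoc add.left_commute add.commute)
    also have "\<dots> = transv n c i j (mmul n a b)"
      unfolding R PQ by (simp only: transv_def matr.scale_zero_right add_0_right)
    finally show ?thesis by (rule sym)
  qed
  have add: "transv n c i j (x + y) = transv n c i j x + transv n c i j y" for x y
    by (simp add: transv_def bracket_add_right matr.scale_right_distrib)
  have sc: "transv n c i j (mscale r x) = mscale r (transv n c i j x)" for r x
    by (simp add: transv_def bracket_scale_right matr.scale_right_distrib mult.commute)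
  have diff: "transv n c i j (x - y) = transv n c i j x - transv n c i j y" for x y
    by (simp add: transv_def bracket_diff_right matr.scale_right_diff_distrib)
  have "transv n c i j (bracket n x y) = bracket n (transv n c i j x) (transv n c i j y)"
    if "x \<in> UT n" "y \<in> UT n" for x y
    unfolding bracket_def diff mult[OF that] mult[OF that(2,1)] ..
  with bij add sc show ?thesis by (rule lie_autoI)
qed

definition fixes_diag :: "nat \<Rightarrow> ('f::field matr \<Rightarrow> 'f matr) \<Rightarrow> bool" where
  "fixes_diag n f \<longleftrightarrow> (\<forall>y\<in>UT n. \<forall>i. f y i i = y i i)"

text \<open>The entries of x are cleared in the order of increasing distance to the diagonal:
  a transvection which clears one entry changes only entries which come later.\<close>

lemma clear_blocks:
  fixes x :: "'f::field matr"
  assumes x: "x \<in> UT n" and D: "\<And>d. d \<in> D \<Longrightarrow> d \<in> Diag n"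
    and xD: "\<And>d i j. d \<in> D \<Longrightarrow> d i i \<noteq> d j j \<Longrightarrow> x i j = 0"
  shows "\<exists>f. lie_auto n f \<and> fixes_diag n f \<and> (\<forall>d\<in>D. f d = d) \<and>
    (\<forall>i j. x i i \<noteq> x j j \<longrightarrow> f x i j = 0)"
proof -
  \<comment> \<open>The code \<open>(j - i) * (n + 1) + i\<close> orders the positions by distance
    to the diagonal and then by row; it is injective because rows are less than n + 1.\<close>
  have "\<exists>f. lie_auto n f \<and> fixes_diag n f \<and> (\<forall>d\<in>D. f d = d) \<and>
    (\<forall>d\<in>D. \<forall>i j. d i i \<noteq> d j j \<longrightarrow> f x i j = 0) \<and>
    (\<forall>i j. 1 \<le> i \<and> i < j \<and> j \<le> n \<and> (j - i) * (n + 1) + i < r \<and> x i i \<noteq> x j j \<longrightarrow> f x i j = 0)" for r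
  proof (induct r)
    case 0
    show ?case by (intro exI[of _ "\<lambda>x. x"]) (use lie_auto_id xD in \<open>auto simp: fixes_diag_def\<close>)
  next
    case (Suc r)
    then obtain f where f: "lie_auto n f" "fixes_diag n f" "\<And>d. d \<in> D \<Longrightarrow> f d = d"
      "\<And>d i j. d \<in> D \<Longrightarrow> d i i \<noteq> d j j \<Longrightarrow> f x i j = 0"
      "\<And>i j. 1 \<le> i \<Longrightarrow> i < j \<Longrightarrow> j \<le> n \<Longrightarrow> (j - i) * (n + 1) + i < r \<Longrightarrow> x i i \<noteq> x j j \<Longrightarrow> f x i j = 0"
      by blast
    let ?y = "f x"
    have y: "?y \<in> UT n" using f(1) x lie_auto_UT by blast
    show ?case
    proof (cases "\<exists>i j. 1 \<le> i \<and> i < j \<and> j \<le> n \<and> (j - i) * (n + 1) + i = r \<and> x i i \<noteq> x j j \<and> ?y i j \<noteq> 0")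
      case False
      then show ?thesis using f by (intro exI[of _ f]) (auto simp: less_Suc_eq)
    next
      case True
      then obtain i j where ij: "1 \<le> i" "i < j" "j \<le> n" and r: "(j - i) * (n + 1) + i = r"
        and xij: "x i i \<noteq> x j j" and yij: "?y i j \<noteq> 0" by blast
      \<comment> \<open>The transvection adds \<open>c * (y j j - y i i)\<close> to the entry at (i,
        j), and the diagonal of y is that of x; this c makes the entry 0.\<close>
      define c where "c = ?y i j / (x i i - x j j)"
      let ?t = "transv n c i j"
      have yd: "?y p p = x p p" for p using f(2) x by (simp add: fixes_diag_def)
      \<comment> \<open>A d separating i and j would already have made this entry 0. So the
        transvection commutes with every d in D.\<close>
      have dij: "d i i = d j j" if "d \<in> D" for d using f(4)[OF that] yij by blast
      have "lie_auto n (\<lambda>x. ?t (f x))" using lie_auto_comp[OF f(1) lie_auto_transv[OF ij]] .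
      moreover have "fixes_diag n (\<lambda>x. ?t (f x))"
        unfolding fixes_diag_def
      proof (intro ballI allI)
        fix y :: "'f matr" and p assume yU: "y \<in> UT n"
        have "f y j i = 0" using UT_eq_0[OF lie_auto_UT[OF f(1) yU] ij(2)] .
        moreover have "f y p p = y p p" using f(2) yU by (simp add: fixes_diag_def)
        ultimately show "?t (f y) p p = y p p" using ij by (simp add: transv_apply)
      qed
      moreover have "?t (f d) = d" if "d \<in> D" for d
      proof -
        have "?t d = d"
        proof (intro ext)
          fix p q
          show "?t d p q = d p q"
            using D[OF that] dij[OF that] ij by (auto simp: transv_apply Diag_iff)
        qed
        then show ?thesis using f(3)[OF that] by simp
      qed
      moreover have "?t ?y p q = 0" if "d \<in> D" "d p p \<noteq> d q q" for d p q
        using f(4)[OF that] f(4)[OF that(1), of j q] f(4)[OF that(1), of p i] dij[OF that(1)] that(2) ij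
        by (auto simp: transv_apply)
      moreover have "?t ?y p q = 0"
        if pq: "1 \<le> p" "p < q" "q \<le> n" "(q - p) * (n + 1) + p < Suc r" "x p p \<noteq> x q q" for p q
      proof (cases "p = i \<and> q = j")
        case True
        then show ?thesis using xij yd ij by (simp add: transv_apply c_def field_simps)
      next
        case False
        \<comment> \<open>Only row i and column j change, by entries \<open>y j q\<close> and
          \<open>y p i\<close>. At a position no farther from the diagonal than (i, j), other than
          (i, j) itself, these lie below the diagonal.\<close>
        have code: "q - p \<le> j - i"
        proof (rule ccontr)
          assume "\<not> q - p \<le> j - i"
          then have "(j - i + 1) * (n + 1) \<le> (q - p) * (n + 1)" by (intro mult_le_mono1) simp
          then show False using pq(4) r ij by (simp add: algebra_simps)
        qed
        have "(q - p) * (n + 1) + p \<noteq> r"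
        proof
          assume "(q - p) * (n + 1) + p = r"
          then have eq: "(q - p) * (n + 1) + p = (j - i) * (n + 1) + i" using r by simp
          then have "((q - p) * (n + 1) + p) mod (n + 1) = ((j - i) * (n + 1) + i) mod (n + 1)" by simp
          then have "p = i" using pq ij by (simp only: mod_mult_self3) simp
          then have "(q - p) * (n + 1) = (j - i) * (n + 1)" using eq by linarith
          then have "q - p = j - i" by (simp only: mult_cancel2) simp
          then show False using False \<open>p = i\<close> pq ij by simp
        qed
        then have "?y p q = 0" using f(5) pq by simp
        moreover have "(if p = i then ?y j q else 0) = 0"
          using code False UT_eq_0[OF y, of q j] ij pq by auto
        moreover have "(if q = j then ?y p i else 0) = 0"
          using code False UT_eq_0[OF y, of i p] ij pq by auto
        ultimately show ?thesis using ij by (simp only: transv_apply) simp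
      qed
      ultimately show ?thesis by (intro exI[of _ "\<lambda>x. ?t (f x)"]) blast
    qed
  qed
  from this[of "(n + 1) * (n + 1)"] obtain f where f: "lie_auto n f" "fixes_diag n f" "\<forall>d\<in>D. f d = d"
    "\<And>i j. 1 \<le> i \<Longrightarrow> i < j \<Longrightarrow> j \<le> n \<Longrightarrow> (j - i) * (n + 1) + i < (n + 1) * (n + 1) \<Longrightarrow> x i i \<noteq> x j j \<Longrightarrow> f x i j = 0"
    by blast
  have "f x i j = 0" if "x i i \<noteq> x j j" for i j
  proof (cases "1 \<le> i \<and> i < j \<and> j \<le> n")
    case True
    have "(j - i) * (n + 1) + i < n * (n + 1) + (n + 1)"
      using True by (intro add_le_less_mono mult_le_mono1) auto
    then show ?thesis using f(4) True that by (simp add: algebra_simps)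
  next
    case False
    then have "i \<noteq> j \<Longrightarrow> \<not> (1 \<le> i \<and> i \<le> j \<and> j \<le> n)" by auto
    then show ?thesis using that UT_zero[OF lie_auto_UT[OF f(1) x]] by metis
  qed
  then show ?thesis using f(1-3) by blast
qed

text \<open>The lift of d is projected into the centralizer of the diagonal matrices already treated
  before it is block-diagonalized, so that the transvections used for d fix those matrices.\<close>

lemma clean_list:
  assumes A: "graded_UT G n A"
    and "\<forall>d\<in>set ds. d \<in> Diag n \<and> (\<exists>x\<in>graded_UT.Az G n A \<one>\<^bsub>G\<^esub>. diag_part x = d)"
  shows "\<exists>f. lie_auto n f \<and> fixes_diag n f \<and>
    (\<forall>d\<in>set ds. d \<in> graded_UT.Az G n (\<lambda>g. f ` A g) \<one>\<^bsub>G\<^esub>)"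
  using assms(2)
proof (induct ds)
  case Nil
  then show ?case using lie_auto_id by (intro exI[of _ "\<lambda>x. x"]) (auto simp: fixes_diag_def)
next
  case (Cons d ds)
  interpret A: graded_UT G n A by (rule A)
  obtain f where f: "lie_auto n f" "fixes_diag n f" "\<forall>d\<in>set ds. d \<in> graded_UT.Az G n (\<lambda>g. f ` A g) \<one>\<^bsub>G\<^esub>"
    using Cons by auto
  interpret B: graded_UT G n "\<lambda>g. f ` A g" by (rule A.grading_image[OF f(1)])
  obtain x where x: "x \<in> A.Az \<one>\<^bsub>G\<^esub>" "diag_part x = d" using Cons(2) by auto
  have fx: "f x \<in> B.Az \<one>\<^bsub>G\<^esub>" using A.Az_image[OF f(1) x(1)] by simp
  have dfx: "diag_part (f x) = d"
  proof -
    have "f x i i = x i i" for i using f(2) x(1) A.Az_UT unfolding fixes_diag_def by blast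
    then have "diag_part (f x) = diag_part x" by (simp add: diag_part_def fun_eq_iff)
    then show ?thesis using x(2) by simp
  qed
  obtain y where y: "y \<in> B.Az \<one>\<^bsub>G\<^esub>" "diag_part y = d" "\<forall>d\<in>set ds. \<forall>i j. d i i \<noteq> d j j \<longrightarrow> y i j = 0"
    using B.project_commuting[of ds "f x"] fx dfx f(3) Cons(2) by auto
  have yU: "y \<in> UT n" using y(1) B.Az_UT by blast
  obtain g where g: "lie_auto n g" "fixes_diag n g" "\<forall>d\<in>set ds. g d = d"
    "\<forall>i j. y i i \<noteq> y j j \<longrightarrow> g y i j = 0"
    using clear_blocks[OF yU, of "set ds"] y(3) Cons(2) by auto
  interpret C: graded_UT G n "\<lambda>h. g ` f ` A h" using B.grading_image[OF g(1)] .
  have gy: "g y i i = y i i" for i using g(2) yU by (simp add: fixes_diag_def)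
  have "g y \<in> C.Az \<one>\<^bsub>G\<^esub>" using B.Az_image[OF g(1) y(1)] by simp
  moreover have "C.block_diagonal (g y)" using g(4) gy by (simp add: C.block_diagonal_def)
  ultimately have "diag_part (g y) \<in> C.Az \<one>\<^bsub>G\<^esub>" by (rule C.diag_part_Az)
  moreover have "diag_part (g y) = d"
  proof -
    have "diag_part (g y) = diag_part y" using gy by (simp add: diag_part_def fun_eq_iff)
    then show ?thesis using y(2) by simp
  qed
  moreover have "e \<in> C.Az \<one>\<^bsub>G\<^esub>" if "e \<in> set ds" for e
    using B.Az_image[OF g(1), of e "\<one>\<^bsub>G\<^esub>"] f(3) g(3) that by auto
  moreover have "fixes_diag n (\<lambda>x. g (f x))"
    using f g lie_auto_UT[OF f(1)] by (auto simp: fixes_diag_def)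
  moreover have "(\<lambda>h. g ` f ` A h) = (\<lambda>h. (\<lambda>x. g (f x)) ` A h)" by (simp add: image_image)
  ultimately show ?case using lie_auto_comp[OF f(1) g(1)] by (intro exI[of _ "\<lambda>x. g (f x)"]) auto
qed

section \<open>Recognizing a grading from a spanning family\<close>

lemma span_Union_subspaces:
  assumes B: "\<And>h. h \<in> K \<Longrightarrow> matr.subspace (B h)" and x: "x \<in> matr.span (\<Union>h\<in>K. B h)"
  obtains S c where "finite S" "S \<subseteq> K" "\<And>h. h \<in> S \<Longrightarrow> c h \<in> B h" "x = (\<Sum>h\<in>S. c h)"
proof -
  let ?P = "\<lambda>x S c. finite S \<and> S \<subseteq> K \<and> (\<forall>h\<in>S. c h \<in> B h) \<and> x = (\<Sum>h\<in>S. c h)"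
  let ?M = "{x. \<exists>S c. ?P x S c}"
  have sub: "matr.subspace ?M"
  proof (rule matr.subspaceI)
    show "0 \<in> ?M" by (simp, rule exI[of _ "{}"]) simp
  next
    fix x y assume "x \<in> ?M" "y \<in> ?M"
    then obtain S c T d where c: "?P x S c" and d: "?P y T d" unfolding mem_Collect_eq by (elim exE)
    let ?c = "\<lambda>h. if h \<in> S then c h else 0" and ?d = "\<lambda>h. if h \<in> T then d h else 0"
    have "(\<Sum>h\<in>S. c h) = (\<Sum>h\<in>S \<union> T. ?c h)" using c d by (intro sum.mono_neutral_cong_left) auto
    moreover have "(\<Sum>h\<in>T. d h) = (\<Sum>h\<in>S \<union> T. ?d h)" using c d by (intro sum.mono_neutral_cong_left) auto
    ultimately have "x + y = (\<Sum>h\<in>S \<union> T. ?c h + ?d h)" using c d by (simp only: sum.distrib)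
    moreover have "?c h + ?d h \<in> B h" if "h \<in> S \<union> T" for h
    proof -
      have "matr.subspace (B h)" using that c d B by blast
      then show ?thesis using c d matr.subspace_0 by (intro matr.subspace_add) auto
    qed
    ultimately have "?P (x + y) (S \<union> T) (\<lambda>h. ?c h + ?d h)" using c d by (intro conjI ballI) auto
    then show "x + y \<in> ?M" unfolding mem_Collect_eq by (intro exI)
  next
    fix r x assume "x \<in> ?M"
    then obtain S c where c: "?P x S c" unfolding mem_Collect_eq by (elim exE)
    have "mscale r x = (\<Sum>h\<in>S. mscale r (c h))" using c matr.scale_sum_right by metis
    moreover have "mscale r (c h) \<in> B h" if "h \<in> S" for h
      using that c B by (intro matr.subspace_scale) blast+
    ultimately have "?P (mscale r x) S (\<lambda>h. mscale r (c h))" using c by (intro conjI ballI) auto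
    then show "mscale r x \<in> ?M" unfolding mem_Collect_eq by (intro exI)
  qed
  have gen: "(\<Union>h\<in>K. B h) \<subseteq> ?M"
  proof
    fix x assume "x \<in> (\<Union>h\<in>K. B h)"
    then obtain h where "h \<in> K" "x \<in> B h" by blast
    then have "?P x {h} (\<lambda>_. x)" by simp
    then show "x \<in> ?M" unfolding mem_Collect_eq by (intro exI)
  qed
  have "x \<in> ?M" by (rule subsetD[OF matr.span_minimal[OF gen sub] x])
  then obtain S c where "?P x S c" unfolding mem_Collect_eq by (elim exE)
  then show ?thesis by (intro that[of S c]) blast+
qed

lemma is_grading_cong:
  assumes "group G" "\<And>h. h \<in> carrier G \<Longrightarrow> A h = B h" "is_grading G n A" shows "is_grading G n B"
proof -
  interpret group G by fact
  have 1: "(\<forall>g\<in>carrier G. c g \<in> A g) \<longleftrightarrow> (\<forall>g\<in>carrier G. c g \<in> B g)" for c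
    using assms(2) by blast
  show ?thesis using assms(3) unfolding is_grading_def 1 using assms(2) by (simp cong: ball_cong)
qed

context graded_UT
begin

lemma Az_bracket_Az:
  assumes "x \<in> Az h" "y \<in> Az k" "h \<in> carrier G" "k \<in> carrier G" shows "bracket n x y \<in> A (h \<otimes> k)"
proof -
  obtain a z where az: "a \<in> A k" "z \<in> centre n" "y = a + z" using Az_E assms by blast
  have "x \<in> UT n" using assms Az_UT by blast
  then have "bracket n x y = bracket n x a" using az by (simp add: bracket_add_right bracket_centre_right)
  then show ?thesis using Az_bracket_left assms az by simp
qed

text \<open>Only the summand with index k can have a noncentral component of degree k.\<close>

lemma Az_sum_central:
  assumes S: "finite S" "S \<subseteq> carrier G" "\<And>s. s \<in> S \<Longrightarrow> c s \<in> Az s" and k: "k \<in> S"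
    and z: "hcomp k (\<Sum>s\<in>S. c s) \<in> centre n"
  shows "c k \<in> centre n"
proof -
  have U: "c s \<in> UT n" if "s \<in> S" for s using S(3)[OF that] Az_UT by blast
  have kG: "k \<in> carrier G" using S k by blast
  have "hcomp k (\<Sum>s\<in>S. c s) = (\<Sum>s\<in>S. hcomp k (c s))" using S(1) U by (rule hcomp_sum)
  also have "\<dots> = hcomp k (c k) + (\<Sum>s\<in>S - {k}. hcomp k (c s))" using S(1) k by (rule sum.remove)
  finally have eq: "hcomp k (c k) = hcomp k (\<Sum>s\<in>S. c s) - (\<Sum>s\<in>S - {k}. hcomp k (c s))"
    by (simp only: add_diff_cancel_right')
  have "(\<Sum>s\<in>S - {k}. hcomp k (c s)) \<in> centre n"
  proof (rule matr.subspace_sum[OF subspace_centre])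
    fix s assume "s \<in> S - {k}"
    then show "hcomp k (c s) \<in> centre n" using S(3)[of s] kG by (auto simp: Az_def)
  qed
  then have 1: "hcomp k (c k) \<in> centre n" unfolding eq using z by (intro matr.subspace_diff[OF subspace_centre])
  show ?thesis
  proof (rule hcomp_mem[OF U[OF k] subspace_centre])
    fix l assume "l \<in> carrier G"
    then show "hcomp l (c k) \<in> centre n" using 1 S(3)[OF k] by (cases "l = k") (auto simp: Az_def)
  qed
qed

text \<open>A spanning family contained in \<open>Az\<close> exhausts it up to the centre: in a
  decomposition of a along B the summands of the other degrees are central.\<close>

lemma spanning_in_Az:
  assumes B: "\<And>h. h \<in> carrier G \<Longrightarrow> matr.subspace (B h)" "\<And>h. h \<in> carrier G \<Longrightarrow> B h \<subseteq> Az h"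
    and UT: "UT n \<subseteq> matr.span (\<Union>h\<in>carrier G. B h)" and a: "a \<in> Az h" "h \<in> carrier G"
  shows "\<exists>b\<in>B h. a - b \<in> centre n"
proof -
  have aU: "a \<in> UT n" using a Az_UT by blast
  obtain S c where S: "finite S" "S \<subseteq> carrier G" "\<And>s. s \<in> S \<Longrightarrow> c s \<in> B s" "a = (\<Sum>s\<in>S. c s)"
    by (rule span_Union_subspaces[OF B(1) subsetD[OF UT aU]]) (assumption, rule that)
  have z: "c s \<in> centre n" if s: "s \<in> S" "s \<noteq> h" for s
  proof (rule Az_sum_central[OF S(1,2) _ s(1)])
    show "c s \<in> Az s" if "s \<in> S" for s using S(2,3) B(2) that by blast
    show "hcomp s (\<Sum>s\<in>S. c s) \<in> centre n" using a S(2,4) s by (auto simp: Az_def)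
  qed
  show ?thesis
  proof (cases "h \<in> S")
    case True
    have "a = c h + (\<Sum>s\<in>S - {h}. c s)" unfolding S(4) using S(1) True by (rule sum.remove)
    then have "a - c h = (\<Sum>s\<in>S - {h}. c s)" by (simp only: add_diff_cancel_left')
    also have "\<dots> \<in> centre n" using z by (intro matr.subspace_sum[OF subspace_centre]) blast
    finally show ?thesis using S(3) True by blast
  next
    case False
    have "a \<in> centre n" unfolding S(4) using z False by (intro matr.subspace_sum[OF subspace_centre]) blast
    then show ?thesis using matr.subspace_0[OF B(1)[OF a(2)]] by (intro bexI[of _ 0]) simp_all
  qed
qed

text \<open>In a relation between elements of the B h all summands are central, and only degree t
  admits nonzero scalars; this gives independence. For brackets no centre interferes, since they lie
  in \<open>Fil n 1\<close>.\<close>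

lemma grading_from_Az:
  assumes B: "\<And>h. h \<in> carrier G \<Longrightarrow> matr.subspace (B h)" "\<And>h. h \<in> carrier G \<Longrightarrow> B h \<subseteq> Az h"
    and UT: "UT n \<subseteq> matr.span (\<Union>h\<in>carrier G. B h)"
    and N: "Fil n 1 \<subseteq> matr.span (\<Union>h\<in>carrier G. B h \<inter> Fil n 1)"
    and t: "\<And>h. h \<in> carrier G \<Longrightarrow> h \<noteq> t \<Longrightarrow> B h \<inter> centre n \<subseteq> {0}"
  shows "is_grading G n B"
proof (rule is_gradingI)
  fix g assume g: "g \<in> carrier G"
  show "matr.subspace (B g)" using B(1)[OF g] .
  show "B g \<subseteq> UT n" using B(2)[OF g] Az_UT by blast
next
  fix x :: "'f matr" assume x: "x \<in> UT n"
  obtain S c where "finite S" "S \<subseteq> carrier G" "\<And>s. s \<in> S \<Longrightarrow> c s \<in> B s" "x = (\<Sum>s\<in>S. c s)"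
    by (rule span_Union_subspaces[OF B(1) subsetD[OF UT x]]) (assumption, rule that)
  then show "\<exists>S c. finite S \<and> S \<subseteq> carrier G \<and> (\<forall>g\<in>S. c g \<in> B g) \<and> x = (\<Sum>g\<in>S. c g)"
    by (intro exI conjI ballI)
next
  fix S c g assume S: "finite S" "S \<subseteq> carrier G" and c: "\<And>g. g \<in> S \<Longrightarrow> c g \<in> B g"
    and sum: "(\<Sum>g\<in>S. c g) = 0" and g: "g \<in> S"
  have z: "c s \<in> centre n" if s: "s \<in> S" for s
  proof (rule Az_sum_central[OF S _ s])
    show "c s \<in> Az s" if "s \<in> S" for s using S(2) c B(2) that by blast
    show "hcomp s (\<Sum>s\<in>S. c s) \<in> centre n"
      using sum hcomp_0 matr.subspace_0[OF subspace_centre] by simp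
  qed
  have 0: "c s = 0" if "s \<in> S" "s \<noteq> t" for s using z[OF that(1)] c[OF that(1)] t[of s] that S(2) by blast
  show "c g = 0"
  proof (cases "g = t")
    case True
    have "(\<Sum>s\<in>S. c s) = c g" using 0 True by (intro sum_single S(1) g) blast
    then show ?thesis using sum by simp
  qed (use 0 g in blast)
next
  fix g h x y assume gh: "g \<in> carrier G" "h \<in> carrier G" "x \<in> B g" "y \<in> B h"
  let ?w = "bracket n x y"
  have xy: "x \<in> Az g" "y \<in> Az h" using gh B(2) by blast+
  have w: "?w \<in> A (g \<otimes> h)" using Az_bracket_Az[OF xy gh(1,2)] .
  have wF: "?w \<in> Fil n 1" using xy Az_UT by (intro bracket_Fil1) blast+
  have sub: "matr.subspace (B s \<inter> Fil n 1)" if "s \<in> carrier G" for s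
    using matr.subspace_inter[OF B(1)[OF that] subspace_Fil] .
  obtain S c where S: "finite S" "S \<subseteq> carrier G" "\<And>s. s \<in> S \<Longrightarrow> c s \<in> B s \<inter> Fil n 1"
    "?w = (\<Sum>s\<in>S. c s)"
    by (rule span_Union_subspaces[OF sub subsetD[OF N wF]]) (assumption, rule that)
  \<comment> \<open>Inside \<open>Fil n 1\<close> the family B is homogeneous for A itself, so the
    bracket, of degree \<open>g \<otimes> h\<close>, is its own summand of that degree.\<close>
  have "c s \<in> A s" if "s \<in> S" for s using S(2,3) that B(2) Az_Fil1 by blast
  then have "hcomp (g \<otimes> h) ?w = (if g \<otimes> h \<in> S then c (g \<otimes> h) else 0)"
    unfolding S(4) using S(1,2) by (intro hcomp_sum_family)
  then have "?w = (if g \<otimes> h \<in> S then c (g \<otimes> h) else 0)"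
    using hcomp_homogeneous[OF w] gh by simp
  then show "?w \<in> B (g \<otimes> h)" using S(3) matr.subspace_0[OF B(1)[of "g \<otimes> h"]] gh by auto
qed

lemma grading_equal:
  assumes B: "\<And>h. h \<in> carrier G \<Longrightarrow> matr.subspace (B h)" "\<And>h. h \<in> carrier G \<Longrightarrow> B h \<subseteq> A h"
    and UT: "UT n \<subseteq> matr.span (\<Union>h\<in>carrier G. B h)" and h: "h \<in> carrier G"
  shows "A h = B h"
proof
  show "A h \<subseteq> B h"
  proof
    fix a assume a: "a \<in> A h"
    then have aU: "a \<in> UT n" using A_UT h by blast
    obtain S c where S: "finite S" "S \<subseteq> carrier G" "\<And>s. s \<in> S \<Longrightarrow> c s \<in> B s" "a = (\<Sum>s\<in>S. c s)"
      by (rule span_Union_subspaces[OF B(1) subsetD[OF UT aU]]) (assumption, rule that)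
    have "hcomp h a = (if h \<in> S then c h else 0)"
      unfolding S(4) using S(1-3) B(2) by (intro hcomp_sum_family) blast+
    then have "a = (if h \<in> S then c h else 0)" using hcomp_homogeneous[OF a h] by simp
    then show "a \<in> B h" using S(3) matr.subspace_0[OF B(1)[OF h]] by auto
  qed
qed (use B(2) h in blast)

lemma grading_equalI:
  assumes B: "\<And>h. h \<in> carrier G \<Longrightarrow> matr.subspace (B h)" "\<And>h. h \<in> carrier G \<Longrightarrow> B h \<subseteq> A h"
    and UT: "UT n \<subseteq> matr.span (\<Union>h\<in>carrier G. B h)"
  shows "is_grading G n B"
  using is_grading_cong[OF group_axioms grading_equal[OF B UT] grading] by blast

subsection \<open>Lifting the torus\<close>

text \<open>A linear functional of the root values which kills the components of degree other than r
  sees only the component of degree r. With two indices it can express symmetry or antisymmetry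
  under the flip.\<close>

lemma simple_root_functional:
  assumes x: "x \<in> UT n" and L: "\<And>h. h \<in> carrier G \<Longrightarrow> h \<noteq> r \<Longrightarrow> p * simple_root (hcomp h x) i + q * simple_root (hcomp h x) j = 0"
  shows "p * simple_root (hcomp r x) i + q * simple_root (hcomp r x) j = p * simple_root x i + q * simple_root x j"
proof -
  obtain S where S: "finite S" "S \<subseteq> carrier G" "x = (\<Sum>g\<in>S. hcomp g x)" "\<And>h. h \<notin> S \<Longrightarrow> hcomp h x = 0"
    using hcomp_expand[OF x] by blast
  have k0: "simple_root 0 k = 0" for k by (simp add: simple_root_def)
  have "x k k = (\<Sum>g\<in>S. hcomp g x k k)" for k by (subst S(3)) (rule sum_matr_apply)
  then have "simple_root x k = (\<Sum>g\<in>S. simple_root (hcomp g x) k)" for k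
    unfolding simple_root_def by (simp only: sum_subtractf)
  then have "p * simple_root x i + q * simple_root x j = (\<Sum>g\<in>S. p * simple_root (hcomp g x) i + q * simple_root (hcomp g x) j)"
    by (simp only: sum.distrib sum_distrib_left)
  also have "\<dots> = (\<Sum>g\<in>insert r S. p * simple_root (hcomp g x) i + q * simple_root (hcomp g x) j)"
    using S(1,4) k0 by (intro sum.mono_neutral_left) auto
  also have "\<dots> = p * simple_root (hcomp r x) i + q * simple_root (hcomp r x) j"
    using S(1,2) L by (intro sum_single) auto
  finally show ?thesis by simp
qed

lemma diag_from_simple_root:
  assumes "\<And>i. 1 \<le> i \<Longrightarrow> i < n \<Longrightarrow> simple_root x i = simple_root d i" and i: "1 \<le> i" "i \<le> n"
  shows "d i i = x i i + (d 1 1 - x 1 1)"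
  using i
proof (induct i)
  case (Suc i)
  show ?case
  proof (cases "i = 0")
    case False
    then have "d i i = x i i + (d 1 1 - x 1 1)" "x i i - x (Suc i) (Suc i) = d i i - d (Suc i) (Suc i)"
      using Suc assms(1)[of i] by (simp_all add: simple_root_def)
    then show ?thesis by algebra
  qed simp
qed simp

lemma scalar_centre: "mscale c (ident n) \<in> centre n"
  using n_pos by (auto simp only: centre_eq)

lemma simple_root_zero_centre:
  assumes d: "d \<in> Diag n" and "\<And>i. 1 \<le> i \<Longrightarrow> i < n \<Longrightarrow> simple_root d i = 0"
  shows "d \<in> centre n"
proof -
  define r where "r = d 1 1"
  have "d i i = r" if "1 \<le> i" "i \<le> n" for i
    using diag_from_simple_root[of 0 d i] assms(2) that by (simp add: simple_root_def r_def)
  then have "d i j = mscale r (ident n) i j" for i j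
    using d by (cases "i = j \<and> 1 \<le> i \<and> i \<le> n") (auto simp: ident_apply Diag_iff)
  then have "d = mscale r (ident n)" by (intro ext)
  then show ?thesis using scalar_centre by metis
qed

text \<open>The component of degree 1 has the right differences of diagonal entries; a scalar, which
  lies in every \<open>Az h\<close>, corrects the diagonal itself.\<close>

lemma lift_diag:
  assumes d: "d \<in> Diag n" and k: "\<And>i. 1 \<le> i \<Longrightarrow> i < n \<Longrightarrow> simple_root (hcomp \<one> d) i = simple_root d i"
  shows "\<exists>x\<in>Az \<one>. diag_part x = d"
proof -
  have dU: "d \<in> UT n" using d Diag_subset_UT by blast
  define c where "c = d 1 1 - hcomp \<one> d 1 1"
  let ?x = "hcomp \<one> d + mscale c (ident n)"
  have "?x \<in> Az \<one>"
    using hcomp_in[OF dU, of \<one>] A_subset_Az[of \<one>] centre_subset_Az scalar_centre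
    by (intro matr.subspace_add[OF subspace_Az]) auto
  moreover have "diag_part ?x i j = d i j" for i j
  proof (cases "i = j \<and> 1 \<le> i \<and> i \<le> n")
    case True
    then show ?thesis using diag_from_simple_root[of "hcomp \<one> d" d i] k by (simp add: ident_apply c_def)
  next
    case False
    then show ?thesis using d UT_zero[OF hcomp_UT[OF dU], of i i]
      by (cases "i = j") (auto simp: diag_part_def Diag_iff ident_apply)
  qed
  ultimately show ?thesis by (intro bexI[of _ ?x] ext)
qed

lemma simple_root_hcomp_trivial:
  assumes "trivial_torus" "x \<in> UT n" "h \<in> carrier G" "h \<noteq> \<one>" "1 \<le> i" "i < n"
  shows "simple_root (hcomp h x) i = 0"
  using assms hcomp_in unfolding trivial_torus_def by blast

lemma lift_trivial:
  assumes T: trivial_torus and d: "d \<in> Diag n" shows "\<exists>x\<in>Az \<one>. diag_part x = d"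
proof (rule lift_diag[OF d])
  fix i assume "1 \<le> i" "i < n"
  moreover have "d \<in> UT n" using d Diag_subset_UT by blast
  ultimately show "simple_root (hcomp \<one> d) i = simple_root d i"
    using simple_root_functional[of d \<one> 1 i 0 i] simple_root_hcomp_trivial[OF T] by simp
qed

lemma flip_torusD:
  assumes "flip_torus g"
  shows "3 \<le> n" "(2::'f) \<noteq> 0" "g \<in> carrier G" "g \<noteq> \<one>" "g \<otimes> g = \<one>"
    and "\<And>h x i. h \<in> carrier G \<Longrightarrow> x \<in> A h \<Longrightarrow> 1 \<le> i \<Longrightarrow> i < n \<Longrightarrow> h \<noteq> \<one> \<Longrightarrow> h \<noteq> g \<Longrightarrow> simple_root x i = 0"
    and "\<And>x i. x \<in> A g \<Longrightarrow> 1 \<le> i \<Longrightarrow> i < n \<Longrightarrow> simple_root x i + simple_root x (n - i) = 0"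
    and "\<And>x i. x \<in> A \<one> \<Longrightarrow> 1 \<le> i \<Longrightarrow> i < n \<Longrightarrow> simple_root x i = simple_root x (n - i)"
  using assms unfolding flip_torus_def by blast+

lemma twice_zero: "(2::'f) \<noteq> 0 \<Longrightarrow> a + b = 0 \<Longrightarrow> a = b \<Longrightarrow> (a::'f) = 0"
  by (metis mult_2 mult_eq_0_iff)

text \<open>The functional measuring the failure of symmetry kills all components except that of
  degree g. If it vanishes on d, the component of degree g is symmetric as well as antisymmetric,
  hence 0 as 2 is invertible. The second part exchanges the roles of 1 and g.\<close>

lemma simple_root_hcomp_flip:
  assumes T: "flip_torus g" and d: "d \<in> UT n" and i: "1 \<le> i" "i < n"
  shows "simple_root d i = simple_root d (n - i) \<Longrightarrow> simple_root (hcomp g d) i = 0"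
    and "simple_root d i + simple_root d (n - i) = 0 \<Longrightarrow> simple_root (hcomp \<one> d) i = 0"
proof -
  note F = flip_torusD[OF T]
  have ni: "1 \<le> n - i" "n - i < n" using i by auto
  have in_A: "h \<in> carrier G \<Longrightarrow> hcomp h d \<in> A h" for h using hcomp_in d by blast
  show "simple_root (hcomp g d) i = 0" if "simple_root d i = simple_root d (n - i)"
  proof -
    have "1 * simple_root (hcomp g d) i + (-1) * simple_root (hcomp g d) (n - i) = 1 * simple_root d i + (-1) * simple_root d (n - i)"
    proof (rule simple_root_functional[OF d])
      fix h assume h: "h \<in> carrier G" "h \<noteq> g"
      then show "1 * simple_root (hcomp h d) i + (-1) * simple_root (hcomp h d) (n - i) = 0"
        using F(6)[OF h(1) in_A[OF h(1)]] F(8)[OF in_A[OF one_closed] i] i ni by (cases "h = \<one>") auto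
    qed
    then have "simple_root (hcomp g d) i = simple_root (hcomp g d) (n - i)" using that by simp
    then show ?thesis using twice_zero[OF F(2)] F(7)[OF in_A[OF F(3)] i] by blast
  qed
  show "simple_root (hcomp \<one> d) i = 0" if "simple_root d i + simple_root d (n - i) = 0"
  proof -
    have "1 * simple_root (hcomp \<one> d) i + 1 * simple_root (hcomp \<one> d) (n - i) = 1 * simple_root d i + 1 * simple_root d (n - i)"
    proof (rule simple_root_functional[OF d])
      fix h assume h: "h \<in> carrier G" "h \<noteq> \<one>"
      then show "1 * simple_root (hcomp h d) i + 1 * simple_root (hcomp h d) (n - i) = 0"
        using F(6)[OF h(1) in_A[OF h(1)]] F(7)[OF in_A[OF F(3)] i] i ni by (cases "h = g") auto
    qed
    then have "simple_root (hcomp \<one> d) i + simple_root (hcomp \<one> d) (n - i) = 0" using that by simp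
    then show ?thesis using twice_zero[OF F(2)] F(8)[OF in_A[OF one_closed] i] by blast
  qed
qed

lemma lift_flip:
  assumes T: "flip_torus g" and d: "d \<in> Diag n" and s: "\<And>i. 1 \<le> i \<Longrightarrow> i < n \<Longrightarrow> simple_root d i = simple_root d (n - i)"
  shows "\<exists>x\<in>Az \<one>. diag_part x = d"
proof (rule lift_diag[OF d])
  fix i assume i: "1 \<le> i" "i < n"
  note F = flip_torusD[OF T]
  have dU: "d \<in> UT n" using d Diag_subset_UT by blast
  have "1 * simple_root (hcomp \<one> d) i + 0 * simple_root (hcomp \<one> d) i = 1 * simple_root d i + 0 * simple_root d i"
  proof (rule simple_root_functional[OF dU])
    fix h assume h: "h \<in> carrier G" "h \<noteq> \<one>"
    then show "1 * simple_root (hcomp h d) i + 0 * simple_root (hcomp h d) i = 0"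
      using F(6)[OF h(1) hcomp_in[OF dU h(1)] i h(2)] simple_root_hcomp_flip(1)[OF T dU i s[OF i]]
      by (cases "h = g") auto
  qed
  then show "simple_root (hcomp \<one> d) i = simple_root d i" by simp
qed

lemma flip_torus_image:
  assumes "flip_torus g" "lie_auto n f" "fixes_diag n f"
  shows "graded_UT.flip_torus G n (\<lambda>g. f ` A g) g"
proof -
  interpret B: graded_UT G n "\<lambda>g. f ` A g" by (rule grading_image[OF assms(2)])
  have k: "simple_root (f x) i = simple_root x i" if "x \<in> A h" "h \<in> carrier G" for x h i
    using assms(3) A_UT[OF that(2,1)] by (simp add: simple_root_def fixes_diag_def)
  note F = flip_torusD[OF assms(1)]
  have "(h \<noteq> \<one> \<and> h \<noteq> g \<longrightarrow> simple_root y i = 0) \<and> (h = g \<longrightarrow> simple_root y i + simple_root y (n - i) = 0) \<and>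
       (h = \<one> \<longrightarrow> simple_root y i = simple_root y (n - i))"
    if h: "h \<in> carrier G" and y: "y \<in> f ` A h" and i: "1 \<le> i" "i < n" for h y i
  proof -
    from y obtain x where x: "y = f x" "x \<in> A h" by (rule imageE)
    show ?thesis unfolding x(1) k[OF x(2) h] using F(6)[OF h x(2) i] F(7,8)[OF _ i, of x] x(2) by blast
  qed
  then show ?thesis using F(1-5) unfolding B.flip_torus_def by blast
qed

lemma hcomp_bracket_Az:
  assumes x: "x \<in> Az k" and y: "y \<in> UT n" and kh: "k \<in> carrier G" "h \<in> carrier G"
  shows "hcomp (k \<otimes> h) (bracket n x y) = bracket n x (hcomp h y)"
proof -
  obtain a z where az: "a \<in> A k" "z \<in> centre n" "x = a + z" using Az_E[OF x kh(1)] by blast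
  have "bracket n x w = bracket n a w" if "w \<in> UT n" for w
    using az that by (simp add: bracket_add_left bracket_centre_left)
  then show ?thesis using hcomp_bracket_left[OF y az(1) kh] y hcomp_UT[OF y] by simp
qed

lemma deg_commute_Az:
  assumes x: "x \<in> Az h" and y: "y \<in> A k" and hk: "h \<in> carrier G" "k \<in> carrier G" and ne: "bracket n x y \<noteq> 0"
  shows "h \<otimes> k = k \<otimes> h"
proof -
  obtain a z where az: "a \<in> A h" "z \<in> centre n" "x = a + z" using Az_E[OF x hk(1)] by blast
  have "bracket n x y = bracket n a y"
    using az A_UT[OF hk(2) y] by (simp add: bracket_add_left bracket_centre_left)
  then show ?thesis using deg_commute[OF az(1) y hk] ne by simp
qed

end

text \<open>Testing with the diagonal matrix units compares the root of a nonzero entry (p, q) with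
  that of (i, j). In characteristic 2 the roots of (i, j) and (j, i) coincide, and upper
  triangularity of w excludes the second position.\<close>

lemma weight_vector:
  assumes w: "w \<in> UT n" and ij: "1 \<le> i" "i < j" "j \<le> n"
    and d: "\<And>d. d \<in> Diag n \<Longrightarrow> bracket n d w = mscale (d i i - d j j) w"
  shows "w = mscale (w i j) (munit i j)"
proof (intro ext)
  fix p q
  show "w p q = mscale (w i j) (munit i j) p q"
  proof (cases "w p q = 0")
    case True then show ?thesis by (auto simp: munit_def)
  next
    case False
    have pq: "p \<le> q" using UT_D[OF w False] by blast
    have e: "((if p = k then 1 else 0) - (if q = k then 1 else 0) :: 'a)
      = (if i = k then 1 else 0) - (if j = k then 1 else 0)" if k: "1 \<le> k" "k \<le> n" for k
    proof -
      have D: "munit k k \<in> Diag n" using k by (auto simp: Diag_iff munit_def)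
      have "bracket n (munit k k) w p q = mscale (munit k k i i - munit k k j j) w p q"
        using d[OF D] by simp
      then have "(munit k k p p - munit k k q q) * w p q = (munit k k i i - munit k k j j) * w p q"
        by (simp add: bracket_Diag[OF D w])
      then have "munit k k p p - munit k k q q = (munit k k i i - munit k k j j :: 'a)" using False by simp
      then show ?thesis by (simp add: munit_def eq_commute cong: if_cong)
    qed
    have "p \<noteq> q" using e[of i] ij by auto
    then have pq': "p < q" using pq by simp
    have "q = j"
    proof (rule ccontr)
      assume "q \<noteq> j"
      then have "p = j" using e[of j] ij by (auto split: if_splits)
      then show False using e[of i] ij pq' by (auto split: if_splits)
    qed
    then have "p = i" using e[of i] ij by (auto split: if_splits)
    then show ?thesis using \<open>q = j\<close> by (simp add: munit_def)
  qed
qed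

lemma Diag_subset_subspace:
  assumes M: "matr.subspace M" and e: "\<And>i. 1 \<le> i \<Longrightarrow> i \<le> n \<Longrightarrow> munit i i \<in> M" shows "Diag n \<subseteq> M"
proof
  fix d :: "'a matr" assume d: "d \<in> Diag n"
  have "d p q = (\<Sum>i=1..n. mscale (d i i) (munit i i)) p q" for p q
  proof (cases "p = q \<and> 1 \<le> p \<and> p \<le> n")
    case True
    have "(\<Sum>i=1..n. d i i * munit i i p q) = d p p * munit p p p q"
      using True by (intro sum_single) (auto simp: munit_def)
    then show ?thesis using True by (simp add: sum_matr_apply munit_def)
  next
    case False
    then have "d p q = 0" using d by (auto simp: Diag_iff)
    moreover have "(\<Sum>i=1..n. d i i * munit i i p q) = 0"
      using False by (intro sum.neutral) (auto simp: munit_def)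
    ultimately show ?thesis by (simp add: sum_matr_apply)
  qed
  then have "d = (\<Sum>i=1..n. mscale (d i i) (munit i i))" by (intro ext)
  also have "\<dots> \<in> M" using e by (intro matr.subspace_sum[OF M] matr.subspace_scale[OF M]) auto
  finally show "d \<in> M" .
qed

lemma munit_Diag: "1 \<le> i \<Longrightarrow> i \<le> n \<Longrightarrow> munit i i \<in> Diag n"
  by (auto simp: Diag_iff munit_def)

section \<open>Root vectors when all diagonal matrices have trivial degree\<close>

context graded_UT
begin

lemma trivial_form:
  assumes T: trivial_torus
  shows "\<exists>f. lie_auto n f \<and> Diag n \<subseteq> graded_UT.Az G n (\<lambda>g. f ` A g) \<one>"
proof -
  let ?ds = "map (\<lambda>i. munit i i) [1..<Suc n] :: 'f matr list"
  have "\<forall>d\<in>set ?ds. d \<in> Diag n \<and> (\<exists>x\<in>Az \<one>. diag_part x = d)"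
    using lift_trivial[OF T] by (auto simp: munit_Diag simp del: upt_Suc)
  then obtain f where f: "lie_auto n f" "\<forall>d\<in>set ?ds. d \<in> graded_UT.Az G n (\<lambda>g. f ` A g) \<one>"
    using clean_list[OF graded_UT_axioms, of ?ds] by auto
  interpret B: graded_UT G n "\<lambda>g. f ` A g" by (rule grading_image[OF f(1)])
  have "Diag n \<subseteq> B.Az \<one>" using f(2) by (intro Diag_subset_subspace[OF B.subspace_Az]) auto
  then show ?thesis using f(1) by blast
qed

text \<open>Diagonal matrices do not shift degrees, so each component of the matrix unit is a weight
  vector for the same root and thus a multiple of it.\<close>

lemma munit_homogeneous:
  assumes D: "Diag n \<subseteq> Az \<one>" and ij: "1 \<le> i" "i < j" "j \<le> n"
  shows "\<exists>h\<in>carrier G. munit i j \<in> A h"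
proof -
  let ?e = "munit i j :: 'f matr"
  have e: "?e \<in> UT n" using ij by (intro munit_UT) auto
  have br: "bracket n d ?e = mscale (d i i - d j j) ?e" if "d \<in> Diag n" for d
    by (intro ext) (simp only: bracket_Diag[OF that e] mscale_apply, simp add: munit_def)
  have c: "hcomp h ?e = mscale (hcomp h ?e i j) ?e" if h: "h \<in> carrier G" for h
  proof (rule weight_vector[OF hcomp_UT[OF e] ij])
    fix d :: "'f matr" assume d: "d \<in> Diag n"
    have "bracket n d (hcomp h ?e) = hcomp h (bracket n d ?e)"
      using hcomp_bracket_Az[of d \<one> ?e h] d D e h by auto
    then show "bracket n d (hcomp h ?e) = mscale (d i i - d j j) (hcomp h ?e)"
      using hcomp_scale[OF e] by (simp add: br[OF d])
  qed
  obtain h where h: "h \<in> carrier G" "hcomp h ?e \<noteq> 0"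
    using hcomp_eqI[OF e UT_closed(1)] munit_nonzero hcomp_0 by metis
  let ?r = "hcomp h ?e i j"
  have "?r \<noteq> 0" using c[OF h(1)] h(2) by auto
  then have "?e = mscale (inverse ?r) (mscale ?r ?e)" by (simp add: matr.scale_scale)
  also have "\<dots> = mscale (inverse ?r) (hcomp h ?e)" using c[OF h(1)] by simp
  also have "\<dots> \<in> A h" using hcomp_in[OF e h(1)] matr.subspace_scale[OF A_subspace[OF h(1)]] by blast
  finally show ?thesis using h(1) by blast
qed

end

subsection \<open>Products of commuting degrees\<close>

lemma seg_prod_refl: "seg_prod G \<eta> i i = \<one>\<^bsub>G\<^esub>"
  by (simp add: seg_prod_def)

lemma seg_prod_Cons: "i < j \<Longrightarrow> seg_prod G \<eta> i j = \<eta> i \<otimes>\<^bsub>G\<^esub> seg_prod G \<eta> (Suc i) j"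
  by (simp add: seg_prod_def upt_conv_Cons)

context group
begin

lemma seg_prod_closed:
  assumes "\<And>k. i \<le> k \<Longrightarrow> k < j \<Longrightarrow> \<eta> k \<in> carrier G" shows "seg_prod G \<eta> i j \<in> carrier G"
  using assms
proof (induct "j - i" arbitrary: i)
  case (Suc d)
  then have "i < j" "d = j - Suc i" by auto
  then show ?case using Suc(1)[of "Suc i"] Suc(3) by (simp add: seg_prod_Cons)
qed (simp add: seg_prod_def)

lemma commute_mult:
  assumes "x \<otimes> a = a \<otimes> x" "x \<otimes> b = b \<otimes> x" "x \<in> carrier G" "a \<in> carrier G" "b \<in> carrier G"
  shows "x \<otimes> (a \<otimes> b) = (a \<otimes> b) \<otimes> x"
  using assms by (metis m_assoc)

lemma commute_cancel_left:
  assumes "x \<otimes> (a \<otimes> b) = (a \<otimes> b) \<otimes> x" "x \<otimes> b = b \<otimes> x" "x \<in> carrier G" "a \<in> carrier G" "b \<in> carrier G"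
  shows "x \<otimes> a = a \<otimes> x"
proof -
  have "(x \<otimes> a) \<otimes> b = (a \<otimes> x) \<otimes> b" using assms by (simp add: m_assoc)
  then show ?thesis using assms by simp
qed

lemma seg_prod_commute:
  assumes "\<And>k. i \<le> k \<Longrightarrow> k < j \<Longrightarrow> \<eta> k \<in> carrier G \<and> x \<otimes> \<eta> k = \<eta> k \<otimes> x" and x: "x \<in> carrier G"
  shows "x \<otimes> seg_prod G \<eta> i j = seg_prod G \<eta> i j \<otimes> x"
  using assms(1)
proof (induct "j - i" arbitrary: i)
  case 0
  then show ?case using x by (simp add: seg_prod_def)
next
  case (Suc d)
  then have ij: "i < j" "d = j - Suc i" by auto
  have "x \<otimes> seg_prod G \<eta> (Suc i) j = seg_prod G \<eta> (Suc i) j \<otimes> x"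
    using Suc(1)[OF ij(2)] Suc(3) by simp
  moreover have "seg_prod G \<eta> (Suc i) j \<in> carrier G" using Suc(3) by (intro seg_prod_closed) auto
  ultimately show ?case unfolding seg_prod_Cons[OF ij(1)] using Suc(3)[of i] ij x
    by (intro commute_mult) auto
qed

text \<open>Nonzero brackets of neighbouring root vectors only show that a segment product commutes
  with the next factor. Cancelling the rest of the segment leaves pairwise commutation.\<close>

lemma elem_paramsI:
  assumes cl: "\<And>i. 1 \<le> i \<Longrightarrow> i < n \<Longrightarrow> \<eta> i \<in> carrier G"
    and cm: "\<And>i j. 1 \<le> i \<Longrightarrow> i < j \<Longrightarrow> j < n \<Longrightarrow> seg_prod G \<eta> i j \<otimes> \<eta> j = \<eta> j \<otimes> seg_prod G \<eta> i j"
  shows "elem_params G n \<eta>"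
proof -
  have lt: "\<eta> j \<otimes> \<eta> i = \<eta> i \<otimes> \<eta> j" if ij: "1 \<le> i" "i < j" "j < n" for i j
  proof (rule commute_cancel_left[of _ _ "seg_prod G \<eta> (Suc i) j"])
    show "\<eta> j \<otimes> (\<eta> i \<otimes> seg_prod G \<eta> (Suc i) j) = \<eta> i \<otimes> seg_prod G \<eta> (Suc i) j \<otimes> \<eta> j"
      using cm[OF ij] seg_prod_Cons[of i j G \<eta>] ij by simp
    show "\<eta> j \<otimes> seg_prod G \<eta> (Suc i) j = seg_prod G \<eta> (Suc i) j \<otimes> \<eta> j"
      using cm[of "Suc i" j] ij cl[of j] by (cases "Suc i = j") (auto simp: seg_prod_refl)
  qed (use ij cl in \<open>auto intro!: seg_prod_closed\<close>)
  have "\<eta> i \<otimes> \<eta> j = \<eta> j \<otimes> \<eta> i" if "i \<in> {1..<n}" "j \<in> {1..<n}" for i j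
    using lt[of i j] lt[of j i] that by (cases i j rule: linorder_cases) auto
  then show ?thesis using cl by (auto simp: elem_params_def)
qed

end

context graded_UT
begin

lemma elementary_params:
  assumes D: "Diag n \<subseteq> Az \<one>"
  shows "\<exists>\<eta>. elem_params G n \<eta> \<and> (\<forall>i j. 1 \<le> i \<longrightarrow> i < j \<longrightarrow> j \<le> n \<longrightarrow> munit i j \<in> A (seg_prod G \<eta> i j))"
proof -
  have "\<exists>h\<in>carrier G. munit i (Suc i) \<in> A h" if "1 \<le> i" "i < n" for i
    using munit_homogeneous[OF D, of i "Suc i"] that by simp
  then obtain \<eta> where \<eta>: "\<And>i. 1 \<le> i \<Longrightarrow> i < n \<Longrightarrow> \<eta> i \<in> carrier G \<and> munit i (Suc i) \<in> A (\<eta> i)"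
    by metis
  have seg_cl: "seg_prod G \<eta> i j \<in> carrier G" if "1 \<le> i" "j \<le> n" for i j
    using \<eta> that by (intro seg_prod_closed) auto
  have mem: "munit i j \<in> A (seg_prod G \<eta> i j)" if "1 \<le> i" "i < j" "j \<le> n" for i j
    using that
  proof (induct "j - i" arbitrary: i)
    case (Suc d)
    show ?case
    proof (cases "j = Suc i")
      case True
      then have "seg_prod G \<eta> i j = \<eta> i" using \<eta>[of i] Suc.prems by (simp add: seg_prod_Cons seg_prod_refl)
      then show ?thesis using \<eta>[of i] Suc.prems True by simp
    next
      case False
      then have "munit (Suc i) j \<in> A (seg_prod G \<eta> (Suc i) j)" using Suc.hyps(1)[of "Suc i"] Suc.hyps(2) Suc.prems by simp
      then have "bracket n (munit i (Suc i)) (munit (Suc i) j) \<in> A (\<eta> i \<otimes> seg_prod G \<eta> (Suc i) j)"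
        using \<eta>[of i] Suc.prems seg_cl[of "Suc i" j] by (intro A_bracket) auto
      moreover have "bracket n (munit i (Suc i)) (munit (Suc i) j) = (munit i j :: 'f matr)"
        using Suc.prems False by (intro bracket_munit_munit) auto
      ultimately show ?thesis using Suc.prems by (simp add: seg_prod_Cons)
    qed
  qed simp
  have "elem_params G n \<eta>"
  proof (rule elem_paramsI)
    fix i j assume ij: "1 \<le> i" "i < j" "j < n"
    have "bracket n (munit i j) (munit j (Suc j)) = (munit i (Suc j) :: 'f matr)"
      using ij by (intro bracket_munit_munit) auto
    then have "bracket n (munit i j) (munit j (Suc j)) \<noteq> (0 :: 'f matr)" using munit_nonzero by metis
    moreover have "munit i j \<in> A (seg_prod G \<eta> i j)" using mem[of i j] ij by simp
    moreover have "munit j (Suc j) \<in> A (\<eta> j)" "\<eta> j \<in> carrier G" using \<eta>[of j] ij by simp_all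
    moreover have "seg_prod G \<eta> i j \<in> carrier G" using seg_cl[of i j] ij by simp
    ultimately show "seg_prod G \<eta> i j \<otimes> \<eta> j = \<eta> j \<otimes> seg_prod G \<eta> i j"
      by (intro deg_commute)
  qed (use \<eta> in blast)
  then show ?thesis using mem by blast
qed

end

section \<open>Conjugation by diagonal matrices and the vectors Xminus and Xplus\<close>

definition diag_conj :: "(nat \<Rightarrow> 'f::field) \<Rightarrow> 'f matr \<Rightarrow> 'f matr" where
  "diag_conj l y = (\<lambda>i j. l i / l j * y i j)"

lemma lie_auto_diag_conj:
  assumes l: "\<And>i. l i \<noteq> 0" shows "lie_auto n (diag_conj l)"
proof (rule lie_autoI)
  have U: "diag_conj m y \<in> UT n" if "y \<in> UT n" for m y using that by (simp add: UT_iff diag_conj_def)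
  have inv: "diag_conj (\<lambda>i. inverse (m i)) (diag_conj m y) = y" if "\<And>i. m i \<noteq> 0" for m :: "nat \<Rightarrow> 'a" and y
    using that by (simp add: diag_conj_def fun_eq_iff field_simps)
  show "bij_betw (diag_conj l) (UT n) (UT n)"
    by (rule bij_betwI[where g = "diag_conj (\<lambda>i. inverse (l i))"])
      (use U inv[of l] inv[of "\<lambda>i. inverse (l i)"] l in auto)
  have m: "diag_conj l (mmul n x y) = mmul n (diag_conj l x) (diag_conj l y)" for x y
  proof (intro ext)
    fix i j
    have "(\<Sum>k=1..n. l i / l k * x i k * (l k / l j * y k j)) = (\<Sum>k=1..n. l i / l j * (x i k * y k j))"
      using l by (intro sum.cong) (auto simp: field_simps)
    then show "diag_conj l (mmul n x y) i j = mmul n (diag_conj l x) (diag_conj l y) i j"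
      by (simp add: diag_conj_def mmul_def sum_distrib_left)
  qed
  have "diag_conj l (x - y) = diag_conj l x - diag_conj l y" for x y
    by (simp add: diag_conj_def fun_eq_iff right_diff_distrib)
  then show "diag_conj l (bracket n x y) = bracket n (diag_conj l x) (diag_conj l y)" for x y
    unfolding bracket_def by (simp only: m)
qed (simp_all add: diag_conj_def fun_eq_iff distrib_left)

lemma diag_conj_Diag: "(\<And>i. l i \<noteq> 0) \<Longrightarrow> d \<in> Diag n \<Longrightarrow> diag_conj l d = d"
proof (intro ext)
  fix i j assume "\<And>i. l i \<noteq> 0" "d \<in> Diag n"
  then show "diag_conj l d i j = d i j" by (cases "i = j") (auto simp: diag_conj_def Diag_iff)
qed

lemma diag_conj_munit: "diag_conj l (munit i j) = mscale (l i / l j) (munit i j)"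
  by (simp add: diag_conj_def munit_def fun_eq_iff)

lemma diag_conj_add: "diag_conj l (x + y) = diag_conj l x + diag_conj l y"
  and diag_conj_diff: "diag_conj l (x - y) = diag_conj l x - diag_conj l y"
  and diag_conj_scale: "diag_conj l (mscale c x) = mscale c (diag_conj l x)"
  by (simp_all add: diag_conj_def fun_eq_iff distrib_left right_diff_distrib)

lemma Xminus_Diag: "1 \<le> i \<Longrightarrow> i \<le> n \<Longrightarrow> Xminus n i i \<in> Diag n"
  and Xplus_Diag: "1 \<le> i \<Longrightarrow> i \<le> n \<Longrightarrow> Xplus n i i \<in> Diag n"
  by (auto simp: Diag_iff Xminus_def Xplus_def munit_def)

lemma Xminus_UT: "1 \<le> i \<Longrightarrow> i \<le> j \<Longrightarrow> j \<le> n \<Longrightarrow> Xminus n i j \<in> UT n"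
  unfolding Xminus_def by (intro subspace_closed(2)[OF subspace_UT] munit_UT; simp)

lemma Xminus_Fil: "1 \<le> i \<Longrightarrow> i < j \<Longrightarrow> j \<le> n \<Longrightarrow> Xminus n i j \<in> Fil n 1"
  and Xplus_Fil: "1 \<le> i \<Longrightarrow> i < j \<Longrightarrow> j \<le> n \<Longrightarrow> Xplus n i j \<in> Fil n 1"
  unfolding Xminus_def Xplus_def
  by (intro subspace_closed(1,2)[OF subspace_Fil] munit_Fil; simp)+

lemma Xminus_diag_entry: "1 \<le> i \<Longrightarrow> i \<le> n \<Longrightarrow>
    Xminus n i i p p = (if p = i then 1 else 0) - (if p = n + 1 - i then 1 else 0)"
  and Xplus_diag_entry: "1 \<le> i \<Longrightarrow> i \<le> n \<Longrightarrow>
    Xplus n i i p p = (if p = i then 1 else 0) + (if p = n + 1 - i then 1 else 0)"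
  by (simp_all add: Xminus_def Xplus_def munit_def)

context graded_UT
begin

text \<open>The reflection also reverses the order of the two entries in a root, hence the sign:
  antisymmetric diagonal matrices (r = -1) have symmetric root values, and symmetric ones have
  antisymmetric root values.\<close>

lemma simple_root_flip:
  assumes i: "1 \<le> i" "i < n" and d: "\<And>p. 1 \<le> p \<Longrightarrow> p \<le> n \<Longrightarrow> d (n + 1 - p) (n + 1 - p) = r * d p p"
  shows "simple_root d (n - i) = - r * simple_root d i"
proof -
  have "n - i = n + 1 - Suc i" "Suc (n - i) = n + 1 - i" using i by auto
  then have "d (n - i) (n - i) = r * d (Suc i) (Suc i)" "d (Suc (n - i)) (Suc (n - i)) = r * d i i"
    using d[of i] d[of "Suc i"] i by simp_all
  then show ?thesis unfolding simple_root_def by (simp add: algebra_simps)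
qed

text \<open>Only the antisymmetric diagonal matrices can be given trivial degree here. They suffice,
  because their centralizer already consists of diagonal matrices.\<close>

lemma flip_form:
  assumes T: "flip_torus g"
  shows "\<exists>f. lie_auto n f \<and> graded_UT.flip_torus G n (\<lambda>h. f ` A h) g \<and>
    (\<forall>i. 1 \<le> i \<longrightarrow> i \<le> n \<longrightarrow> Xminus n i i \<in> graded_UT.Az G n (\<lambda>h. f ` A h) \<one>)"
proof -
  let ?ds = "map (\<lambda>i. Xminus n i i) [1..<Suc n] :: 'f matr list"
  have "(Xminus n i i :: 'f matr) \<in> Diag n \<and> (\<exists>x\<in>Az \<one>. diag_part x = Xminus n i i)"
    if i: "1 \<le> i" "i \<le> n" for i
  proof
    show D: "Xminus n i i \<in> (Diag n :: 'f matr set)" using Xminus_Diag i by blast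
    show "\<exists>x\<in>Az \<one>. diag_part x = Xminus n i i"
    proof (rule lift_flip[OF T D])
      fix k assume k: "1 \<le> k" "k < n"
      have "simple_root (Xminus n i i :: 'f matr) (n - k) = - (-1) * simple_root (Xminus n i i) k"
        using i by (intro simple_root_flip k) (auto simp: Xminus_diag_entry)
      then show "simple_root (Xminus n i i :: 'f matr) k = simple_root (Xminus n i i) (n - k)" by simp
    qed
  qed
  then have "\<forall>d\<in>set ?ds. d \<in> Diag n \<and> (\<exists>x\<in>Az \<one>. diag_part x = d)"
    by (auto simp del: upt_Suc)
  then obtain f where f: "lie_auto n f" "fixes_diag n f"
    "\<forall>d\<in>set ?ds. d \<in> graded_UT.Az G n (\<lambda>h. f ` A h) \<one>"
    using clean_list[OF graded_UT_axioms, of ?ds] by auto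
  have "Xminus n i i \<in> graded_UT.Az G n (\<lambda>h. f ` A h) \<one>" if "1 \<le> i" "i \<le> n" for i
    using f(3) that by (auto simp del: upt_Suc)
  then show ?thesis using f(1) flip_torus_image[OF T f(1,2)] by blast
qed

end

section \<open>Root vectors when the torus carries degrees 1 and g\<close>

locale flip_UT = graded_UT G n A for G :: "('g, 'z) monoid_scheme" (structure) and n
    and A :: "'g \<Rightarrow> 'f::field matr set" +
  fixes g :: 'g
  assumes flip: "flip_torus g"
    and Xminus_Az: "\<And>i. 1 \<le> i \<Longrightarrow> i \<le> n \<Longrightarrow> Xminus n i i \<in> Az \<one>"
begin

lemmas n3 = flip_torusD(1)[OF flip] and two = flip_torusD(2)[OF flip]
  and gG = flip_torusD(3)[OF flip] and g1 = flip_torusD(4)[OF flip] and gg = flip_torusD(5)[OF flip]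

lemma gg_mult: "h \<in> carrier G \<Longrightarrow> g \<otimes> (g \<otimes> h) = h"
  using gG gg by (simp add: m_assoc[symmetric])

text \<open>The antisymmetric diagonal matrices separate any two indices p and q: test with k = p,
  or with k = q if p is the middle index. For mirror images the values are 1 and -1, different as 2
  is nonzero.\<close>

lemma centralizer:
  fixes y :: "'f matr"
  assumes y: "y \<in> UT n" and z: "\<And>k. 1 \<le> k \<Longrightarrow> k \<le> n \<Longrightarrow> bracket n (Xminus n k k) y = 0"
  shows "y \<in> Diag n"
proof -
  have "p = q" if "y p q \<noteq> 0" for p q
  proof (rule ccontr)
    assume ne: "p \<noteq> q"
    have pq: "1 \<le> p" "p \<le> q" "q \<le> n" using UT_D[OF y that] by auto
    have e: "((if p = k then 1 else 0) - (if p = n + 1 - k then 1 else 0) :: 'f)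
        = (if q = k then 1 else 0) - (if q = n + 1 - k then 1 else 0)" if k: "1 \<le> k" "k \<le> n" for k
    proof -
      have "bracket n (Xminus n k k) y p q = 0" using z[OF k] by simp
      then have "Xminus n k k p p = (Xminus n k k q q :: 'f)"
        using \<open>y p q \<noteq> 0\<close> by (simp add: bracket_Diag[OF Xminus_Diag[OF k] y])
      then show ?thesis by (simp only: Xminus_diag_entry[OF k])
    qed
    have m1: "(1::'f) \<noteq> -1" using two by (simp add: eq_neg_iff_add_eq_0)
    show False
    proof (cases "p = n + 1 - p")
      case False
      then show False using e[of p] pq ne m1 by (auto split: if_splits)
    next
      case True
      then have "q \<noteq> n + 1 - q" "p \<noteq> n + 1 - q" using pq ne by auto
      then show False using e[of q] pq ne by auto
    qed
  qed
  then show ?thesis using UT_zero[OF y] unfolding Diag_iff by (metis order_refl)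
qed

lemma hcomp_Diag:
  assumes d: "d \<in> Diag n" and h: "h \<in> carrier G" shows "hcomp h d \<in> Diag n"
proof (rule centralizer)
  have dU: "d \<in> UT n" using d Diag_subset_UT by blast
  then show "hcomp h d \<in> UT n" by (rule hcomp_UT)
  fix k assume k: "1 \<le> k" "k \<le> n"
  have D: "Xminus n k k \<in> (Diag n :: 'f matr set)" using k by (rule Xminus_Diag)
  have "bracket n (Xminus n k k) d p q = 0" for p q
    unfolding bracket_Diag[OF D dU] using d by (cases "p = q") (auto simp: Diag_iff)
  then have "bracket n (Xminus n k k) d = 0" by (simp add: fun_eq_iff)
  then show "bracket n (Xminus n k k) (hcomp h d) = 0"
    using hcomp_bracket_Az[OF Xminus_Az[OF k] dU one_closed h] h hcomp_0 by simp
qed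

text \<open>The name refers to the root values, which are symmetric. The components of d are
  diagonal, those of nontrivial degree have zero root values, and so these are scalar. In
  \<open>anti_Az\<close> the roles of 1 and g are exchanged.\<close>

lemma sym_Az:
  assumes d: "d \<in> Diag n" and s: "\<forall>p. 1 \<le> p \<longrightarrow> p \<le> n \<longrightarrow> d (n + 1 - p) (n + 1 - p) = - d p p"
  shows "d \<in> Az \<one>"
proof -
  have dU: "d \<in> UT n" using d Diag_subset_UT by blast
  have "hcomp k d \<in> centre n" if k: "k \<in> carrier G" "k \<noteq> \<one>" for k
  proof (rule simple_root_zero_centre[OF hcomp_Diag[OF d k(1)]])
    fix i assume i: "1 \<le> i" "i < n"
    have "simple_root d (n - i) = - (-1) * simple_root d i" using s by (intro simple_root_flip i) simp
    then show "simple_root (hcomp k d) i = 0"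
      using simple_root_hcomp_flip(1)[OF flip dU i] flip_torusD(6)[OF flip k(1) hcomp_in[OF dU k(1)] i k(2)]
      by (cases "k = g") auto
  qed
  then show ?thesis using dU by (simp add: Az_def)
qed

lemma anti_Az:
  assumes d: "d \<in> Diag n" and s: "\<forall>p. 1 \<le> p \<longrightarrow> p \<le> n \<longrightarrow> d (n + 1 - p) (n + 1 - p) = d p p"
  shows "d \<in> Az g"
proof -
  have dU: "d \<in> UT n" using d Diag_subset_UT by blast
  have "hcomp k d \<in> centre n" if k: "k \<in> carrier G" "k \<noteq> g" for k
  proof (rule simple_root_zero_centre[OF hcomp_Diag[OF d k(1)]])
    fix i assume i: "1 \<le> i" "i < n"
    have "simple_root d (n - i) = - 1 * simple_root d i" using s by (intro simple_root_flip i) simp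
    then show "simple_root (hcomp k d) i = 0"
      using simple_root_hcomp_flip(2)[OF flip dU i] flip_torusD(6)[OF flip k(1) hcomp_in[OF dU k(1)] i _ k(2)]
      by (cases "k = \<one>") auto
  qed
  then show ?thesis using dU by (simp add: Az_def)
qed

lemma flip_split:
  fixes d :: "'f matr"
  assumes d: "d \<in> Diag n"
  obtains s a where "d = s + a" "s \<in> Diag n" "a \<in> Diag n"
    "\<forall>p. 1 \<le> p \<longrightarrow> p \<le> n \<longrightarrow> s (n + 1 - p) (n + 1 - p) = - s p p"
    "\<forall>p. 1 \<le> p \<longrightarrow> p \<le> n \<longrightarrow> a (n + 1 - p) (n + 1 - p) = a p p"
proof
  let ?s = "\<lambda>p q. if p = q \<and> 1 \<le> p \<and> p \<le> n then (d p p - d (n + 1 - p) (n + 1 - p)) / 2 else 0"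
  let ?a = "\<lambda>p q. if p = q \<and> 1 \<le> p \<and> p \<le> n then (d p p + d (n + 1 - p) (n + 1 - p)) / 2 else 0"
  show "?s \<in> Diag n" "?a \<in> Diag n" by (auto simp: Diag_iff)
  show "\<forall>p. 1 \<le> p \<longrightarrow> p \<le> n \<longrightarrow> ?s (n + 1 - p) (n + 1 - p) = - ?s p p"
    "\<forall>p. 1 \<le> p \<longrightarrow> p \<le> n \<longrightarrow> ?a (n + 1 - p) (n + 1 - p) = ?a p p"
    by (auto simp: diff_divide_distrib add.commute)
  have half: "(x - y) / 2 + (x + y) / 2 = x" for x y :: 'f
  proof -
    have "(x - y) / 2 + (x + y) / 2 = (2 * x) / 2"
      unfolding add_divide_distrib[symmetric] by (rule arg_cong[where f = "\<lambda>z. z / 2"], algebra)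
    then show ?thesis using two by simp
  qed
  show "d = ?s + ?a"
  proof (intro ext)
    fix p q
    show "d p q = (?s + ?a) p q"
      using half[of "d p p" "d (n + 1 - p) (n + 1 - p)"] d by (auto simp: Diag_iff)
  qed
qed

text \<open>Let u and v be the components of degrees h and \<open>g \<otimes> h\<close>.
  Antisymmetric diagonal matrices act on both by the root, symmetric ones interchange them up to the
  root value. So u + v is a weight vector for the root and u - v for the mirror root, and both are
  multiples of matrix units.\<close>

lemma root_components:
  assumes ij: "1 \<le> i" "i < j" "j \<le> n" and h: "h \<in> carrier G"
  shows "\<exists>p q. hcomp h (munit i j) = mscale p (munit i j) + mscale q (munit (n + 1 - j) (n + 1 - i)) \<and>
    hcomp (g \<otimes> h) (munit i j) = mscale p (munit i j) - mscale q (munit (n + 1 - j) (n + 1 - i))"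
proof -
  let ?e = "munit i j :: 'f matr" and ?e' = "munit (n + 1 - j) (n + 1 - i) :: 'f matr"
  have e: "?e \<in> UT n" using ij by (intro munit_UT) auto
  have gh: "g \<otimes> h \<in> carrier G" using gG h by simp
  let ?u = "hcomp h ?e" and ?v = "hcomp (g \<otimes> h) ?e"
  have uv: "?u \<in> UT n" "?v \<in> UT n" using e by (simp_all add: hcomp_UT)
  have br: "bracket n d ?e = mscale (d i i - d j j) ?e" if "d \<in> Diag n" for d
    by (intro ext) (simp only: bracket_Diag[OF that e] mscale_apply, simp add: munit_def)
  have s1: "bracket n s ?u = mscale (s i i - s j j) ?u" "bracket n s ?v = mscale (s i i - s j j) ?v"
    if "s \<in> Diag n" "\<forall>p. 1 \<le> p \<longrightarrow> p \<le> n \<longrightarrow> s (n + 1 - p) (n + 1 - p) = - s p p" for s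
    using hcomp_bracket_Az[OF sym_Az[OF that] e one_closed h] hcomp_bracket_Az[OF sym_Az[OF that] e one_closed gh]
      hcomp_scale[OF e] h gh by (simp_all add: br[OF that(1)])
  have a1: "bracket n a ?u = mscale (a i i - a j j) ?v" "bracket n a ?v = mscale (a i i - a j j) ?u"
    if "a \<in> Diag n" "\<forall>p. 1 \<le> p \<longrightarrow> p \<le> n \<longrightarrow> a (n + 1 - p) (n + 1 - p) = a p p" for a
    using hcomp_bracket_Az[OF anti_Az[OF that] e gG h] hcomp_bracket_Az[OF anti_Az[OF that] e gG gh]
      hcomp_scale[OF e] gg_mult[OF h] by (simp_all add: br[OF that(1)])
  define W W' where "W = ?u + ?v" and "W' = ?u - ?v"
  have WU: "W \<in> UT n" "W' \<in> UT n" using uv by (simp_all add: W_def W'_def UT_closed)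
  have W: "W = mscale (W i j) ?e"
  proof (rule weight_vector[OF WU(1) ij])
    fix d :: "'f matr" assume "d \<in> Diag n"
    then obtain s a where sa: "d = s + a" "s \<in> Diag n" "a \<in> Diag n"
      "\<forall>p. 1 \<le> p \<longrightarrow> p \<le> n \<longrightarrow> s (n + 1 - p) (n + 1 - p) = - s p p"
      "\<forall>p. 1 \<le> p \<longrightarrow> p \<le> n \<longrightarrow> a (n + 1 - p) (n + 1 - p) = a p p" by (rule flip_split) blast
    have "bracket n d W = (bracket n s ?u + bracket n s ?v) + (bracket n a ?u + bracket n a ?v)"
      by (simp only: sa(1) W_def bracket_add_left bracket_add_right add_ac)
    also have "\<dots> = mscale (d i i - d j j) W"
      unfolding s1[OF sa(2,4)] a1[OF sa(3,5)] by (intro ext) (simp add: sa(1) W_def algebra_simps)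
    finally show "bracket n d W = mscale (d i i - d j j) W" .
  qed
  have W': "W' = mscale (W' (n + 1 - j) (n + 1 - i)) ?e'"
  proof (rule weight_vector[OF WU(2)])
    fix d :: "'f matr" assume "d \<in> Diag n"
    then obtain s a where sa: "d = s + a" "s \<in> Diag n" "a \<in> Diag n"
      "\<forall>p. 1 \<le> p \<longrightarrow> p \<le> n \<longrightarrow> s (n + 1 - p) (n + 1 - p) = - s p p"
      "\<forall>p. 1 \<le> p \<longrightarrow> p \<le> n \<longrightarrow> a (n + 1 - p) (n + 1 - p) = a p p" by (rule flip_split) blast
    have eq: "bracket n d W' = (bracket n s ?u - bracket n s ?v) + (bracket n a ?u - bracket n a ?v)"
      by (simp only: sa(1) W'_def bracket_add_left bracket_diff_right add_diff_add)
    \<comment> \<open>Passing to the mirror root keeps the value on s and changes the sign of the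
      value on a.\<close>
    have c: "d (n + 1 - j) (n + 1 - j) - d (n + 1 - i) (n + 1 - i) = (s i i - s j j) - (a i i - a j j)"
      using sa(4)[rule_format, of i] sa(4)[rule_format, of j] sa(5)[rule_format, of i] sa(5)[rule_format, of j] ij
      by (simp add: sa(1))
    show "bracket n d W' = mscale (d (n + 1 - j) (n + 1 - j) - d (n + 1 - i) (n + 1 - i)) W'"
      unfolding eq c s1[OF sa(2,4)] a1[OF sa(3,5)] by (intro ext) (simp add: W'_def algebra_simps)
  qed (use ij in auto)
  have half: "x = a / 2 + b / 2 \<and> y = a / 2 - b / 2" if "x + y = a" "x - y = b" for x y a b :: 'f
  proof -
    have "a + b = 2 * x" "a - b = 2 * y" unfolding that[symmetric] by algebra+
    then show ?thesis using two by (simp add: add_divide_distrib[symmetric] diff_divide_distrib[symmetric])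
  qed
  have "?u k l = (mscale (W i j / 2) ?e + mscale (W' (n + 1 - j) (n + 1 - i) / 2) ?e') k l \<and>
      ?v k l = (mscale (W i j / 2) ?e - mscale (W' (n + 1 - j) (n + 1 - i) / 2) ?e') k l" for k l
  proof -
    have "?u k l + ?v k l = W i j * ?e k l"
      using fun_cong[OF fun_cong[OF W], of k l] by (simp only: W_def plus_fun_apply mscale_apply)
    moreover have "?u k l - ?v k l = W' (n + 1 - j) (n + 1 - i) * ?e' k l"
      using fun_cong[OF fun_cong[OF W'], of k l] by (simp only: W'_def matr_diff_apply mscale_apply)
    ultimately show ?thesis
      using half[of "?u k l" "?v k l"] by (simp only: plus_fun_apply matr_diff_apply mscale_apply times_divide_eq_left)
  qed
  then show ?thesis
    by (intro exI[of _ "W i j / 2"] exI[of _ "W' (n + 1 - j) (n + 1 - i) / 2"] conjI ext) blast+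
qed

lemma nonzero_component:
  assumes ij: "1 \<le> i" "i < j" "j \<le> n"
  obtains h where "h \<in> carrier G" "hcomp h (munit i j) i j \<noteq> 0"
proof -
  note ex = that
  have "\<exists>h\<in>carrier G. hcomp h (munit i j) i j \<noteq> 0"
  proof (rule ccontr)
    assume "\<not> ?thesis"
    then have z: "hcomp h (munit i j) i j = 0" if "h \<in> carrier G" for h using that by blast
  have "matr.subspace {y :: 'f matr. y i j = 0}" by (intro matr.subspaceI) auto
  then have "munit i j \<in> {y :: 'f matr. y i j = 0}"
    by (rule hcomp_mem[rotated]) (use z ij in \<open>auto intro!: munit_UT\<close>)
  then show False by (simp add: munit_def)
  qed
  then show ?thesis using ex by blast
qed

text \<open>The components from \<open>root_components\<close> are scaled so that the matrix unit
  has coefficient 1. If b were 0, the matrix unit would have both degrees h and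
  \<open>g \<otimes> h\<close>.\<close>

lemma root_pair:
  assumes ij: "1 \<le> i" "i < j" "j \<le> n" and ne: "i + j \<noteq> n + 1"
  shows "\<exists>h b. h \<in> carrier G \<and> b \<noteq> 0 \<and>
    munit i j + mscale b (munit (n + 1 - j) (n + 1 - i)) \<in> A h \<and>
    munit i j - mscale b (munit (n + 1 - j) (n + 1 - i)) \<in> A (g \<otimes> h)"
proof -
  let ?e = "munit i j :: 'f matr" and ?e' = "munit (n + 1 - j) (n + 1 - i) :: 'f matr"
  have e: "?e \<in> UT n" using ij by (intro munit_UT) auto
  obtain h where h: "h \<in> carrier G" "hcomp h ?e i j \<noteq> 0" by (rule nonzero_component[OF ij])
  have gh: "g \<otimes> h \<in> carrier G" using gG h by simp
  obtain p q where pq: "hcomp h ?e = mscale p ?e + mscale q ?e'" "hcomp (g \<otimes> h) ?e = mscale p ?e - mscale q ?e'"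
    using root_components[OF ij h(1)] by blast
  have "hcomp h ?e i j = p" unfolding pq(1) using ij ne by (auto simp: munit_def)
  then have p: "p \<noteq> 0" using h(2) by simp
  have u: "mscale (inverse p) (hcomp h ?e) \<in> A h"
    using matr.subspace_scale[OF A_subspace[OF h(1)] hcomp_in[OF e h(1)]] .
  have v: "mscale (inverse p) (hcomp (g \<otimes> h) ?e) \<in> A (g \<otimes> h)"
    using matr.subspace_scale[OF A_subspace[OF gh] hcomp_in[OF e gh]] .
  have "mscale (inverse p) (hcomp h ?e) = ?e + mscale (inverse p * q) ?e'"
    unfolding pq(1) using p by (simp add: matr.scale_right_distrib)
  then have u': "?e + mscale (inverse p * q) ?e' \<in> A h" using u by simp
  have "mscale (inverse p) (hcomp (g \<otimes> h) ?e) = ?e - mscale (inverse p * q) ?e'"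
    unfolding pq(2) using p by (simp add: matr.scale_right_diff_distrib)
  then have v': "?e - mscale (inverse p * q) ?e' \<in> A (g \<otimes> h)" using v by simp
  have "inverse p * q \<noteq> 0"
  proof
    assume z: "inverse p * q = 0"
    have "?e \<in> A h" using u' unfolding z by (simp only: matr.scale_zero_left add_0_right)
    moreover have "?e \<in> A (g \<otimes> h)" using v' unfolding z by (simp only: matr.scale_zero_left diff_0_right)
    ultimately have "h = g \<otimes> h" using deg_unique munit_nonzero h gh by blast
    then show False using g1 gG h(1) by (metis l_one one_closed right_cancel)
  qed
  then show ?thesis using u' v' h(1) by blast
qed

lemma root_self:
  assumes ij: "1 \<le> i" "i < j" "j \<le> n" and eq: "i + j = n + 1"
  shows "\<exists>h\<in>carrier G. munit i j \<in> A h"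
proof -
  let ?e = "munit i j :: 'f matr"
  have e: "?e \<in> UT n" using ij by (intro munit_UT) auto
  obtain h where h: "h \<in> carrier G" "hcomp h ?e i j \<noteq> 0" by (rule nonzero_component[OF ij])
  have "n + 1 - j = i" "n + 1 - i = j" using eq by auto
  then obtain p q where "hcomp h ?e = mscale p ?e + mscale q ?e"
    using root_components[OF ij h(1)] by auto
  then have r: "hcomp h ?e = mscale (p + q) ?e" by (simp only: matr.scale_left_distrib)
  then have "p + q \<noteq> 0" using h(2) by auto
  then have "?e = mscale (inverse (p + q)) (hcomp h ?e)" unfolding r by (simp add: matr.scale_scale)
  also have "\<dots> \<in> A h" using matr.subspace_scale[OF A_subspace[OF h(1)] hcomp_in[OF e h(1)]] .
  finally show ?thesis using h(1) by blast
qed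

end

text \<open>The rescaling by a diagonal matrix turns the pairs of homogeneous combinations of
  \<open>e\<^sub>i\<^sub>,\<^sub>i\<^sub>+\<^sub>1\<close> and its mirror image into the elements Xminus and Xplus.\<close>

fun rescale :: "nat \<Rightarrow> (nat \<Rightarrow> 'f::field) \<Rightarrow> nat \<Rightarrow> 'f" where
  "rescale n b 0 = 1"
| "rescale n b (Suc k) = (if n - k < k \<and> k < n then - b (n - k) * rescale n b k else rescale n b k)"

text \<open>What the normalization achieves: the X vectors are homogeneous, modulo the centre on the
  diagonal and exactly at the simple roots. The remaining root vectors follow by brackets.\<close>

locale adapted_flip = graded_UT G n A for G :: "('g, 'z) monoid_scheme" (structure) and n
    and A :: "'g \<Rightarrow> 'f::field matr set" +
  fixes g :: 'g and \<eta> :: "nat \<Rightarrow> 'g"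
  assumes n3: "3 \<le> n" and two: "(2::'f) \<noteq> 0" and gG: "g \<in> carrier G" and g1: "g \<noteq> \<one>" and gg: "g \<otimes> g = \<one>"
    and eta_closed: "\<And>i. 1 \<le> i \<Longrightarrow> i < n \<Longrightarrow> \<eta> i \<in> carrier G"
    and eta_flip: "\<And>i. 1 \<le> i \<Longrightarrow> i < n \<Longrightarrow> \<eta> (n - i) = \<eta> i"
    and Xminus_diag: "\<And>i. 1 \<le> i \<Longrightarrow> i \<le> n \<Longrightarrow> Xminus n i i \<in> Az \<one>"
    and Xplus_diag: "\<And>i. 1 \<le> i \<Longrightarrow> i \<le> n \<Longrightarrow> Xplus n i i \<in> Az g"
    and Xminus_simple: "\<And>i. 1 \<le> i \<Longrightarrow> i < n \<Longrightarrow> Xminus n i (Suc i) \<in> A (\<eta> i)"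
    and Xplus_simple: "\<And>i. 1 \<le> i \<Longrightarrow> i < n \<Longrightarrow> Xplus n i (Suc i) \<in> A (g \<otimes> \<eta> i)"

lemma (in flip_UT) rescaled_form:
  "\<exists>f \<eta>. lie_auto n f \<and> adapted_flip G n (\<lambda>h. f ` A h) g \<eta>"
proof -
  \<comment> \<open>For 2 * i = n the simple root is its own mirror image and its matrix unit is
    homogeneous; otherwise a pair from \<open>root_pair\<close> is chosen.\<close>
  define hh :: "nat \<Rightarrow> 'g" where "hh = (\<lambda>i. if 2 * i = n then SOME h. h \<in> carrier G \<and> munit i (Suc i) \<in> A h
    else SOME h. h \<in> carrier G \<and> (\<exists>b. b \<noteq> 0 \<and>
      munit i (Suc i) + mscale b (munit (n - i) (n + 1 - i)) \<in> A h \<and>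
      munit i (Suc i) - mscale b (munit (n - i) (n + 1 - i)) \<in> A (g \<otimes> h)))"
  have self: "hh i \<in> carrier G \<and> munit i (Suc i) \<in> A (hh i)" if "1 \<le> i" "i < n" "2 * i = n" for i
  proof -
    have "\<exists>h. h \<in> carrier G \<and> munit i (Suc i) \<in> A h" using root_self[of i "Suc i"] that by auto
    from someI_ex[OF this] show ?thesis using that(3) by (simp add: hh_def)
  qed
  have pair: "hh i \<in> carrier G \<and> (\<exists>b. b \<noteq> 0 \<and>
      munit i (Suc i) + mscale b (munit (n - i) (n + 1 - i)) \<in> A (hh i) \<and>
      munit i (Suc i) - mscale b (munit (n - i) (n + 1 - i)) \<in> A (g \<otimes> hh i))"
    if "1 \<le> i" "i < n" "2 * i \<noteq> n" for i
  proof -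
    have "\<exists>h. h \<in> carrier G \<and> (\<exists>b. b \<noteq> 0 \<and>
      munit i (Suc i) + mscale b (munit (n - i) (n + 1 - i)) \<in> A h \<and>
      munit i (Suc i) - mscale b (munit (n - i) (n + 1 - i)) \<in> A (g \<otimes> h))"
      using root_pair[of i "Suc i"] that by auto
    from someI_ex[OF this] show ?thesis using that(3) by (simp add: hh_def)
  qed
  then obtain b where b: "\<And>i. 1 \<le> i \<Longrightarrow> i < n \<Longrightarrow> 2 * i \<noteq> n \<Longrightarrow> hh i \<in> carrier G \<and> b i \<noteq> 0 \<and>
      munit i (Suc i) + mscale (b i) (munit (n - i) (n + 1 - i)) \<in> A (hh i) \<and>
      munit i (Suc i) - mscale (b i) (munit (n - i) (n + 1 - i)) \<in> A (g \<otimes> hh i)"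
    by metis
  define l where "l = rescale n b"
  have l: "l k \<noteq> 0" for k
  proof (induct k)
    case (Suc k)
    have "b (n - k) \<noteq> 0" if k: "n - k < k \<and> k < n"
    proof -
      have "1 \<le> n - k" "n - k < n" "2 * (n - k) \<noteq> n" using k by linarith+
      then show ?thesis using b by blast
    qed
    then show ?case using Suc by (auto simp: l_def)
  qed (simp add: l_def)
  let ?f = "diag_conj l"
  have f: "lie_auto n ?f" using l by (rule lie_auto_diag_conj)
  interpret B: graded_UT G n "\<lambda>h. ?f ` A h" by (rule grading_image[OF f])
  \<comment> \<open>At the middle root Xminus vanishes and Xplus is twice the matrix unit, of degree
    \<open>hh i\<close>. This degree has to be \<open>g \<otimes> \<eta> i\<close>, whence the
    factor g.\<close>
  define \<eta> where "\<eta> = (\<lambda>i. if 2 * i < n then hh i else if 2 * i = n then g \<otimes> hh i else hh (n - i))"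
  have low: "Xminus n i (Suc i) \<in> ?f ` A (hh i) \<and> Xplus n i (Suc i) \<in> ?f ` A (g \<otimes> hh i)"
    if i: "1 \<le> i" "2 * i < n" for i
  proof -
    let ?e = "munit i (Suc i) :: 'f matr" and ?e' = "munit (n - i) (n + 1 - i) :: 'f matr"
    have "\<not> (n - i < i)" using i by linarith
    then have "l (Suc i) = l i" by (simp add: l_def)
    then have e: "?f ?e = ?e" using l[of i] by (simp add: diag_conj_munit)
    have s: "n + 1 - i = Suc (n - i)" "n - (n - i) = i" using i by auto
    \<comment> \<open>The scaling leaves the root vector in the left half alone and multiplies its
      mirror image by \<open>- inverse (b i)\<close>, so that the coefficient b i becomes
      -1.\<close>
    have "l (Suc (n - i)) = - b i * l (n - i)" using i s(2) by (simp add: l_def)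
    then have e': "?f ?e' = mscale (- inverse (b i)) ?e'"
      using l[of "n - i"] b[of i] i unfolding s(1) by (simp add: diag_conj_munit field_simps)
    have "?f (?e + mscale (b i) ?e') = Xminus n i (Suc i)"
      unfolding diag_conj_add diag_conj_scale e e' using b[of i] i by (simp add: Xminus_def matr.scale_scale)
    moreover have "?f (?e - mscale (b i) ?e') = Xplus n i (Suc i)"
      unfolding diag_conj_diff diag_conj_scale e e' using b[of i] i by (simp add: Xplus_def matr.scale_scale)
    moreover have "?e + mscale (b i) ?e' \<in> A (hh i)" "?e - mscale (b i) ?e' \<in> A (g \<otimes> hh i)"
      using b[of i] i by auto
    ultimately show ?thesis by (metis image_eqI)
  qed
  have mid: "Xminus n i (Suc i) = (0 :: 'f matr)" "Xplus n i (Suc i) \<in> ?f ` A (hh i)"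
    if i: "1 \<le> i" "2 * i = n" for i
  proof -
    have s: "n + 1 - Suc i = i" "n + 1 - i = Suc i" using i by auto
    show "Xminus n i (Suc i) = (0 :: 'f matr)" unfolding Xminus_def s by simp
    have h: "hh i \<in> carrier G" "munit i (Suc i) \<in> A (hh i)" using self[of i] i by auto
    have "Xplus n i (Suc i) = ?f (mscale (2 * l (Suc i) / l i) (munit i (Suc i)))"
      unfolding Xplus_def s diag_conj_scale diag_conj_munit using l by (simp add: fun_eq_iff)
    then show "Xplus n i (Suc i) \<in> ?f ` A (hh i)"
      using matr.subspace_scale[OF A_subspace[OF h(1)] h(2)] by blast
  qed
  have eta_closed: "\<eta> i \<in> carrier G" if "1 \<le> i" "i < n" for i
    using that self[of i] pair[of i] pair[of "n - i"] gG by (auto simp: \<eta>_def)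
  have flip_X: "Xminus n i (Suc i) = - (Xminus n (n - i) (Suc (n - i)) :: 'f matr)"
    "Xplus n i (Suc i) = (Xplus n (n - i) (Suc (n - i)) :: 'f matr)" if i: "1 \<le> i" "i < n" for i
  proof -
    have s: "n + 1 - Suc i = n - i" "n + 1 - i = Suc (n - i)" "n + 1 - Suc (n - i) = i" "n + 1 - (n - i) = Suc i"
      using i by auto
    show "Xminus n i (Suc i) = - (Xminus n (n - i) (Suc (n - i)) :: 'f matr)"
      "Xplus n i (Suc i) = (Xplus n (n - i) (Suc (n - i)) :: 'f matr)"
      unfolding Xminus_def Xplus_def s by (simp_all only: minus_diff_eq add.commute)
  qed
  have "adapted_flip G n (\<lambda>h. ?f ` A h) g \<eta>"
  proof (unfold_locales)
    show "3 \<le> n" "(2::'f) \<noteq> 0" "g \<in> carrier G" "g \<noteq> \<one>" "g \<otimes> g = \<one>" using n3 two gG g1 gg by auto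
    fix i
    show "\<eta> i \<in> carrier G" if "1 \<le> i" "i < n" using eta_closed that .
    show "\<eta> (n - i) = \<eta> i" if "1 \<le> i" "i < n"
    proof -
      have "n - (n - i) = i" "2 * (n - i) < n \<longleftrightarrow> n < 2 * i" "2 * (n - i) = n \<longleftrightarrow> 2 * i = n" using that by auto
      moreover have "2 * i = n \<Longrightarrow> n - i = i" by auto
      ultimately show ?thesis by (auto simp: \<eta>_def)
    qed
    show "Xminus n i i \<in> B.Az \<one>" if i: "1 \<le> i" "i \<le> n"
      using Az_image[OF f Xminus_Az[OF i] one_closed] diag_conj_Diag[OF l Xminus_Diag[OF i]] by simp
    show "Xplus n i i \<in> B.Az g" if i: "1 \<le> i" "i \<le> n"
    proof -
      have "Xplus n i i \<in> Az g" using i by (intro anti_Az Xplus_Diag) (auto simp: Xplus_diag_entry)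
      then show ?thesis using Az_image[OF f _ gG, of "Xplus n i i"] diag_conj_Diag[OF l Xplus_Diag[OF i]] by simp
    qed
    assume i: "1 \<le> i" "i < n"
    have ni: "1 \<le> n - i" "n - i < n" using i by auto
    consider "2 * i < n" | "2 * i = n" | "n < 2 * i" by linarith
    then have "Xminus n i (Suc i) \<in> ?f ` A (\<eta> i) \<and> Xplus n i (Suc i) \<in> ?f ` A (g \<otimes> \<eta> i)"
    proof cases
      case 1 then show ?thesis using low[of i] i by (simp add: \<eta>_def)
    next
      case 2
      then have "hh i \<in> carrier G" using self[of i] i by blast
      then have "g \<otimes> \<eta> i = hh i" using 2 gg_mult by (simp add: \<eta>_def)
      then show ?thesis using mid[of i] i 2 matr.subspace_0[OF B.A_subspace[OF eta_closed[OF i]]] by simp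
    next
      case 3
      then have \<eta>: "\<eta> i = hh (n - i)" and c: "hh (n - i) \<in> carrier G" using pair[of "n - i"] i by (auto simp: \<eta>_def)
      have "Xminus n (n - i) (Suc (n - i)) \<in> ?f ` A (hh (n - i))" "Xplus n (n - i) (Suc (n - i)) \<in> ?f ` A (g \<otimes> hh (n - i))"
        using low[of "n - i"] 3 i by auto
      then show ?thesis unfolding flip_X[OF i] \<eta> using matr.subspace_neg[OF B.A_subspace[OF c]] by blast
    qed
    then show "Xminus n i (Suc i) \<in> ?f ` A (\<eta> i)" "Xplus n i (Suc i) \<in> ?f ` A (g \<otimes> \<eta> i)" by simp_all
  qed
  then show ?thesis using f by blast
qed

text \<open>A single bracket of X vectors also contains mixed terms, between a matrix unit and a
  mirrored one; they cancel in these sums. The mirrored product has its factors in reverse order,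
  which accounts for its sign.\<close>

lemma Xbracket:
  fixes n :: nat and M P :: "nat \<Rightarrow> nat \<Rightarrow> 'a::field matr"
  defines "M \<equiv> Xminus n" and "P \<equiv> Xplus n"
  assumes "1 \<le> i" "i < k" "k < j" "j \<le> n"
  shows "bracket n (M i k) (M k j) + bracket n (P i k) (P k j) = mscale 2 (M i j)"
    and "bracket n (P i k) (M k j) + bracket n (M i k) (P k j) = mscale 2 (P i j)"
proof -
  let ?a = "munit i k :: 'a matr" and ?b = "munit k j :: 'a matr"
  let ?a' = "munit (n + 1 - k) (n + 1 - i) :: 'a matr" and ?b' = "munit (n + 1 - j) (n + 1 - k) :: 'a matr"
  have ab: "bracket n ?a ?b = munit i j" using assms by (intro bracket_munit_munit) auto
  have "bracket n ?b' ?a' = munit (n + 1 - j) (n + 1 - i)" using assms by (intro bracket_munit_munit) auto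
  then have ab': "bracket n ?a' ?b' = - munit (n + 1 - j) (n + 1 - i)" using bracket_anticomm[of n ?a' ?b'] by simp
  show "bracket n (M i k) (M k j) + bracket n (P i k) (P k j) = mscale 2 (M i j)"
    unfolding M_def P_def Xminus_def Xplus_def bracket_add_left bracket_add_right bracket_diff_left bracket_diff_right ab ab'
    by (intro ext, simp only: plus_fun_apply matr_diff_apply uminus_apply mscale_apply, algebra)
  show "bracket n (P i k) (M k j) + bracket n (M i k) (P k j) = mscale 2 (P i j)"
    unfolding M_def P_def Xminus_def Xplus_def bracket_add_left bracket_add_right bracket_diff_left bracket_diff_right ab ab'
    by (intro ext, simp only: plus_fun_apply matr_diff_apply uminus_apply mscale_apply, algebra)
qed

section \<open>Degrees of all X vectors and commutation of the parameters\<close>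

context adapted_flip
begin

lemma gg_mult: "h \<in> carrier G \<Longrightarrow> g \<otimes> (g \<otimes> h) = h"
  using gG gg by (simp add: m_assoc[symmetric])

text \<open>Here \<open>Suc i\<close> is the middle root, where Xplus is twice a matrix unit. The
  nonzero brackets with both vectors at its left neighbour serve \<open>g_commute\<close>.\<close>

lemma Xbracket_entry:
  assumes i: "1 \<le> i" "Suc (Suc i) \<le> n" and n: "2 * i + 2 = n"
  shows "bracket n (Xminus n i (Suc i)) (Xplus n (Suc i) (Suc (Suc i))) \<noteq> (0 :: 'f matr)"
    and "bracket n (Xplus n i (Suc i)) (Xplus n (Suc i) (Suc (Suc i))) \<noteq> (0 :: 'f matr)"
proof -
  have U: "Xplus n (Suc i) (Suc (Suc i)) = mscale 2 (munit (Suc i) (Suc (Suc i)) :: 'f matr)" if "2 * i + 2 = n"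
  proof -
    have "n + 1 - Suc (Suc i) = Suc i" "n + 1 - Suc i = Suc (Suc i)" using that by auto
    then show ?thesis unfolding Xplus_def by (intro ext) (simp only: mscale_apply plus_fun_apply mult_2)
  qed
  have e: "bracket n (munit (Suc i) (Suc (Suc i))) (Xminus n i (Suc i)) i (Suc (Suc i)) = (-1 :: 'f)"
    "bracket n (munit (Suc i) (Suc (Suc i))) (Xplus n i (Suc i)) i (Suc (Suc i)) = (-1 :: 'f)" if "2 * i + 2 = n"
    using that i by (auto simp: bracket_munit) (auto simp: Xminus_def Xplus_def munit_def)
  have ne: "bracket n y (mscale 2 x) \<noteq> 0" if "bracket n x y p q = - 1" for x y :: "'f matr" and p q
  proof
    assume "bracket n y (mscale 2 x) = 0"
    then have "2 * bracket n y x p q = 0" unfolding bracket_scale_right by (metis mscale_apply zero_fun_apply)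
    then have "bracket n y x p q = 0" using two by simp
    then show False using that bracket_anticomm[of n x y] by simp
  qed
  show "bracket n (Xminus n i (Suc i)) (Xplus n (Suc i) (Suc (Suc i)) :: 'f matr) \<noteq> 0"
    "bracket n (Xplus n i (Suc i)) (Xplus n (Suc i) (Suc (Suc i)) :: 'f matr) \<noteq> 0"
    unfolding U[OF n] by (rule ne[OF e(1)[OF n]], rule ne[OF e(2)[OF n]])
qed

text \<open>Off the middle root the symmetric diagonal matrix \<open>Xplus n i i\<close> has degree
  g and brackets nontrivially with Xminus of degree \<open>\<eta> i\<close>; the root value is 1 or
  2.\<close>

lemma g_commute: assumes i: "1 \<le> i" "i < n" shows "g \<otimes> \<eta> i = \<eta> i \<otimes> g"
proof (cases "2 * i = n")
  case False
  have D: "Xplus n i i \<in> (Diag n :: 'f matr set)" using i by (intro Xplus_Diag) auto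
  have U: "Xminus n i (Suc i) \<in> (UT n :: 'f matr set)" using i by (intro Xminus_UT) auto
  have "Xplus n i i i i - Xplus n i i (Suc i) (Suc i) = (if i = n + 1 - i then 2 else 1 :: 'f)"
    using i False by (auto simp: Xplus_diag_entry)
  moreover have "Xminus n i (Suc i) i (Suc i) = (1::'f)"
    using i False by (auto simp: Xminus_def munit_def)
  ultimately have "bracket n (Xplus n i i) (Xminus n i (Suc i)) i (Suc i) \<noteq> (0 :: 'f)"
    using two by (simp add: bracket_Diag[OF D U])
  then have "bracket n (Xplus n i i) (Xminus n i (Suc i)) \<noteq> (0 :: 'f matr)" by auto
  then show ?thesis
    using deg_commute_Az[OF Xplus_diag Xminus_simple gG eta_closed] i by simp
next
  case True
  \<comment> \<open>At the middle root Xminus is 0, so the left neighbour is used, which exists as n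
    is at least 3. The degree \<open>g \<otimes> \<eta> i\<close> commutes with
    \<open>\<eta> k\<close> and \<open>g \<otimes> \<eta> k\<close>, hence with g.\<close>
  define k where "k = i - 1"
  have k: "i = Suc k" "1 \<le> k" "2 * k + 2 = n" using True n3 by (auto simp: k_def)
  let ?p = "\<eta> k" and ?q = "g \<otimes> \<eta> i"
  have G: "?p \<in> carrier G" "?q \<in> carrier G" "\<eta> i \<in> carrier G" using eta_closed[of k] eta_closed[of i] gG i k by auto
  have X: "Xminus n k (Suc k) \<in> A ?p" "Xplus n k (Suc k) \<in> A (g \<otimes> ?p)" "Xplus n i (Suc i) \<in> A ?q"
    using Xminus_simple[of k] Xplus_simple[of k] Xplus_simple[of i] i k by auto
  have "?p \<otimes> ?q = ?q \<otimes> ?p"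
    using Xbracket_entry(1)[of k] k i by (intro deg_commute[OF X(1,3) G(1,2)]) auto
  moreover have "(g \<otimes> ?p) \<otimes> ?q = ?q \<otimes> (g \<otimes> ?p)"
    using Xbracket_entry(2)[of k] k i G gG by (intro deg_commute[OF X(2,3)]) auto
  ultimately have "?q \<otimes> g = g \<otimes> ?q" using G gG by (intro commute_cancel_left[of ?q g ?p]) auto
  then have "(g \<otimes> \<eta> i) \<otimes> g = g \<otimes> (g \<otimes> \<eta> i)" .
  then have "g \<otimes> (\<eta> i \<otimes> g) = g \<otimes> (g \<otimes> \<eta> i)" using G gG by (simp add: m_assoc)
  then show ?thesis using G gG by simp
qed

lemma seg_closed: "1 \<le> i \<Longrightarrow> j \<le> n \<Longrightarrow> seg_prod G \<eta> i j \<in> carrier G"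
  using eta_closed by (intro seg_prod_closed) auto

lemma g_seg: "1 \<le> i \<Longrightarrow> j \<le> n \<Longrightarrow> g \<otimes> seg_prod G \<eta> i j = seg_prod G \<eta> i j \<otimes> g"
  using eta_closed g_commute gG by (intro seg_prod_commute) auto

lemma X_upper:
  assumes "1 \<le> i" "i < j" "j \<le> n"
  shows "Xminus n i j \<in> A (seg_prod G \<eta> i j) \<and> Xplus n i j \<in> A (g \<otimes> seg_prod G \<eta> i j)"
  using assms
proof (induct "j - i" arbitrary: i)
  case (Suc d)
  note ij = Suc.prems
  show ?case
  proof (cases "j = Suc i")
    case True
    then have "seg_prod G \<eta> i j = \<eta> i" using eta_closed[of i] ij by (simp add: seg_prod_Cons seg_prod_refl)
    then show ?thesis using Xminus_simple[of i] Xplus_simple[of i] ij True by simp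
  next
    case False
    let ?k = "Suc i" let ?s = "seg_prod G \<eta> ?k j" let ?t = "seg_prod G \<eta> i j"
    have k: "1 \<le> i" "i < ?k" "?k < j" "j \<le> n" using ij False by auto
    have IH: "Xminus n ?k j \<in> A ?s" "Xplus n ?k j \<in> A (g \<otimes> ?s)"
      using Suc.hyps(1)[of ?k] Suc.hyps(2) k by auto
    have G: "\<eta> i \<in> carrier G" "?s \<in> carrier G" "?t \<in> carrier G"
      using eta_closed[of i] seg_closed k by auto
    have X: "Xminus n i ?k \<in> A (\<eta> i)" "Xplus n i ?k \<in> A (g \<otimes> \<eta> i)" using Xminus_simple Xplus_simple k by auto
    have t: "?t = \<eta> i \<otimes> ?s" using ij by (intro seg_prod_Cons)
    have c: "g \<otimes> \<eta> i = \<eta> i \<otimes> g" using g_commute k by simp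
    have t1: "(g \<otimes> \<eta> i) \<otimes> (g \<otimes> ?s) = ?t"
      unfolding t c using G gG gg_mult[OF G(2)] by (simp add: m_assoc)
    have t2: "(g \<otimes> \<eta> i) \<otimes> ?s = g \<otimes> ?t" "\<eta> i \<otimes> (g \<otimes> ?s) = g \<otimes> ?t"
    proof -
      show "(g \<otimes> \<eta> i) \<otimes> ?s = g \<otimes> ?t" unfolding t using G gG by (simp add: m_assoc)
      then show "\<eta> i \<otimes> (g \<otimes> ?s) = g \<otimes> ?t" unfolding c using G gG by (simp add: m_assoc)
    qed
    have gs: "g \<otimes> ?s \<in> carrier G" "g \<otimes> \<eta> i \<in> carrier G" "g \<otimes> ?t \<in> carrier G" using G gG by auto
    have half: "x \<in> A h" if "mscale 2 x \<in> A h" "h \<in> carrier G" for x h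
      using matr.subspace_scale[OF A_subspace[OF that(2)] that(1), of "inverse 2"] two by (simp add: matr.scale_scale)
    have "mscale 2 (Xminus n i j) \<in> A ?t" unfolding Xbracket(1)[OF k, symmetric]
      using A_bracket[OF G(1,2) X(1) IH(1)] A_bracket[OF gs(2,1) X(2) IH(2)] unfolding t1 t[symmetric]
      by (rule matr.subspace_add[OF A_subspace[OF G(3)]])
    moreover have "mscale 2 (Xplus n i j) \<in> A (g \<otimes> ?t)" unfolding Xbracket(2)[OF k, symmetric]
      using A_bracket[OF gs(2) G(2) X(2) IH(1)] A_bracket[OF G(1) gs(1) X(1) IH(2)] unfolding t2
      by (rule matr.subspace_add[OF A_subspace[OF gs(3)]])
    ultimately show ?thesis using half G(3) gs(3) by blast
  qed
qed simp

text \<open>If the two degrees did not commute, neither would they after multiplication by g. Then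
  all four brackets of X vectors vanish by \<open>deg_commute\<close>, and \<open>Xbracket\<close>
  gives Xminus = Xplus = 0 for the next root, whose sum at (i, j + 1) is 2.\<close>

lemma flip_params: "elem_params G n \<eta>"
proof (rule elem_paramsI)
  fix i j assume ij: "1 \<le> i" "i < j" "j < n"
  let ?s = "seg_prod G \<eta> i j"
  have G: "?s \<in> carrier G" "\<eta> j \<in> carrier G" using seg_closed[of i j] eta_closed[of j] ij by auto
  have gs: "g \<otimes> ?s = ?s \<otimes> g" "g \<otimes> \<eta> j = \<eta> j \<otimes> g" using g_seg[of i j] g_commute[of j] ij by auto
  have X: "Xminus n i j \<in> A ?s" "Xplus n i j \<in> A (g \<otimes> ?s)" using X_upper[of i j] ij by auto
  have Y: "Xminus n j (Suc j) \<in> A (\<eta> j)" "Xplus n j (Suc j) \<in> A (g \<otimes> \<eta> j)"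
    using Xminus_simple[of j] Xplus_simple[of j] ij by auto
  have k: "1 \<le> i" "i < j" "j < Suc j" "Suc j \<le> n" using ij by auto
  have b1: "b \<otimes> a = a \<otimes> b" if "(g \<otimes> a) \<otimes> b = b \<otimes> (g \<otimes> a)" "g \<otimes> a = a \<otimes> g" "g \<otimes> b = b \<otimes> g"
    "a \<in> carrier G" "b \<in> carrier G" for a b
    using that gG by (intro commute_cancel_left[of b a g]) auto
  have gb: "g \<otimes> (g \<otimes> a) = (g \<otimes> a) \<otimes> g" if "g \<otimes> a = a \<otimes> g" "a \<in> carrier G" for a
    using that gG by (metis m_assoc)
  show "?s \<otimes> \<eta> j = \<eta> j \<otimes> ?s"
  proof (rule ccontr)
    assume ne: "?s \<otimes> \<eta> j \<noteq> \<eta> j \<otimes> ?s"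
    have ne2: "(g \<otimes> ?s) \<otimes> \<eta> j \<noteq> \<eta> j \<otimes> (g \<otimes> ?s)" using b1[of ?s "\<eta> j"] ne gs G by metis
    have ne3: "?s \<otimes> (g \<otimes> \<eta> j) \<noteq> (g \<otimes> \<eta> j) \<otimes> ?s" using b1[of "\<eta> j" ?s] ne gs G by metis
    have ne4: "(g \<otimes> ?s) \<otimes> (g \<otimes> \<eta> j) \<noteq> (g \<otimes> \<eta> j) \<otimes> (g \<otimes> ?s)"
      using b1[of ?s "g \<otimes> \<eta> j"] ne3 gs gb[OF gs(2)] G gG by (metis m_closed)
    have "bracket n (Xminus n i j) (Xminus n j (Suc j)) = (0 :: 'f matr)" using deg_commute[OF X(1) Y(1) G] ne by blast
    moreover have "bracket n (Xplus n i j) (Xminus n j (Suc j)) = (0 :: 'f matr)"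
      using deg_commute[OF X(2) Y(1) _ G(2)] ne2 G gG by blast
    moreover have "bracket n (Xminus n i j) (Xplus n j (Suc j)) = (0 :: 'f matr)"
      using deg_commute[OF X(1) Y(2) G(1)] ne3 G gG by blast
    moreover have "bracket n (Xplus n i j) (Xplus n j (Suc j)) = (0 :: 'f matr)"
      using deg_commute[OF X(2) Y(2)] ne4 G gG by blast
    ultimately have "mscale 2 (Xminus n i (Suc j)) = (0 :: 'f matr)" "mscale 2 (Xplus n i (Suc j)) = (0 :: 'f matr)"
      using Xbracket[OF k, where 'a = 'f] by simp_all
    then have "Xminus n i (Suc j) = (0 :: 'f matr)" "Xplus n i (Suc j) = (0 :: 'f matr)"
      using two by simp_all
    then have "Xminus n i (Suc j) i (Suc j) + Xplus n i (Suc j) i (Suc j) = (0 :: 'f)" by simp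
    moreover have "(x - y) + (x + y) = 2 * x" for x y :: 'f by algebra
    ultimately have "2 * munit i (Suc j) i (Suc j) = (0 :: 'f)"
      by (simp only: Xminus_def Xplus_def matr_diff_apply plus_fun_apply)
    then show False using two by (simp add: munit_def)
  qed
qed (use eta_closed in blast)

end

lemma two_nonzero_iff: "(2::'f::field) \<noteq> 0 \<longleftrightarrow> CHAR('f) \<noteq> 2"
proof -
  have "(2::'f) = 0 \<longleftrightarrow> CHAR('f) dvd 2" using of_nat_eq_0_iff_char_dvd[of 2, where 'a = 'f] by simp
  also have "\<dots> \<longleftrightarrow> CHAR('f) = 2"
    using CHAR_not_1[where 'a = 'f] prime_nat_iff[of 2] two_is_prime_nat by auto
  finally show ?thesis by simp
qed

section \<open>Comparing gradings modulo the centre\<close>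

lemma mod_centre_eq: assumes "x - y \<in> centre n" shows "mod_centre n x = mod_centre n y"
proof -
  have "mod_centre n x \<subseteq> mod_centre n y" if d: "x - y \<in> centre n" for x y :: "'a matr"
  proof
    fix w assume "w \<in> mod_centre n x"
    then obtain z where z: "z \<in> centre n" "w = x + z" by (auto simp: mod_centre_def)
    have "w = y + ((x - y) + z)" using z by simp
    moreover have "(x - y) + z \<in> centre n" using d z matr.subspace_add[OF subspace_centre] by blast
    ultimately show "w \<in> mod_centre n y" unfolding mod_centre_def by blast
  qed
  moreover have "y - x \<in> centre n" using matr.subspace_neg[OF subspace_centre assms] by simp
  ultimately show ?thesis using assms by blast
qed

lemma mod_centre_self: "x \<in> mod_centre n x"
  unfolding mod_centre_def using matr.subspace_0[OF subspace_centre, of n] by (auto intro!: exI[of _ 0])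

lemma lie_auto_centre_rev:
  assumes f: "lie_auto n f" and x: "x \<in> UT n" and z: "f x \<in> centre n" shows "x \<in> centre n"
proof -
  have "bracket n x y = 0" if y: "y \<in> UT n" for y
  proof -
    have "f (bracket n x y) = bracket n (f x) (f y)" using lie_auto_bracket[OF f x y] .
    also have "\<dots> = 0" using bracket_centre_left[OF z lie_auto_UT[OF f y]] .
    finally have "f (bracket n x y) = f 0" using lie_auto_0[OF f] by simp
    then show ?thesis
      using bij_betw_imp_inj_on[OF lie_auto_bij[OF f]] bracket_UT[OF x y] matr.subspace_0[OF subspace_UT]
      by (metis inj_onD)
  qed
  then show ?thesis using x by (simp add: centre_def)
qed

lemma lie_auto_mod_centre:
  assumes f: "lie_auto n f" and x: "x \<in> UT n" shows "f ` mod_centre n x = mod_centre n (f x)"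
proof
  show "f ` mod_centre n x \<subseteq> mod_centre n (f x)"
  proof
    fix w assume "w \<in> f ` mod_centre n x"
    then obtain z where z: "z \<in> centre n" "w = f (x + z)" by (auto simp: mod_centre_def)
    then have "w = f x + f z" using lie_auto_add[OF f x] centre_subset_UT by blast
    then show "w \<in> mod_centre n (f x)" using lie_auto_centre[OF f z(1)] unfolding mod_centre_def by blast
  qed
  show "mod_centre n (f x) \<subseteq> f ` mod_centre n x"
  proof
    fix w assume "w \<in> mod_centre n (f x)"
    then obtain z where z: "z \<in> centre n" "w = f x + z" by (auto simp: mod_centre_def)
    have zU: "z \<in> UT n" using z(1) centre_subset_UT by blast
    obtain y where y: "y \<in> UT n" "z = f y" by (rule lie_auto_surj[OF f zU])
    have "y \<in> centre n" using lie_auto_centre_rev[OF f y(1)] z(1) y(2) by simp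
    moreover have "w = f (x + y)" using z y lie_auto_add[OF f x y(1)] by simp
    ultimately show "w \<in> f ` mod_centre n x" unfolding mod_centre_def by blast
  qed
qed

lemma (in graded_UT) A_spans: "UT n \<subseteq> matr.span (\<Union>h\<in>carrier G. A h)"
proof
  fix x :: "'f matr" assume x: "x \<in> UT n"
  show "x \<in> matr.span (\<Union>h\<in>carrier G. A h)"
    by (rule hcomp_mem[OF x matr.subspace_span]) (use hcomp_in x in \<open>blast intro: matr.span_base\<close>)
qed

lemma (in graded_UT) pract_graded_isoI:
  assumes B: "is_grading G n B" and f: "lie_auto n f"
    and AB: "\<And>h a. h \<in> carrier G \<Longrightarrow> a \<in> A h \<Longrightarrow> \<exists>b\<in>B h. f a - b \<in> centre n"
  shows "pract_graded_iso G n A B"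
proof -
  have "(\<lambda>C. f ` C) ` (mod_centre n ` A h) \<subseteq> mod_centre n ` B h" if h: "h \<in> carrier G" for h
  proof
    fix D assume "D \<in> (\<lambda>C. f ` C) ` (mod_centre n ` A h)"
    then obtain a where a: "a \<in> A h" "D = f ` mod_centre n a" by blast
    obtain b where b: "b \<in> B h" "f a - b \<in> centre n" using AB[OF h a(1)] by blast
    have "D = mod_centre n b"
      using a lie_auto_mod_centre[OF f A_UT[OF h a(1)]] mod_centre_eq[OF b(2)] by simp
    then show "D \<in> mod_centre n ` B h" using b(1) by blast
  qed
  then show ?thesis unfolding pract_graded_iso_def using grading B f by blast
qed

text \<open>The definition puts the image of \<open>A h\<close> into B h plus the centre. As the
  images span, \<open>spanning_in_Az\<close> for the grading B reverses this, so B h lies in the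
  image of \<open>A h\<close> plus the centre.\<close>

lemma (in graded_UT) pract_graded_isoD:
  assumes P: "pract_graded_iso G n A B"
  shows "\<exists>f. lie_auto n f \<and> (\<forall>h\<in>carrier G. \<forall>a\<in>A h. \<exists>b\<in>B h. f a - b \<in> centre n) \<and>
    (\<forall>h\<in>carrier G. B h \<subseteq> graded_UT.Az G n (\<lambda>g. f ` A g) h)"
proof -
  note P' = P[unfolded pract_graded_iso_def, THEN conjunct2]
  have B: "is_grading G n B" by (rule P'[THEN conjunct1])
  obtain f where f: "lie_auto n f"
    "\<forall>h\<in>carrier G. (\<lambda>C. f ` C) ` (mod_centre n ` A h) \<subseteq> mod_centre n ` B h"
    using P'[THEN conjunct2] by (elim exE conjE)
  interpret B: graded_UT G n B by unfold_locales (use n_pos B in auto)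
  interpret C: graded_UT G n "\<lambda>g. f ` A g" by (rule grading_image[OF f(1)])
  have 1: "\<exists>b\<in>B h. f a - b \<in> centre n" if h: "h \<in> carrier G" and a: "a \<in> A h" for h a
  proof -
    have "f ` mod_centre n a \<in> mod_centre n ` B h" using bspec[OF f(2) h] a by blast
    then obtain b where b: "b \<in> B h" "f ` mod_centre n a = mod_centre n b" by blast
    have "f a \<in> mod_centre n b" using mod_centre_self[of a n] b(2) by blast
    then obtain z where "z \<in> centre n" "f a = b + z" by (auto simp: mod_centre_def)
    then show ?thesis using b(1) by (intro bexI[of _ b]) simp_all
  qed
  have "B h \<subseteq> C.Az h" if h: "h \<in> carrier G" for h
  proof
    fix b assume b: "b \<in> B h"
    have "\<exists>c\<in>f ` A h. b - c \<in> centre n"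
    proof (rule B.spanning_in_Az)
      show "matr.subspace (f ` A k)" if "k \<in> carrier G" for k using C.A_subspace[OF that] .
      show "f ` A k \<subseteq> B.Az k" if k: "k \<in> carrier G" for k
      proof
        fix c assume "c \<in> f ` A k"
        then obtain a where a: "a \<in> A k" "c = f a" by blast
        obtain b where b: "b \<in> B k" "f a - b \<in> centre n" using 1[OF k a(1)] by blast
        have "b + (f a - b) \<in> B.Az k"
          using B.A_subset_Az[OF k] B.centre_subset_Az b by (intro matr.subspace_add[OF B.subspace_Az]) blast+
        then show "c \<in> B.Az k" using a(2) by simp
      qed
      show "UT n \<subseteq> matr.span (\<Union>h\<in>carrier G. f ` A h)" by (rule C.A_spans)
      show "b \<in> B.Az h" "h \<in> carrier G" using B.A_subset_Az[OF h] b h by blast+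
    qed
    then obtain c where c: "c \<in> f ` A h" "b - c \<in> centre n" by blast
    have "c + (b - c) \<in> C.Az h"
      using C.A_subset_Az[OF h] C.centre_subset_Az c by (intro matr.subspace_add[OF C.subspace_Az]) blast+
    then show "b \<in> C.Az h" by simp
  qed
  then show ?thesis using f(1) 1 by blast
qed

lemma (in graded_UT) ident_image:
  assumes f: "lie_auto n f" and t: "t \<in> carrier G" "ident n \<in> A t" shows "ident n \<in> f ` A t"
proof -
  interpret C: graded_UT G n "\<lambda>g. f ` A g" by (rule grading_image[OF f])
  have "mscale 1 (ident n) \<in> centre n" by (rule scalar_centre)
  then have I: "(ident n :: 'f matr) \<in> centre n" by simp
  obtain c where c: "f (ident n) = mscale c (ident n)"
    using lie_auto_centre[OF f I] n_pos by (auto simp: centre_eq)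
  have "c \<noteq> 0"
  proof
    assume "c = 0"
    then have "f (ident n) = f 0" using c lie_auto_0[OF f] by simp
    then have "ident n = (0 :: 'f matr)"
      using bij_betw_imp_inj_on[OF lie_auto_bij[OF f]] ident_UT UT_closed(1) by (metis inj_onD)
    then show False using ident_nonzero[OF n_pos] by blast
  qed
  then have "ident n = mscale (inverse c) (f (ident n))" unfolding c by (simp add: matr.scale_scale)
  also have "\<dots> \<in> f ` A t" using t matr.subspace_scale[OF C.A_subspace[OF t(1)]] by blast
  finally show ?thesis .
qed

lemma (in graded_UT) Az_ident: assumes t: "t \<in> carrier G" "ident n \<in> A t" shows "Az t \<subseteq> A t"
proof
  fix x assume "x \<in> Az t"
  then obtain a z where az: "a \<in> A t" "z \<in> centre n" "x = a + z" using Az_E t(1) by blast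
  then obtain c where "z = mscale c (ident n)" using n_pos by (auto simp: centre_eq)
  then show "x \<in> A t" using az t subspace_closed(1,3)[OF A_subspace[OF t(1)]] by simp
qed

lemma (in graded_UT) scalar_deg:
  assumes "t \<in> carrier G" "ident n \<in> A t" "h \<in> carrier G" "h \<noteq> t" "mscale c (ident n) \<in> A h"
  shows "c = 0"
proof (rule ccontr)
  assume "c \<noteq> 0"
  then have "mscale (inverse c) (mscale c (ident n)) = (ident n :: 'f matr)" by (simp add: matr.scale_scale)
  then have "ident n \<in> A h" using matr.subspace_scale[OF A_subspace[OF assms(3)] assms(5), of "inverse c"] by simp
  then show False using deg_unique assms ident_nonzero[OF n_pos] by blast
qed

subsection \<open>Elementary gradings\<close>

context group
begin

lemma elem_params_seg_closed:
  "elem_params G n \<eta> \<Longrightarrow> 1 \<le> i \<Longrightarrow> j \<le> n \<Longrightarrow> seg_prod G \<eta> i j \<in> carrier G"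
  by (intro seg_prod_closed) (auto simp: elem_params_def)

lemma elem_params_seg_commute:
  assumes P: "elem_params G n \<eta>" and ij: "1 \<le> i" "j \<le> n" and kl: "1 \<le> k" "l \<le> n"
  shows "seg_prod G \<eta> i j \<otimes> seg_prod G \<eta> k l = seg_prod G \<eta> k l \<otimes> seg_prod G \<eta> i j"
proof (rule seg_prod_commute)
  fix m assume m: "k \<le> m" "m < l"
  have "\<eta> m \<otimes> seg_prod G \<eta> i j = seg_prod G \<eta> i j \<otimes> \<eta> m"
    using P m ij kl by (intro seg_prod_commute) (auto simp: elem_params_def)
  then show "\<eta> m \<in> carrier G \<and> seg_prod G \<eta> i j \<otimes> \<eta> m = \<eta> m \<otimes> seg_prod G \<eta> i j"
    using P m kl by (auto simp: elem_params_def)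
qed (rule elem_params_seg_closed[OF P ij])

end

lemma munit_gamma1: "1 \<le> i \<Longrightarrow> i \<le> j \<Longrightarrow> j \<le> n \<Longrightarrow> munit i j \<in> gamma1 G n \<eta> (seg_prod G \<eta> i j)"
  unfolding gamma1_def by (intro matr.span_base) blast

lemma gamma1_spans:
  assumes "group G" "elem_params G n \<eta>"
  shows "UT n \<subseteq> matr.span (\<Union>h\<in>carrier G. gamma1 G n \<eta> h :: 'f::field matr set)"
    and "Fil n 1 \<subseteq> matr.span (\<Union>h\<in>carrier G. gamma1 G n \<eta> h \<inter> Fil n 1 :: 'f matr set)"
proof -
  interpret group G by fact
  have cl: "seg_prod G \<eta> i j \<in> carrier G" if "1 \<le> i" "j \<le> n" for i j
    using elem_params_seg_closed[OF assms(2) that] .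
  show "UT n \<subseteq> matr.span (\<Union>h\<in>carrier G. gamma1 G n \<eta> h :: 'f matr set)"
    by (intro UT_subset_subspace matr.subspace_span matr.span_base) (rule UN_I[where B = "gamma1 G n \<eta>", OF cl munit_gamma1])
  have "munit i j \<in> matr.span (\<Union>h\<in>carrier G. gamma1 G n \<eta> h \<inter> Fil n 1 :: 'f matr set)"
    if ij: "1 \<le> i" "i \<le> j" "i + 1 \<le> j" "j \<le> n" for i j
  proof (rule matr.span_base)
    have "munit i j \<in> (gamma1 G n \<eta> (seg_prod G \<eta> i j) \<inter> Fil n 1 :: 'f matr set)"
      using munit_gamma1 munit_Fil ij by blast
    then show "munit i j \<in> (\<Union>h\<in>carrier G. gamma1 G n \<eta> h \<inter> Fil n 1 :: 'f matr set)"
      by (rule UN_I[OF cl[OF ij(1,4)]])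
  qed
  then show "Fil n 1 \<subseteq> matr.span (\<Union>h\<in>carrier G. gamma1 G n \<eta> h \<inter> Fil n 1 :: 'f matr set)"
    by (intro Fil_subset_subspace matr.subspace_span)
qed

context graded_UT
begin

text \<open>The automorphism and the degrees of the matrix units are exported together with the
  practical isomorphism, because the two by two case builds its type 2 gradings from them.\<close>

lemma trivial_elementary:
  assumes T: trivial_torus
  shows "\<exists>f \<eta>. lie_auto n f \<and> elem_params G n \<eta> \<and> Diag n \<subseteq> graded_UT.Az G n (\<lambda>g. f ` A g) \<one> \<and>
    (\<forall>i j. 1 \<le> i \<longrightarrow> i < j \<longrightarrow> j \<le> n \<longrightarrow> munit i j \<in> f ` A (seg_prod G \<eta> i j)) \<and>
    pract_iso_elementary G n A \<eta>"
proof -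
  obtain f where f: "lie_auto n f" and D: "Diag n \<subseteq> graded_UT.Az G n (\<lambda>g. f ` A g) \<one>"
    using trivial_form[OF T] by blast
  interpret C: graded_UT G n "\<lambda>g. f ` A g" by (rule grading_image[OF f])
  obtain \<eta> where \<eta>: "elem_params G n \<eta>"
    "\<And>i j. 1 \<le> i \<Longrightarrow> i < j \<Longrightarrow> j \<le> n \<Longrightarrow> munit i j \<in> f ` A (seg_prod G \<eta> i j)"
    using C.elementary_params[OF D] by blast
  let ?B = "gamma1 G n \<eta> :: 'g \<Rightarrow> 'f matr set"
  have sub: "matr.subspace (?B h)" for h by (simp add: gamma1_def)
  have BAz: "?B h \<subseteq> C.Az h" if h: "h \<in> carrier G" for h
    unfolding gamma1_def
  proof (rule matr.span_minimal[OF _ C.subspace_Az], clarify)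
    fix i j assume ij: "1 \<le> i" "i \<le> j" "j \<le> n" and h: "h = seg_prod G \<eta> i j"
    show "munit i j \<in> C.Az (seg_prod G \<eta> i j)"
    proof (cases "i = j")
      case True then show ?thesis using D munit_Diag[of i n] ij by (auto simp: seg_prod_refl)
    next
      case False
      then show ?thesis
        using \<eta>(2)[of i j] ij C.A_subset_Az[OF elem_params_seg_closed[OF \<eta>(1), of i j]] by auto
    qed
  qed
  \<comment> \<open>In the elementary grading scalars occur in degree 1 only: the other components
    are strictly upper triangular.\<close>
  have "?B h \<inter> centre n \<subseteq> {0}" if h: "h \<in> carrier G" "h \<noteq> \<one>" for h
  proof -
    have "?B h \<subseteq> Fil n 1" unfolding gamma1_def
    proof (rule matr.span_minimal[OF _ subspace_Fil], clarify)
      fix i j assume ij: "1 \<le> i" "i \<le> j" "j \<le> n" and "h = seg_prod G \<eta> i j"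
      then have "i \<noteq> j" using h by (auto simp: seg_prod_refl)
      then show "munit i j \<in> Fil n 1" using ij by (intro munit_Fil) auto
    qed
    then show ?thesis using centre_Fil1 n_pos by blast
  qed
  then have B: "is_grading G n ?B"
    using C.grading_from_Az[OF sub BAz gamma1_spans[OF group_axioms \<eta>(1)]] by blast
  have "\<exists>b\<in>?B h. f a - b \<in> centre n" if "h \<in> carrier G" "a \<in> A h" for h a
    using C.spanning_in_Az[OF sub BAz gamma1_spans(1)[OF group_axioms \<eta>(1)], of "f a" h]
      C.A_subset_Az that by blast
  then have "pract_graded_iso G n A ?B" using pract_graded_isoI[OF B f] by blast
  then show ?thesis using f D \<eta> unfolding pract_iso_elementary_def by blast
qed

text \<open>Strictly upper matrix units have exact degrees by \<open>Az_Fil1\<close>; only the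
  diagonal needs a choice. Once V has degree 1, the practical elementary grading lies inside the
  transported one and spans, so the two agree.\<close>

lemma elementary_graded_iso:
  assumes P: "pract_iso_elementary G n A \<eta>" and t: "t \<in> carrier G" "ident n \<in> A t"
  shows "is_pract_elementary G n A t \<eta>"
proof -
  let ?B = "gamma1 G n \<eta> :: 'g \<Rightarrow> 'f matr set"
  have \<eta>: "elem_params G n \<eta>" and iso: "pract_graded_iso G n A ?B"
    using P unfolding pract_iso_elementary_def by auto
  obtain f where f: "lie_auto n f" and BAz: "\<And>h. h \<in> carrier G \<Longrightarrow> ?B h \<subseteq> graded_UT.Az G n (\<lambda>g. f ` A g) h"
    using pract_graded_isoD[OF iso] by blast
  interpret C: graded_UT G n "\<lambda>g. f ` A g" by (rule grading_image[OF f])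
  have tC: "ident n \<in> f ` A t" using ident_image[OF f t] .
  have cl: "seg_prod G \<eta> i j \<in> carrier G" if "1 \<le> i" "j \<le> n" for i j
    using elem_params_seg_closed[OF \<eta> that] .
  have e: "munit i j \<in> f ` A (seg_prod G \<eta> i j)" if ij: "1 \<le> i" "i < j" "j \<le> n" for i j
    by (rule C.Az_Fil1[OF _ munit_Fil])
      (use ij BAz[OF cl, of i j] munit_gamma1[of i j n G \<eta>] cl[of i j] in auto)
  have d: "Diag n \<subseteq> C.Az \<one>"
  proof (rule Diag_subset_subspace[OF C.subspace_Az])
    fix i assume "1 \<le> i" "i \<le> n"
    then show "munit i i \<in> C.Az \<one>"
      using munit_gamma1[of i i n G \<eta>] BAz[OF one_closed] by (auto simp: seg_prod_refl)
  qed
  \<comment> \<open>For t = 1 all diagonal matrices have degree 1 and any complement of the scalars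
    will do. Otherwise the diagonal matrices of exact degree 1 are taken; they contain no nonzero
    scalar, since scalars have degree t.\<close>
  define V :: "'f matr set" where "V = (if t = \<one> then {x \<in> Diag n. x n n = 0} else Diag n \<inter> f ` A \<one>)"
  have V: "matr.subspace V" "V \<subseteq> f ` A \<one>" "V \<subseteq> Diag n"
  proof -
    have "matr.subspace {x :: 'f matr. x \<in> Diag n \<and> x n n = 0}"
      by (intro matr.subspaceI) (simp_all add: subspace_closed[OF subspace_Diag])
    then show "matr.subspace V"
      using matr.subspace_inter[OF subspace_Diag C.A_subspace[OF one_closed]] by (simp add: V_def)
    show "V \<subseteq> f ` A \<one>" using d C.Az_ident[OF t(1) tC] by (auto simp: V_def)
    show "V \<subseteq> Diag n" by (auto simp: V_def)
  qed
  have I: "mscale c (ident n) \<in> (Diag n :: 'f matr set)" for c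
    using subspace_closed(3)[OF subspace_Diag ident_Diag] .
  have V0: "c = 0" if "mscale c (ident n) \<in> V" for c
    using that n_pos C.scalar_deg[OF t(1) tC one_closed] by (auto simp: V_def ident_apply split: if_splits)
  have split: "\<exists>v\<in>V. \<exists>c. x = v + mscale c (ident n)" if x: "x \<in> Diag n" for x
  proof (cases "t = \<one>")
    case True
    have "x - mscale (x n n) (ident n) \<in> Diag n" using x I by (rule matr.subspace_diff[OF subspace_Diag])
    then have "x - mscale (x n n) (ident n) \<in> V" using True n_pos by (simp add: V_def ident_apply)
    then show ?thesis by (intro bexI[of _ "x - mscale (x n n) (ident n)"] exI[of _ "x n n"]) simp_all
  next
    case False
    obtain a z where az: "a \<in> f ` A \<one>" "z \<in> centre n" "x = a + z" using C.Az_E[of x \<one>] d x by blast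
    obtain c where c: "z = mscale c (ident n)" using az(2) n_pos by (auto simp: centre_eq)
    have "x - mscale c (ident n) \<in> Diag n" using x I by (rule matr.subspace_diff[OF subspace_Diag])
    then have "a \<in> Diag n" using az c by simp
    then show ?thesis using az c False by (auto simp: V_def)
  qed
  have comp: "ident_complement n (Diag n) V"
    unfolding ident_complement_def span_ident
  proof (intro conjI)
    show "V \<inter> range (\<lambda>c. mscale c (ident n)) = {0}" using V0 matr.subspace_0[OF V(1)] by (auto intro!: image_eqI[of _ _ 0])
    show "Diag n = {v + z |v z. v \<in> V \<and> z \<in> range (\<lambda>c. mscale c (ident n))}"
      using split V(3) I subspace_closed(1)[OF subspace_Diag] by blast
  qed (rule V(1))
  let ?P = "pract_gamma1 G n t \<eta> V"
  have sub: "matr.subspace (?P h)" for h by (simp add: pract_gamma1_def)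
  have PA: "?P h \<subseteq> f ` A h" if h: "h \<in> carrier G" for h
    unfolding pract_gamma1_def
  proof (rule matr.span_minimal[OF subsetI C.A_subspace[OF h]])
    fix x assume "x \<in> {munit i j | i j. 1 \<le> i \<and> i < j \<and> j \<le> n \<and> seg_prod G \<eta> i j = h} \<union>
      (if h = \<one> then V else {}) \<union> (if h = t then {ident n} else {})"
    then consider i j where "x = munit i j" "1 \<le> i" "i < j" "j \<le> n" "seg_prod G \<eta> i j = h"
      | "h = \<one>" "x \<in> V" | "h = t" "x = ident n" by (auto split: if_splits)
    then show "x \<in> f ` A h"
    proof cases
      case 1 then show ?thesis using e[of i j] by simp
    qed (use V(2) tC in auto)
  qed
  have spans: "UT n \<subseteq> matr.span (\<Union>h\<in>carrier G. ?P h)"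
  proof (rule UT_subset_subspace[OF matr.subspace_span])
    fix i j assume ij: "1 \<le> i" "i \<le> j" "j \<le> n"
    let ?S = "matr.span (\<Union>h\<in>carrier G. ?P h)"
    show "munit i j \<in> ?S"
    proof (cases "i = j")
      case False
      then have lt: "i < j" using ij by simp
      have "munit i j \<in> ?P (seg_prod G \<eta> i j)"
        unfolding pract_gamma1_def by (intro matr.span_base UnI1) (use lt ij in blast)
      then show ?thesis using cl[of i j] ij by (intro matr.span_base) blast
    next
      case True
      obtain v c where vc: "v \<in> V" "munit i j = v + mscale c (ident n)" using split[of "munit i j"] munit_Diag ij True by blast
      have "v \<in> ?P \<one>" "ident n \<in> ?P t" unfolding pract_gamma1_def using vc by (auto intro!: matr.span_base)
      then have "v \<in> ?S" "ident n \<in> ?S" using t(1) by (blast intro: matr.span_base)+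
      then show ?thesis unfolding vc(2) by (intro matr.span_add matr.span_scale)
    qed
  qed
  have "is_grading G n ?P" using C.grading_equalI[OF sub PA spans] .
  moreover have "f ` A h \<subseteq> ?P h" if "h \<in> carrier G" for h
    using C.grading_equal[OF sub PA spans that] by simp
  ultimately have "graded_iso G n A ?P" unfolding graded_iso_def using grading f by blast
  then show ?thesis unfolding is_pract_elementary_def using comp by blast
qed

end

subsection \<open>Type 2 gradings\<close>

lemma Xminus_gamma2: "1 \<le> i \<Longrightarrow> i \<le> j \<Longrightarrow> j \<le> n \<Longrightarrow> Xminus n i j \<in> gamma2 G n g \<eta> (seg_prod G \<eta> i j)"
  and Xplus_gamma2: "1 \<le> i \<Longrightarrow> i \<le> j \<Longrightarrow> j \<le> n \<Longrightarrow> Xplus n i j \<in> gamma2 G n g \<eta> (g \<otimes>\<^bsub>G\<^esub> seg_prod G \<eta> i j)"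
  unfolding gamma2_def by (intro matr.span_base; blast)+

lemma munit_half:
  assumes "(2::'f::field) \<noteq> 0"
  shows "munit i j = mscale (inverse 2) (Xminus n i j + (Xplus n i j :: 'f matr))"
proof -
  have "(x - y) + (x + y) = 2 * x" for x y :: 'f by algebra
  then show ?thesis using assms by (simp add: Xminus_def Xplus_def fun_eq_iff)
qed

lemma gamma2_spans:
  assumes "group G" and two: "(2::'f::field) \<noteq> 0" and g: "g \<in> carrier G"
    and \<eta>: "\<And>i. 1 \<le> i \<Longrightarrow> i < n \<Longrightarrow> \<eta> i \<in> carrier G"
  shows "UT n \<subseteq> matr.span (\<Union>h\<in>carrier G. gamma2 G n g \<eta> h :: 'f matr set)"
    and "Fil n 1 \<subseteq> matr.span (\<Union>h\<in>carrier G. gamma2 G n g \<eta> h \<inter> Fil n 1 :: 'f matr set)"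
proof -
  interpret group G by fact
  have cl: "seg_prod G \<eta> i j \<in> carrier G" "g \<otimes>\<^bsub>G\<^esub> seg_prod G \<eta> i j \<in> carrier G" if "1 \<le> i" "j \<le> n" for i j
  proof -
    show "seg_prod G \<eta> i j \<in> carrier G" using \<eta> that by (intro seg_prod_closed) auto
    then show "g \<otimes>\<^bsub>G\<^esub> seg_prod G \<eta> i j \<in> carrier G" using g by simp
  qed
  show "UT n \<subseteq> matr.span (\<Union>h\<in>carrier G. gamma2 G n g \<eta> h :: 'f matr set)"
  proof (rule UT_subset_subspace[OF matr.subspace_span])
    fix i j assume ij: "1 \<le> i" "i \<le> j" "j \<le> n"
    show "munit i j \<in> matr.span (\<Union>h\<in>carrier G. gamma2 G n g \<eta> h :: 'f matr set)"
      unfolding munit_half[OF two, of i j n]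
      by (intro matr.span_scale matr.span_add matr.span_base
          UN_I[where B = "gamma2 G n g \<eta>", OF cl(1)[OF ij(1,3)] Xminus_gamma2[OF ij]]
          UN_I[where B = "gamma2 G n g \<eta>", OF cl(2)[OF ij(1,3)] Xplus_gamma2[OF ij]])
  qed
  show "Fil n 1 \<subseteq> matr.span (\<Union>h\<in>carrier G. gamma2 G n g \<eta> h \<inter> Fil n 1 :: 'f matr set)"
  proof (rule Fil_subset_subspace[OF matr.subspace_span])
    fix i j assume ij: "1 \<le> i" "i \<le> j" "i + 1 \<le> j" "j \<le> n"
    then have lt: "i < j" by simp
    show "munit i j \<in> matr.span (\<Union>h\<in>carrier G. gamma2 G n g \<eta> h \<inter> Fil n 1 :: 'f matr set)"
      unfolding munit_half[OF two, of i j n]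
      by (intro matr.span_scale matr.span_add matr.span_base
          UN_I[where B = "\<lambda>h. gamma2 G n g \<eta> h \<inter> Fil n 1", OF cl(1)[OF ij(1,4)] IntI[OF Xminus_gamma2[OF ij(1,2,4)] Xminus_Fil[OF ij(1) lt ij(4)]]]
          UN_I[where B = "\<lambda>h. gamma2 G n g \<eta> h \<inter> Fil n 1", OF cl(2)[OF ij(1,4)] IntI[OF Xplus_gamma2[OF ij(1,2,4)] Xplus_Fil[OF ij(1) lt ij(4)]]])
  qed
qed

lemma gamma2_subset:
  assumes M: "matr.subspace M"
    and m: "\<And>i j. 1 \<le> i \<Longrightarrow> i \<le> j \<Longrightarrow> j \<le> n \<Longrightarrow> seg_prod G \<eta> i j = h \<Longrightarrow> Xminus n i j \<in> M"
    and p: "\<And>i j. 1 \<le> i \<Longrightarrow> i \<le> j \<Longrightarrow> j \<le> n \<Longrightarrow> g \<otimes>\<^bsub>G\<^esub> seg_prod G \<eta> i j = h \<Longrightarrow> Xplus n i j \<in> M"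
  shows "gamma2 G n g \<eta> h \<subseteq> M"
  unfolding gamma2_def by (rule matr.span_minimal[OF _ M]) (use m p in blast)

context graded_UT
begin

text \<open>The functional \<open>x 1 1 + x n n\<close> kills every Xminus and everything strictly
  upper triangular, but has the value 2 c on the scalar c. For h other than g no diagonal Xplus
  occurs.\<close>

lemma gamma2_centre:
  assumes two: "(2::'f) \<noteq> 0" and g: "g \<in> carrier G" and h: "h \<noteq> g"
  shows "gamma2 G n g \<eta> h \<inter> centre n \<subseteq> {0 :: 'f matr}"
proof
  fix x :: "'f matr" assume x: "x \<in> gamma2 G n g \<eta> h \<inter> centre n"
  have "gamma2 G n g \<eta> h \<subseteq> {x :: 'f matr. x 1 1 + x n n = 0}"
  proof (rule gamma2_subset)
    show "matr.subspace {x :: 'f matr. x 1 1 + x n n = 0}"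
      by (rule matr.subspaceI; simp only: mem_Collect_eq plus_fun_apply mscale_apply zero_fun_apply) algebra+
    fix i j assume ij: "1 \<le> i" "i \<le> j" "j \<le> n"
    have "munit (n + 1 - j) (n + 1 - i) 1 1 = (munit i j n n :: 'f)"
      "munit (n + 1 - j) (n + 1 - i) n n = (munit i j 1 1 :: 'f)"
      using ij unfolding munit_def by (intro if_cong refl; linarith)+
    then show "Xminus n i j \<in> {x :: 'f matr. x 1 1 + x n n = 0}"
      unfolding mem_Collect_eq Xminus_def matr_diff_apply by simp
    assume "g \<otimes> seg_prod G \<eta> i j = h"
    then have "i \<noteq> j" using h g by (auto simp: seg_prod_refl)
    then have "i < j" using ij by simp
    then have "Xplus n i j \<in> (Fil n 1 :: 'f matr set)" using ij by (intro Xplus_Fil)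
    then show "Xplus n i j \<in> {x :: 'f matr. x 1 1 + x n n = 0}" by (simp add: Fil_def)
  qed
  then have "x 1 1 + x n n = 0" using x by blast
  moreover obtain c where c: "x = mscale c (ident n)" using x n_pos by (auto simp: centre_eq)
  ultimately have "c + c = 0" using n_pos by (simp add: ident_apply)
  then have "c = 0" using twice_zero[OF two] by blast
  then show "x \<in> {0}" using c by simp
qed

lemma gamma2_pract:
  assumes two: "(2::'f) \<noteq> 0" and g: "g \<in> carrier G" and \<eta>: "\<And>i. 1 \<le> i \<Longrightarrow> i < n \<Longrightarrow> \<eta> i \<in> carrier G"
    and f: "lie_auto n f"
    and BAz: "\<And>h. h \<in> carrier G \<Longrightarrow> gamma2 G n g \<eta> h \<subseteq> graded_UT.Az G n (\<lambda>g. f ` A g) h"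
  shows "pract_graded_iso G n A (gamma2 G n g \<eta>)"
proof -
  interpret C: graded_UT G n "\<lambda>g. f ` A g" by (rule grading_image[OF f])
  let ?B = "gamma2 G n g \<eta> :: 'g \<Rightarrow> 'f matr set"
  have sub: "matr.subspace (?B h)" for h by (simp add: gamma2_def)
  note spans = gamma2_spans[OF group_axioms two g \<eta>]
  have B: "is_grading G n ?B"
    using C.grading_from_Az[OF sub BAz spans gamma2_centre[OF two g]] .
  have "\<exists>b\<in>?B h. f a - b \<in> centre n" if "h \<in> carrier G" "a \<in> A h" for h a
    using C.spanning_in_Az[OF sub BAz spans(1), of "f a" h] C.A_subset_Az that by blast
  then show ?thesis using pract_graded_isoI[OF B f] by blast
qed

end

lemma (in adapted_flip) gamma2_Az:
  assumes h: "h \<in> carrier G" shows "gamma2 G n g \<eta> h \<subseteq> Az h"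
proof (rule gamma2_subset[OF subspace_Az])
  fix i j assume ij: "1 \<le> i" "i \<le> j" "j \<le> n"
  have cl: "seg_prod G \<eta> i j \<in> carrier G" "g \<otimes> seg_prod G \<eta> i j \<in> carrier G" using seg_closed ij gG by auto
  have "Xminus n i j \<in> Az (seg_prod G \<eta> i j) \<and> Xplus n i j \<in> Az (g \<otimes> seg_prod G \<eta> i j)"
  proof (cases "i = j")
    case True
    then show ?thesis using Xminus_diag[of i] Xplus_diag[of i] ij gG by (simp add: seg_prod_refl)
  next
    case False
    then show ?thesis using X_upper[of i j] ij A_subset_Az[OF cl(1)] A_subset_Az[OF cl(2)] by auto
  qed
  then show "seg_prod G \<eta> i j = h \<Longrightarrow> Xminus n i j \<in> Az h" "g \<otimes> seg_prod G \<eta> i j = h \<Longrightarrow> Xplus n i j \<in> Az h"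
    by auto
qed

context graded_UT
begin

lemma flip_type2:
  assumes T: "flip_torus g" shows "\<exists>\<eta>. pract_iso_type2 G n A g \<eta>"
proof -
  obtain f1 where f1: "lie_auto n f1" "graded_UT.flip_torus G n (\<lambda>h. f1 ` A h) g"
    "\<forall>i. 1 \<le> i \<longrightarrow> i \<le> n \<longrightarrow> Xminus n i i \<in> graded_UT.Az G n (\<lambda>h. f1 ` A h) \<one>"
    using flip_form[OF T] by blast
  interpret B: graded_UT G n "\<lambda>h. f1 ` A h" by (rule grading_image[OF f1(1)])
  interpret B: flip_UT G n "\<lambda>h. f1 ` A h" g by unfold_locales (use f1 in auto)
  obtain f2 \<eta> where f2: "lie_auto n f2" "adapted_flip G n (\<lambda>h. f2 ` f1 ` A h) g \<eta>"
    using B.rescaled_form by blast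
  interpret C: adapted_flip G n "\<lambda>h. f2 ` f1 ` A h" g \<eta> by (rule f2(2))
  let ?f = "\<lambda>x. f2 (f1 x)"
  have f: "lie_auto n ?f" using lie_auto_comp[OF f1(1) f2(1)] .
  have eq: "(\<lambda>h. f2 ` f1 ` A h) = (\<lambda>h. ?f ` A h)" by (simp add: image_image)
  have "pract_graded_iso G n A (gamma2 G n g \<eta>)"
    using C.gamma2_Az unfolding eq by (intro gamma2_pract[OF C.two C.gG C.eta_closed f])
  moreover have "type2_params TYPE('f) G n g \<eta>"
    unfolding type2_params_def
    using C.flip_params C.gG C.g1 C.gg C.eta_flip C.g_commute C.two by (simp add: two_nonzero_iff)
  ultimately show ?thesis unfolding pract_iso_type2_def by blast
qed

text \<open>Each diagonal Xminus has trivial degree after adding a scalar c i. An automorphism x +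
  m(x) I with a linear functional m absorbs these scalars: m has to vanish on brackets, and m(I) = 0
  makes it invertible. Since scalars are not of degree 1, the c i are antisymmetric.\<close>

lemma central_shift:
  assumes two: "(2::'f) \<noteq> 0" and t: "t \<in> carrier G" "ident n \<in> A t" "t \<noteq> \<one>"
    and X: "\<And>i. 1 \<le> i \<Longrightarrow> i \<le> n \<Longrightarrow> Xminus n i i \<in> Az \<one>"
  shows "\<exists>r. lie_auto n r \<and> (\<forall>x\<in>UT n. r x - x \<in> centre n) \<and> (\<forall>i. 1 \<le> i \<longrightarrow> i \<le> n \<longrightarrow> Xminus n i i \<in> r ` A \<one>)"
proof -
  let ?I = "ident n :: 'f matr" and ?X = "\<lambda>i. Xminus n i i :: 'f matr"
  have "\<exists>c. ?X i + mscale c ?I \<in> A \<one>" if i: "1 \<le> i" "i \<le> n" for i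
  proof -
    obtain a z where az: "a \<in> A \<one>" "z \<in> centre n" "?X i = a + z" using Az_E[OF X[OF i]] by blast
    obtain c where "z = mscale c ?I" using az(2) n_pos by (auto simp: centre_eq)
    then have "?X i + mscale (- c) ?I = a" using az(3) by simp
    then show ?thesis using az(1) by metis
  qed
  then obtain c where c: "\<And>i. 1 \<le> i \<Longrightarrow> i \<le> n \<Longrightarrow> ?X i + mscale (c i) ?I \<in> A \<one>" by metis
  have c_flip: "c (n + 1 - i) = - c i" if i: "1 \<le> i" "i \<le> n" for i
  proof -
    have i': "1 \<le> n + 1 - i" "n + 1 - i \<le> n" "n + 1 - (n + 1 - i) = i" using i by auto
    have "?X (n + 1 - i) = - ?X i" unfolding Xminus_def i'(3) by simp
    then have "(?X i + mscale (c i) ?I) + (?X (n + 1 - i) + mscale (c (n + 1 - i)) ?I)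
        = mscale (c i + c (n + 1 - i)) ?I"
      by (simp add: matr.scale_left_distrib)
    then have "mscale (c i + c (n + 1 - i)) ?I \<in> A \<one>"
      using matr.subspace_add[OF A_subspace[OF one_closed] c[OF i] c[OF i'(1,2)]] by simp
    then have "c i + c (n + 1 - i) = 0" using scalar_deg[OF t(1,2) one_closed] t(3) by blast
    then show ?thesis by (simp add: add_eq_0_iff)
  qed
  \<comment> \<open>Since c is antisymmetric, this functional of the diagonal vanishes at I, and at
    Xminus number i it is - (c i - c (n + 1 - i)) / 2 = - c i.\<close>
  define m where "m = (\<lambda>x :: 'f matr. - inverse 2 * (\<Sum>p=1..n. c p * x p p))"
  have m_add: "m (x + y) = m x + m y" for x y
    by (simp only: m_def plus_fun_apply distrib_left sum.distrib)
  have m_scale: "m (mscale r x) = r * m x" for r x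
  proof -
    have "(\<Sum>p=1..n. c p * (r * x p p)) = r * (\<Sum>p=1..n. c p * x p p)"
      by (simp add: sum_distrib_left mult.left_commute)
    then show ?thesis by (simp add: m_def)
  qed
  have mI: "m ?I = 0"
  proof -
    have "(\<Sum>p=1..n. c p) = (\<Sum>p=1..n. c (n + 1 - p))" by (rule sum.atLeastAtMost_rev)
    also have "\<dots> = (\<Sum>p=1..n. - c p)" using c_flip by (intro sum.cong) auto
    finally have "(\<Sum>p=1..n. c p) = - (\<Sum>p=1..n. c p)" by (simp only: sum_negf)
    then have "(\<Sum>p=1..n. c p) = 0" using twice_zero[OF two, of "\<Sum>p=1..n. c p"] by (metis right_minus)
    moreover have "(\<Sum>p=1..n. c p * ?I p p) = (\<Sum>p=1..n. c p)" by (intro sum.cong) (auto simp: ident_apply)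
    ultimately show ?thesis by (simp add: m_def)
  qed
  have mX: "m (?X i) = - c i" if i: "1 \<le> i" "i \<le> n" for i
  proof -
    have i': "n + 1 - i \<in> {1..n}" using i by auto
    have "(\<Sum>p=1..n. c p * ?X i p p)
      = (\<Sum>p=1..n. (if p = i then c p else 0) - (if p = n + 1 - i then c p else 0))"
      unfolding Xminus_diag_entry[OF i] by (intro sum.cong) auto
    also have "\<dots> = c i - c (n + 1 - i)" using i i' by (simp add: sum_subtractf)
    also have "\<dots> = 2 * c i" using c_flip[OF i] by simp
    finally show ?thesis using two by (simp add: m_def)
  qed
  define r where "r = (\<lambda>x :: 'f matr. x + mscale (m x) ?I)"
  have rU: "r x \<in> UT n" if "x \<in> UT n" for x
    unfolding r_def by (rule UT_closed(2)[OF that UT_closed(5)[OF ident_UT]])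
  have mr: "m (r x) = m x" for x by (simp add: r_def m_add m_scale mI)
  have "bij_betw r (UT n) (UT n)"
  proof (rule bij_betwI[where g = "\<lambda>x. x - mscale (m x) ?I"])
    show "r \<in> UT n \<rightarrow> UT n" using rU by blast
    show "(\<lambda>x. x - mscale (m x) ?I) \<in> UT n \<rightarrow> UT n" using ident_UT by (auto intro!: UT_closed)
    show "r x - mscale (m (r x)) ?I = x" for x unfolding mr by (simp add: r_def)
    show "r (y - mscale (m y) ?I) = y" for y
    proof -
      have "m (y + mscale (- m y) ?I) = m y" by (simp only: m_add m_scale mI mult_zero_right add_0_right)
      then have "m (y - mscale (m y) ?I) = m y" by simp
      then show ?thesis by (simp add: r_def)
    qed
  qed
  then have auto: "lie_auto n r"
  proof (rule lie_autoI)
    show "r (x + y) = r x + r y" for x y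
      by (simp add: r_def m_add matr.scale_left_distrib)
    show "r (mscale s x) = mscale s (r x)" for s x
      by (simp add: r_def m_scale matr.scale_right_distrib matr.scale_scale)
    fix x y :: "'f matr" assume xy: "x \<in> UT n" "y \<in> UT n"
    have "m (bracket n x y) = 0"
      using bracket_diag_entry[OF xy] by (simp add: m_def)
    then have "r (bracket n x y) = bracket n x y" by (simp add: r_def)
    moreover have "bracket n (r x) (r y) = bracket n x y"
      unfolding r_def using xy
      by (simp add: bracket_add_left bracket_add_right bracket_centre_left[OF scalar_centre]
          bracket_centre_right[OF scalar_centre] UT_closed ident_UT)
    ultimately show "r (bracket n x y) = bracket n (r x) (r y)" by simp
  qed
  have "r x - x \<in> centre n" for x using scalar_centre by (simp add: r_def)
  moreover have "?X i \<in> r ` A \<one>" if i: "1 \<le> i" "i \<le> n" for i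
  proof -
    have "r (?X i + mscale (c i) ?I) = ?X i + mscale (c i) ?I + mscale (m (?X i + mscale (c i) ?I)) ?I"
      by (simp only: r_def)
    also have "m (?X i + mscale (c i) ?I) = - c i" by (simp add: m_add m_scale mI mX[OF i])
    also have "?X i + mscale (c i) ?I + mscale (- c i) ?I = ?X i" by simp
    finally have "r (?X i + mscale (c i) ?I) = ?X i" .
    then show ?thesis using c[OF i] by (metis image_eqI)
  qed
  ultimately show ?thesis using auto by blast
qed

lemma Az_shift:
  assumes r: "lie_auto n r" "\<forall>x\<in>UT n. r x - x \<in> centre n" and h: "h \<in> carrier G"
  shows "Az h \<subseteq> graded_UT.Az G n (\<lambda>g. r ` A g) h"
proof
  interpret C: graded_UT G n "\<lambda>g. r ` A g" by (rule grading_image[OF r(1)])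
  fix x assume x: "x \<in> Az h"
  then have "r x - x \<in> C.Az h" using r(2) Az_UT C.centre_subset_Az by blast
  then have "r x - (r x - x) \<in> C.Az h" using Az_image[OF r(1) x h] matr.subspace_diff[OF C.subspace_Az] by blast
  then show "x \<in> C.Az h" by simp
qed

lemma ident_gamma2:
  assumes two: "(2::'f) \<noteq> 0" and g: "g \<in> carrier G" shows "ident n \<in> (gamma2 G n g \<eta> g :: 'f matr set)"
proof -
  have S: "Xplus n i i \<in> (gamma2 G n g \<eta> g :: 'f matr set)" if "i \<in> {1..n}" for i
    using Xplus_gamma2[of i i n G g \<eta>] that g by (simp add: seg_prod_refl)
  have sub: "matr.subspace (gamma2 G n g \<eta> g :: 'f matr set)" by (simp add: gamma2_def)
  have "ident n = (\<Sum>i=1..n. munit (n + 1 - i) (n + 1 - i) :: 'f matr)"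
    unfolding ident_def by (rule sum.atLeastAtMost_rev)
  then have "(\<Sum>i=1..n. Xplus n i i) = (ident n + ident n :: 'f matr)"
    unfolding Xplus_def sum.distrib by (simp add: ident_def)
  also have "\<dots> = mscale 2 (ident n)" by (intro ext) (simp only: plus_fun_apply mscale_apply mult_2)
  finally have "ident n = mscale (inverse 2) (\<Sum>i=1..n. Xplus n i i :: 'f matr)"
    using two by (simp add: matr.scale_scale)
  also have "\<dots> \<in> gamma2 G n g \<eta> g" using S by (intro matr.subspace_scale[OF sub] matr.subspace_sum[OF sub])
  finally show ?thesis .
qed

text \<open>Off the diagonal the degrees are exact by \<open>Az_Fil1\<close>. The diagonal Xminus
  have to be homogeneous of exact degree 1; for t = 1 this is automatic because scalars then have
  degree 1, otherwise it is the hypothesis X.\<close>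

lemma pract_gamma2_equal:
  assumes two: "(2::'f) \<noteq> 0" and g: "g \<in> carrier G" and \<eta>: "\<And>i. 1 \<le> i \<Longrightarrow> i < n \<Longrightarrow> \<eta> i \<in> carrier G"
    and t: "t \<in> carrier G" "ident n \<in> A t"
    and BAz: "\<And>h. h \<in> carrier G \<Longrightarrow> gamma2 G n g \<eta> h \<subseteq> Az h"
    and X: "t \<noteq> \<one> \<Longrightarrow> \<forall>i. 1 \<le> i \<longrightarrow> i \<le> n \<longrightarrow> Xminus n i i \<in> A \<one>"
  shows "\<exists>V. ident_complement n (gamma2 G n g \<eta> g) V \<and> is_grading G n (pract_gamma2 G n t g \<eta> V) \<and>
    (\<forall>h\<in>carrier G. A h = pract_gamma2 G n t g \<eta> V h)"
proof -
  let ?B = "gamma2 G n g \<eta> :: 'g \<Rightarrow> 'f matr set" and ?I = "ident n :: 'f matr"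
  have subB: "matr.subspace (?B h)" for h by (simp add: gamma2_def)
  have spans: "UT n \<subseteq> matr.span (\<Union>h\<in>carrier G. ?B h)"
    using \<eta> by (rule gamma2_spans(1)[OF group_axioms two g])
  have IB: "mscale c ?I \<in> ?B g" for c using ident_gamma2[OF two g] matr.subspace_scale[OF subB] by blast
  \<comment> \<open>For t = g the scalars belong to the component of degree g and any complement of
    them will do. Otherwise the component of degree g is itself the complement.\<close>
  define V where "V = (if t = g then {x \<in> ?B g. x n n = 0} else A g)"
  have subV: "matr.subspace V"
  proof -
    have "matr.subspace {x \<in> ?B g. x n n = 0}"
      by (intro matr.subspaceI) (simp_all add: subspace_closed[OF subB])
    then show ?thesis using A_subspace[OF g] by (simp add: V_def)
  qed
  have V0: "c = 0" if "mscale c ?I \<in> V" for c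
    using that n_pos scalar_deg[OF t g] by (auto simp: V_def ident_apply split: if_splits)
  have VB: "V \<subseteq> ?B g"
  proof (cases "t = g")
    case False
    show ?thesis
    proof
      fix a assume "a \<in> V"
      then have a: "a \<in> A g" using False by (simp add: V_def)
      obtain b where b: "b \<in> ?B g" "a - b \<in> centre n"
        using spanning_in_Az[OF subB BAz spans, of a g] a A_subset_Az[OF g] g by blast
      then obtain c where "a - b = mscale c ?I" using n_pos by (auto simp: centre_eq)
      then have "a = b + mscale c ?I" by (simp add: algebra_simps)
      then show "a \<in> ?B g" using b(1) IB matr.subspace_add[OF subB] by simp
    qed
  qed (auto simp: V_def)
  have split: "\<exists>v\<in>V. \<exists>c. x = v + mscale c ?I" if x: "x \<in> ?B g" for x
  proof (cases "t = g")
    case True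
    have "x - mscale (x n n) ?I \<in> V"
      using True matr.subspace_diff[OF subB x IB[of "x n n"]] n_pos by (simp add: V_def ident_apply)
    then show ?thesis by (intro bexI[of _ "x - mscale (x n n) ?I"] exI[of _ "x n n"]) simp_all
  next
    case False
    obtain a z where az: "a \<in> A g" "z \<in> centre n" "x = a + z" using Az_E[of x g] BAz[OF g] x g by blast
    obtain c where c: "z = mscale c ?I" using az(2) n_pos by (auto simp: centre_eq)
    then show ?thesis using az False by (auto simp: V_def)
  qed
  have comp: "ident_complement n (?B g) V"
    unfolding ident_complement_def span_ident
  proof (intro conjI)
    show "V \<inter> range (\<lambda>c. mscale c ?I) = {0}" using V0 matr.subspace_0[OF subV] by (auto intro!: image_eqI[of _ _ 0])
    show "?B g = {v + z |v z. v \<in> V \<and> z \<in> range (\<lambda>c. mscale c ?I)}"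
      using split VB IB matr.subspace_add[OF subB] by blast
  qed (rule subV)
  let ?P = "pract_gamma2 G n t g \<eta> V"
  have subP: "matr.subspace (?P h)" for h
    unfolding pract_gamma2_def using subB subV matr.subspace_sums[OF subB matr.subspace_span, of t "{?I}"] by simp
  have PA: "?P h \<subseteq> A h" if h: "h \<in> carrier G" for h
  proof -
    consider "h = t" | "h \<noteq> t" "h = g" | "h \<noteq> t" "h \<noteq> g" by blast
    then show ?thesis
    proof cases
      case 1
      have "?B t \<subseteq> A t" using BAz[OF t(1)] Az_ident[OF t] by blast
      moreover have "mscale c ?I \<in> A t" for c using t matr.subspace_scale[OF A_subspace[OF t(1)]] by blast
      ultimately show ?thesis
        using 1 matr.subspace_add[OF A_subspace[OF t(1)]] by (auto simp: pract_gamma2_def span_ident)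
    next
      case 2 then show ?thesis by (auto simp: pract_gamma2_def V_def)
    next
      case 3
      have "?B h \<subseteq> A h"
      proof (rule gamma2_subset[OF A_subspace[OF h]])
        fix i j assume ij: "1 \<le> i" "i \<le> j" "j \<le> n"
        show "Xminus n i j \<in> A h" if s: "seg_prod G \<eta> i j = h"
        proof (cases "i = j")
          case True
          then show ?thesis using X 3 s ij by (auto simp: seg_prod_refl)
        next
          case False
          show ?thesis
            by (rule Az_Fil1[OF _ Xminus_Fil h])
              (use Xminus_gamma2[OF ij, of G g \<eta>] BAz[OF h] s ij False in auto)
        qed
        show "Xplus n i j \<in> A h" if s: "g \<otimes> seg_prod G \<eta> i j = h"
        proof (cases "i = j")
          case True
          then show ?thesis using 3 s g by (auto simp: seg_prod_refl)
        next
          case False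
          show ?thesis
            by (rule Az_Fil1[OF _ Xplus_Fil h])
              (use Xplus_gamma2[OF ij, of G g \<eta>] BAz[OF h] s ij False in auto)
        qed
      qed
      then show ?thesis using 3 by (simp add: pract_gamma2_def)
    qed
  qed
  let ?S = "matr.span (\<Union>h\<in>carrier G. ?P h)"
  have PS: "?P h \<subseteq> ?S" if "h \<in> carrier G" for h using that by (blast intro: matr.span_base)
  have Pt_mem: "u + mscale c ?I \<in> ?P t" if "u \<in> ?B t" for u c
    unfolding pract_gamma2_def span_ident using that by auto
  have Pt: "?B t \<subseteq> ?P t" using Pt_mem[of _ 0] by auto
  have It: "mscale c ?I \<in> ?P t" for c using Pt_mem[of 0 c] matr.subspace_0[OF subB] by simp
  have BS: "?B h \<subseteq> ?S" if h: "h \<in> carrier G" for h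
  proof -
    consider "h = t" | "h \<noteq> t" "h = g" | "h \<noteq> t" "h \<noteq> g" by blast
    then show ?thesis
    proof cases
      case 1 then show ?thesis using Pt PS[OF t(1)] by blast
    next
      case 2
      then have "?P g = V" by (auto simp: pract_gamma2_def)
      then have "V \<subseteq> ?S" using PS[OF g] by simp
      moreover have "mscale c ?I \<in> ?S" for c using It PS[OF t(1)] by blast
      ultimately show ?thesis using split matr.span_add 2 by blast
    next
      case 3 then show ?thesis using PS[OF h] by (simp add: pract_gamma2_def)
    qed
  qed
  then have "matr.span (\<Union>h\<in>carrier G. ?B h) \<subseteq> ?S" by (intro matr.span_minimal matr.subspace_span) blast
  then have spansP: "UT n \<subseteq> ?S" using spans by blast
  show ?thesis using comp grading_equalI[OF subP PA spansP] grading_equal[OF subP PA spansP] by blast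
qed

lemma type2_paramsD:
  assumes "type2_params TYPE('f) G n g \<eta>"
  shows "(2::'f) \<noteq> 0" "elem_params G n \<eta>" "g \<in> carrier G" "g \<noteq> \<one>" "g \<otimes> g = \<one>"
    "\<And>i. 1 \<le> i \<Longrightarrow> i < n \<Longrightarrow> \<eta> i \<in> carrier G" "\<And>i. 1 \<le> i \<Longrightarrow> i < n \<Longrightarrow> g \<otimes> \<eta> i = \<eta> i \<otimes> g"
  using assms unfolding type2_params_def elem_params_def two_nonzero_iff Ball_def atLeastLessThan_iff
  by blast+

text \<open>A practical isomorphism leaves scalars undetermined in the diagonal Xminus. For t other
  than 1 \<open>central_shift\<close> removes them without changing the grading modulo the centre,
  and then \<open>pract_gamma2_equal\<close> applies.\<close>

lemma type2_graded_iso: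
  assumes P: "pract_iso_type2 G n A g \<eta>" and t: "t \<in> carrier G" "ident n \<in> A t"
  shows "is_pract_type2 G n A t g \<eta>"
proof -
  let ?B = "gamma2 G n g \<eta> :: 'g \<Rightarrow> 'f matr set"
  have params: "type2_params TYPE('f) G n g \<eta>" and iso: "pract_graded_iso G n A ?B"
    using P unfolding pract_iso_type2_def by auto
  note p = type2_paramsD[OF params]
  obtain f where f: "lie_auto n f" and BAz: "\<And>h. h \<in> carrier G \<Longrightarrow> ?B h \<subseteq> graded_UT.Az G n (\<lambda>g. f ` A g) h"
    using pract_graded_isoD[OF iso] by blast
  interpret C: graded_UT G n "\<lambda>g. f ` A g" by (rule grading_image[OF f])
  have tC: "ident n \<in> f ` A t" using ident_image[OF f t] .
  have XAz: "Xminus n i i \<in> C.Az \<one>" if "1 \<le> i" "i \<le> n" for i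
    using Xminus_gamma2[of i i n G g \<eta>] BAz[OF one_closed] that by (auto simp: seg_prod_refl)
  have "\<exists>r. lie_auto n r \<and> (\<forall>x\<in>UT n. r x - x \<in> centre n) \<and>
      (t \<noteq> \<one> \<longrightarrow> (\<forall>i. 1 \<le> i \<longrightarrow> i \<le> n \<longrightarrow> Xminus n i i \<in> r ` f ` A \<one>))"
  proof (cases "t = \<one>")
    case True
    then show ?thesis using lie_auto_id matr.subspace_0[OF subspace_centre] by (intro exI[of _ "\<lambda>x. x"]) auto
  next
    case False
    then show ?thesis using C.central_shift[OF p(1) t(1) tC False XAz] by blast
  qed
  then obtain r where r: "lie_auto n r" "\<forall>x\<in>UT n. r x - x \<in> centre n"
    "t \<noteq> \<one> \<Longrightarrow> \<forall>i. 1 \<le> i \<longrightarrow> i \<le> n \<longrightarrow> Xminus n i i \<in> r ` f ` A \<one>" by blast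
  interpret D: graded_UT G n "\<lambda>g. r ` f ` A g" by (rule C.grading_image[OF r(1)])
  have BD: "?B h \<subseteq> D.Az h" if "h \<in> carrier G" for h
    using BAz[OF that] C.Az_shift[OF r(1,2) that] by (rule subset_trans)
  have "\<exists>V. ident_complement n (?B g) V \<and> is_grading G n (pract_gamma2 G n t g \<eta> V) \<and>
    (\<forall>h\<in>carrier G. r ` f ` A h = pract_gamma2 G n t g \<eta> V h)"
    by (rule D.pract_gamma2_equal[OF p(1,3,6) t(1) C.ident_image[OF r(1) t(1) tC] BD r(3)])
  then obtain V where V: "ident_complement n (?B g) V" "is_grading G n (pract_gamma2 G n t g \<eta> V)"
    "\<forall>h\<in>carrier G. r ` f ` A h = pract_gamma2 G n t g \<eta> V h"
    by (elim exE conjE)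
  have "(\<lambda>x. r (f x)) ` A h \<subseteq> pract_gamma2 G n t g \<eta> V h" if "h \<in> carrier G" for h
    using V(3)[rule_format, OF that] by (auto simp: image_image)
  then have "graded_iso G n A (pract_gamma2 G n t g \<eta> V)"
    unfolding graded_iso_def using grading V(2) lie_auto_comp[OF f r(1)] by blast
  then show ?thesis unfolding is_pract_type2_def using V(1) by blast
qed

subsection \<open>The essential support\<close>

lemma ess_support_nonzero:
  assumes iso: "pract_graded_iso G n A B" and h: "h \<in> ess_support G n A" shows "\<not> B h \<subseteq> {0}"
proof
  assume B0: "B h \<subseteq> {0}"
  have hG: "h \<in> carrier G" and nc: "\<not> A h \<subseteq> centre n" using h by (auto simp: ess_support_def)
  obtain f where f: "lie_auto n f" "\<forall>h\<in>carrier G. \<forall>a\<in>A h. \<exists>b\<in>B h. f a - b \<in> centre n"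
    using pract_graded_isoD[OF iso] by blast
  have "a \<in> centre n" if a: "a \<in> A h" for a
  proof -
    obtain b where "b \<in> B h" "f a - b \<in> centre n" using f(2) hG a by blast
    then have "f a \<in> centre n" using B0 by auto
    then show ?thesis using lie_auto_centre_rev[OF f(1) A_UT[OF hG a]] by blast
  qed
  then show False using nc by blast
qed

lemma elementary_commute:
  assumes P: "pract_iso_elementary G n A \<eta>" and hk: "h \<in> ess_support G n A" "k \<in> ess_support G n A"
  shows "h \<otimes> k = k \<otimes> h"
proof -
  have \<eta>: "elem_params G n \<eta>" and iso: "pract_graded_iso G n A (gamma1 G n \<eta>)"
    using P unfolding pract_iso_elementary_def by auto
  have "\<exists>i j. 1 \<le> i \<and> j \<le> n \<and> h = seg_prod G \<eta> i j" if h: "h \<in> ess_support G n A" for h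
  proof (rule ccontr)
    assume "\<not> ?thesis"
    then have "gamma1 G n \<eta> h \<subseteq> {0 :: 'f matr}"
      unfolding gamma1_def by (intro matr.span_minimal matr.subspace_single_0) blast
    then show False using ess_support_nonzero[OF iso h] by blast
  qed
  then obtain i j k' l where "1 \<le> i" "j \<le> n" "h = seg_prod G \<eta> i j" "1 \<le> k'" "l \<le> n" "k = seg_prod G \<eta> k' l"
    using hk by metis
  then show ?thesis using elem_params_seg_commute[OF \<eta>] by blast
qed

lemma type2_commute:
  assumes P: "pract_iso_type2 G n A g \<eta>" and hk: "h \<in> ess_support G n A" "k \<in> ess_support G n A"
  shows "h \<otimes> k = k \<otimes> h"
proof -
  have params: "type2_params TYPE('f) G n g \<eta>" and iso: "pract_graded_iso G n A (gamma2 G n g \<eta>)"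
    using P unfolding pract_iso_type2_def by auto
  note p = type2_paramsD[OF params]
  have ex: "\<exists>i j. 1 \<le> i \<and> j \<le> n \<and> (h = seg_prod G \<eta> i j \<or> h = g \<otimes> seg_prod G \<eta> i j)"
    if h: "h \<in> ess_support G n A" for h
  proof (rule ccontr)
    assume "\<not> ?thesis"
    then have "gamma2 G n g \<eta> h \<subseteq> {0 :: 'f matr}"
      by (intro gamma2_subset matr.subspace_single_0) blast+
    then show False using ess_support_nonzero[OF iso h] by blast
  qed
  obtain i j where ij: "1 \<le> i" "j \<le> n" "h = seg_prod G \<eta> i j \<or> h = g \<otimes> seg_prod G \<eta> i j" using ex[OF hk(1)] by blast
  obtain i' j' where ij': "1 \<le> i'" "j' \<le> n" "k = seg_prod G \<eta> i' j' \<or> k = g \<otimes> seg_prod G \<eta> i' j'" using ex[OF hk(2)] by blast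
  let ?s = "seg_prod G \<eta> i j" and ?s' = "seg_prod G \<eta> i' j'"
  have cl: "?s \<in> carrier G" "?s' \<in> carrier G" using elem_params_seg_closed[OF p(2)] ij ij' by auto
  have gs: "g \<otimes> ?s = ?s \<otimes> g" "g \<otimes> ?s' = ?s' \<otimes> g"
    using p(3,6,7) ij ij' by (auto intro!: seg_prod_commute)
  have ss: "?s \<otimes> ?s' = ?s' \<otimes> ?s" using elem_params_seg_commute[OF p(2)] ij ij' by blast
  have 1: "x \<otimes> k = k \<otimes> x" if "x \<otimes> g = g \<otimes> x" "x \<otimes> ?s' = ?s' \<otimes> x" "x \<in> carrier G" for x
    using ij'(3) commute_mult[OF that(1,2,3) p(3) cl(2)] that(2) by blast
  have "?s \<otimes> k = k \<otimes> ?s" "g \<otimes> k = k \<otimes> g" using 1[of ?s] 1[of g] gs ss cl p(3) by auto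
  moreover have kG: "k \<in> carrier G" using ij'(3) cl p(3) by auto
  ultimately have "k \<otimes> (g \<otimes> ?s) = (g \<otimes> ?s) \<otimes> k" using cl p(3) by (intro commute_mult) auto
  then show ?thesis using ij(3) \<open>?s \<otimes> k = k \<otimes> ?s\<close> by metis
qed

subsection \<open>The two by two case\<close>

lemma trivial_torus_2: "n = 2 \<Longrightarrow> trivial_torus"
  using torus_cases flip_torusD(1) by fastforce

lemma ess_support_upper:
  assumes f: "lie_auto n f" and h: "h \<in> carrier G" and e: "munit i j \<in> f ` A h" "1 \<le> i" "i < j" "j \<le> n"
  shows "h \<in> ess_support G n A"
proof -
  obtain a where a: "a \<in> A h" "munit i j = f a" using e by blast
  have "a \<notin> centre n"
  proof
    assume "a \<in> centre n"
    then have "munit i j \<in> (centre n :: 'f matr set)" using lie_auto_centre[OF f] a(2) by simp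
    moreover have "munit i j \<in> (Fil n 1 :: 'f matr set)" using e by (intro munit_Fil) auto
    ultimately show False using centre_Fil1[OF _ _ n_pos] munit_nonzero by blast
  qed
  then show ?thesis using a(1) h unfolding ess_support_def by blast
qed

lemma index_2:
  assumes "1 \<le> i" "i \<le> j" "j \<le> (2::nat)" obtains "i = j" | "i = 1" "j = 2"
  using assms by linarith

lemma X_2:
  assumes n2: "n = 2" shows "Xminus n 1 2 = (0 :: 'f matr)" "Xplus n 1 2 = mscale 2 (munit 1 2 :: 'f matr)"
    "1 \<le> i \<Longrightarrow> i \<le> n \<Longrightarrow> Xplus n i i = (ident n :: 'f matr)"
proof -
  show "Xminus n 1 2 = (0 :: 'f matr)" using n2 by (simp add: Xminus_def)
  show "Xplus n 1 2 = mscale 2 (munit 1 2 :: 'f matr)"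
    unfolding n2 by (intro ext) (simp add: Xplus_def munit_def)
  show "Xplus n i i = (ident n :: 'f matr)" if "1 \<le> i" "i \<le> n"
  proof (intro ext)
    fix p q
    have "i = 1 \<or> i = 2" using that n2 by auto
    then show "Xplus n i i p q = (ident n :: 'f matr) p q"
      unfolding ident_apply by (auto simp: n2 Xplus_def munit_def)
  qed
qed

text \<open>For n = 2 the diagonal Xplus are the identity, which lies in every \<open>Az h\<close>,
  so g is limited only by order and commutation. The torus is trivial, and the only root vector is
  \<open>munit 1 2\<close>.\<close>

lemma type2_exists_2:
  assumes n2: "n = 2" and two: "(2::'f) \<noteq> 0" and g: "g \<in> carrier G" "g \<noteq> \<one>" "g \<otimes> g = \<one>"
    and gc: "\<forall>h\<in>ess_support G n A. g \<otimes> h = h \<otimes> g"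
  shows "\<exists>\<eta>. pract_iso_type2 G n A g \<eta>"
proof -
  obtain f \<eta> where f: "lie_auto n f" and \<eta>: "elem_params G n \<eta>"
    and D: "Diag n \<subseteq> graded_UT.Az G n (\<lambda>g. f ` A g) \<one>"
    and e: "\<And>i j. 1 \<le> i \<Longrightarrow> i < j \<Longrightarrow> j \<le> n \<Longrightarrow> munit i j \<in> f ` A (seg_prod G \<eta> i j)"
    using trivial_elementary[OF trivial_torus_2[OF n2]] by blast
  interpret C: graded_UT G n "\<lambda>g. f ` A g" by (rule grading_image[OF f])
  let ?r = "\<eta> 1"
  have r: "?r \<in> carrier G" using \<eta> n2 by (simp add: elem_params_def)
  have s: "seg_prod G \<eta>' 1 2 = \<eta>' 1" if "\<eta>' 1 \<in> carrier G" for \<eta>'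
    using that by (simp add: seg_prod_Cons seg_prod_refl numeral_2_eq_2)
  have e12: "munit 1 2 \<in> f ` A ?r" using e[of 1 2] s[of \<eta>, OF r] n2 by simp
  have gr: "g \<otimes> ?r = ?r \<otimes> g" using gc ess_support_upper[OF f r e12] n2 by auto
  \<comment> \<open>Xminus at the only simple root is 0, and Xplus there has degree
    \<open>g \<otimes> \<eta> 1\<close>. This has to be the degree of \<open>munit 1 2\<close>, and
    g is its own inverse.\<close>
  let ?\<eta> = "\<lambda>i :: nat. g \<otimes> ?r"
  have \<eta>G: "g \<otimes> ?r \<in> carrier G" using g r by simp
  have ggr: "g \<otimes> (g \<otimes> ?r) = ?r" using g r by (simp add: m_assoc[symmetric])
  have "gamma2 G n g ?\<eta> h \<subseteq> C.Az h" if h: "h \<in> carrier G" for h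
  proof (rule gamma2_subset[OF C.subspace_Az])
    fix i j assume ij: "1 \<le> i" "i \<le> j" "j \<le> n"
    show "Xminus n i j \<in> C.Az h" if h: "seg_prod G ?\<eta> i j = h"
      using ij(1,2) ij(3)[unfolded n2]
    proof (cases rule: index_2)
      case 1
      have "Xminus n i i \<in> (Diag n :: 'f matr set)" using ij 1 by (intro Xminus_Diag) auto
      then show ?thesis using h D 1 by (auto simp: seg_prod_refl)
    next
      case 2
      then show ?thesis using X_2(1)[OF n2] matr.subspace_0[OF C.subspace_Az] by simp
    qed
    show "Xplus n i j \<in> C.Az h" if h: "g \<otimes> seg_prod G ?\<eta> i j = h"
      using ij(1,2) ij(3)[unfolded n2]
    proof (cases rule: index_2)
      case 1
      then have "Xplus n i j = mscale 1 (ident n :: 'f matr)" using X_2(3)[OF n2] ij by simp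
      then show ?thesis using C.centre_subset_Az scalar_centre[of 1] by auto
    next
      case 2
      have "h = ?r" using h 2 s[of ?\<eta>] \<eta>G ggr by simp
      moreover have "mscale 2 (munit 1 2) \<in> f ` A ?r" using e12 matr.subspace_scale[OF C.A_subspace[OF r]] by blast
      ultimately show ?thesis using C.A_subset_Az[OF r] 2 X_2(2)[OF n2] by auto
    qed
  qed
  then have "pract_graded_iso G n A (gamma2 G n g ?\<eta>)" using \<eta>G by (intro gamma2_pract[OF two g(1) _ f])
  moreover have "g \<otimes> (g \<otimes> ?r) = (g \<otimes> ?r) \<otimes> g" using commute_mult[OF refl gr g(1) g(1) r] .
  then have "type2_params TYPE('f) G n g ?\<eta>"
    using g two \<eta>G by (simp add: type2_params_def elem_params_def two_nonzero_iff)
  ultimately show ?thesis unfolding pract_iso_type2_def by blast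
qed

text \<open>Now the identity itself has the degree t of the diagonal Xplus, and
  \<open>central_shift\<close> gives the diagonal Xminus exact degree 1, so the isomorphism is
  graded and not only practical. Commutation of t with the essential support is asked for only where
  the parameters have to be those of a type 2 grading.\<close>

lemma type2_graded_iso_2:
  assumes n2: "n = 2" and two: "(2::'f) \<noteq> 0" and t: "t \<in> carrier G" "ident n \<in> A t" "t \<noteq> \<one>" "t \<otimes> t = \<one>"
  shows "\<exists>\<eta>'. (\<forall>i\<in>{1..<n}. \<eta>' i \<in> carrier G) \<and> graded_iso G n A (gamma2 G n t \<eta>') \<and>
    ((\<forall>h\<in>ess_support G n A. t \<otimes> h = h \<otimes> t) \<longrightarrow> type2_params TYPE('f) G n t \<eta>')"
proof -
  obtain f \<eta> where f: "lie_auto n f" and \<eta>: "elem_params G n \<eta>"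
    and D: "Diag n \<subseteq> graded_UT.Az G n (\<lambda>g. f ` A g) \<one>"
    and e: "\<And>i j. 1 \<le> i \<Longrightarrow> i < j \<Longrightarrow> j \<le> n \<Longrightarrow> munit i j \<in> f ` A (seg_prod G \<eta> i j)"
    using trivial_elementary[OF trivial_torus_2[OF n2]] by blast
  interpret C: graded_UT G n "\<lambda>g. f ` A g" by (rule grading_image[OF f])
  have tC: "ident n \<in> f ` A t" using ident_image[OF f t(1,2)] .
  let ?r = "\<eta> 1"
  have r: "?r \<in> carrier G" using \<eta> n2 by (simp add: elem_params_def)
  have s: "seg_prod G \<eta>' 1 2 = \<eta>' 1" if "\<eta>' 1 \<in> carrier G" for \<eta>'
    using that by (simp add: seg_prod_Cons seg_prod_refl numeral_2_eq_2)
  have e12: "munit 1 2 \<in> f ` A ?r" using e[of 1 2] s[of \<eta>, OF r] n2 by simp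
  have XAz: "Xminus n i i \<in> C.Az \<one>" if "1 \<le> i" "i \<le> n" for i
    using D Xminus_Diag[OF that] by blast
  obtain q where q: "lie_auto n q" "\<forall>x\<in>UT n. q x - x \<in> centre n"
    "\<forall>i. 1 \<le> i \<longrightarrow> i \<le> n \<longrightarrow> Xminus n i i \<in> q ` f ` A \<one>"
    using C.central_shift[OF two t(1) tC t(3) XAz] by blast
  interpret E: graded_UT G n "\<lambda>g. q ` f ` A g" by (rule C.grading_image[OF q(1)])
  have "munit 1 2 \<in> E.Az ?r" using C.Az_shift[OF q(1,2) r] C.A_subset_Az[OF r] e12 by blast
  then have e12': "munit 1 2 \<in> q ` f ` A ?r" using n2 by (intro E.Az_Fil1[OF _ munit_Fil r]) auto
  have tE: "ident n \<in> q ` f ` A t" using C.ident_image[OF q(1) t(1) tC] .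
  let ?\<eta> = "\<lambda>i :: nat. t \<otimes> ?r"
  have \<eta>G: "t \<otimes> ?r \<in> carrier G" using t r by simp
  have ttr: "t \<otimes> (t \<otimes> ?r) = ?r" using t r by (simp add: m_assoc[symmetric])
  let ?B = "gamma2 G n t ?\<eta> :: 'g \<Rightarrow> 'f matr set"
  have sub: "matr.subspace (?B h)" for h by (simp add: gamma2_def)
  have BE: "?B h \<subseteq> q ` f ` A h" if hG: "h \<in> carrier G" for h
  proof (rule gamma2_subset[OF E.A_subspace[OF hG]])
    fix i j assume ij: "1 \<le> i" "i \<le> j" "j \<le> n"
    show "Xminus n i j \<in> q ` f ` A h" if h: "seg_prod G ?\<eta> i j = h"
      using ij(1,2) ij(3)[unfolded n2]
    proof (cases rule: index_2)
      case 1
      then show ?thesis using q(3) ij h by (auto simp: seg_prod_refl)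
    next
      case 2
      then show ?thesis using X_2(1)[OF n2] matr.subspace_0[OF E.A_subspace[OF hG]] by simp
    qed
    show "Xplus n i j \<in> q ` f ` A h" if h: "t \<otimes> seg_prod G ?\<eta> i j = h"
      using ij(1,2) ij(3)[unfolded n2]
    proof (cases rule: index_2)
      case 1
      then have "Xplus n i j = (ident n :: 'f matr)" "h = t" using X_2(3)[OF n2] ij h t by (auto simp: seg_prod_refl)
      then show ?thesis using tE by simp
    next
      case 2
      have "h = ?r" using h 2 s[of ?\<eta>] \<eta>G ttr by simp
      then show ?thesis using e12' matr.subspace_scale[OF E.A_subspace[OF r]] 2 X_2(2)[OF n2] by simp
    qed
  qed
  have spans: "UT n \<subseteq> matr.span (\<Union>h\<in>carrier G. ?B h)"
    using \<eta>G by (intro gamma2_spans(1)[OF group_axioms two t(1)])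
  have "(\<lambda>x. q (f x)) ` A h \<subseteq> ?B h" if "h \<in> carrier G" for h
    using E.grading_equal[OF sub BE spans that] by (auto simp: image_image)
  then have "graded_iso G n A ?B"
    unfolding graded_iso_def using grading E.grading_equalI[OF sub BE spans] lie_auto_comp[OF f q(1)] by blast
  moreover have "type2_params TYPE('f) G n t ?\<eta>" if "\<forall>h\<in>ess_support G n A. t \<otimes> h = h \<otimes> t"
  proof -
    have "t \<otimes> ?r = ?r \<otimes> t" using that ess_support_upper[OF f r e12] n2 by auto
    then have "t \<otimes> (t \<otimes> ?r) = (t \<otimes> ?r) \<otimes> t" using commute_mult[OF refl _ t(1) t(1) r] by blast
    then show ?thesis using t two \<eta>G by (simp add: type2_params_def elem_params_def two_nonzero_iff)
  qed
  ultimately show ?thesis using \<eta>G by (intro exI[of _ ?\<eta>]) blast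
qed

end

theorem theorem12:
  fixes G :: "('g, 'z) monoid_scheme"
    and n :: nat
    and A :: "'g \<Rightarrow> 'f::field matr set"
  assumes "group G" and "1 \<le> n" and "is_grading G n A"
  shows
    "let t = hdeg G A (ident n) in
     (\<forall>g\<in>ess_support G n A. \<forall>h\<in>ess_support G n A. g \<otimes>\<^bsub>G\<^esub> h = h \<otimes>\<^bsub>G\<^esub> g) \<and>
     ((\<exists>\<eta>. pract_iso_elementary G n A \<eta>) \<or> (\<exists>g \<eta>. pract_iso_type2 G n A g \<eta>)) \<and>
     (\<forall>\<eta>. pract_iso_elementary G n A \<eta> \<longrightarrow> is_pract_elementary G n A t \<eta>) \<and>
     (\<forall>g \<eta>. pract_iso_type2 G n A g \<eta> \<longrightarrow>
        (3 \<le> n \<longrightarrow> is_pract_type2 G n A t g \<eta>) \<and>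
        (n = 2 \<and> t \<noteq> t \<otimes>\<^bsub>G\<^esub> t \<and> t \<otimes>\<^bsub>G\<^esub> t = \<one>\<^bsub>G\<^esub> \<longrightarrow>
         (\<exists>\<eta>'. (\<forall>i\<in>{1..<n}. \<eta>' i \<in> carrier G) \<and> graded_iso G n A (gamma2 G n t \<eta>') \<and>
            ((\<forall>h\<in>ess_support G n A. t \<otimes>\<^bsub>G\<^esub> h = h \<otimes>\<^bsub>G\<^esub> t) \<longrightarrow>
             type2_params TYPE('f) G n t \<eta>')))) \<and>
     (CHAR('f) = 2 \<longrightarrow> \<not> (\<exists>g \<eta>. pract_iso_type2 G n A g \<eta>)) \<and>
     (n = 2 \<and> CHAR('f) \<noteq> 2 \<longrightarrow>
        (\<exists>\<eta>. pract_iso_elementary G n A \<eta>) \<and>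
        ((\<exists>g\<in>carrier G. g \<noteq> \<one>\<^bsub>G\<^esub> \<and> g \<otimes>\<^bsub>G\<^esub> g = \<one>\<^bsub>G\<^esub> \<and>
            (\<forall>h\<in>ess_support G n A. g \<otimes>\<^bsub>G\<^esub> h = h \<otimes>\<^bsub>G\<^esub> g)) \<longrightarrow>
         (\<exists>g \<eta>. pract_iso_type2 G n A g \<eta>)))"
proof -
  interpret group G by fact
  interpret graded_UT G n A by unfold_locales (use assms in auto)
  define t where "t = hdeg G A (ident n)"
  have t: "t \<in> carrier G" "ident n \<in> A t" using hdeg_ident by (simp_all add: t_def)
  have cases: "(\<exists>\<eta>. pract_iso_elementary G n A \<eta>) \<or> (\<exists>g \<eta>. pract_iso_type2 G n A g \<eta>)"
    using torus_cases trivial_elementary flip_type2 by blast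
  have comm: "g \<otimes>\<^bsub>G\<^esub> h = h \<otimes>\<^bsub>G\<^esub> g" if "g \<in> ess_support G n A" "h \<in> ess_support G n A" for g h
    using cases elementary_commute[OF _ that] type2_commute[OF _ that] by blast
  have char: "(2::'f) \<noteq> 0" if "pract_iso_type2 G n A g \<eta>" for g \<eta>
    using that type2_paramsD(1) unfolding pract_iso_type2_def by blast
  \<comment> \<open>The two conditions on t give t other than 1, as \<open>central_shift\<close>
    requires.\<close>
  have two_dim: "\<exists>\<eta>'. (\<forall>i\<in>{1..<n}. \<eta>' i \<in> carrier G) \<and> graded_iso G n A (gamma2 G n t \<eta>') \<and>
            ((\<forall>h\<in>ess_support G n A. t \<otimes>\<^bsub>G\<^esub> h = h \<otimes>\<^bsub>G\<^esub> t) \<longrightarrow> type2_params TYPE('f) G n t \<eta>')"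
    if "pract_iso_type2 G n A g \<eta>" "n = 2" "t \<noteq> t \<otimes>\<^bsub>G\<^esub> t" "t \<otimes>\<^bsub>G\<^esub> t = \<one>\<^bsub>G\<^esub>" for g \<eta>
    using type2_graded_iso_2[OF that(2) char[OF that(1)] t _ that(4)] that(3,4) by metis
  have not2: "\<not> (\<exists>g \<eta>. pract_iso_type2 G n A g \<eta>)" if "CHAR('f) = 2"
    using char that two_nonzero_iff[where 'f = 'f] by blast
  have elem2: "\<exists>\<eta>. pract_iso_elementary G n A \<eta>" if "n = 2"
    using trivial_elementary[OF trivial_torus_2[OF that]] by blast
  have type2: "\<exists>g \<eta>. pract_iso_type2 G n A g \<eta>"
    if "n = 2" "CHAR('f) \<noteq> 2" "\<exists>g\<in>carrier G. g \<noteq> \<one>\<^bsub>G\<^esub> \<and> g \<otimes>\<^bsub>G\<^esub> g = \<one>\<^bsub>G\<^esub> \<and>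
            (\<forall>h\<in>ess_support G n A. g \<otimes>\<^bsub>G\<^esub> h = h \<otimes>\<^bsub>G\<^esub> g)"
    using type2_exists_2[OF that(1)] that(2,3) two_nonzero_iff[where 'f = 'f] by blast
  show ?thesis
    unfolding Let_def t_def[symmetric]
    using comm cases elementary_graded_iso[OF _ t] type2_graded_iso[OF _ t] two_dim not2 elem2 type2
    by blast
qed

end
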